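(* Let $S$ be a nonempty finite set of positive integers. Let $\mathcal{S}=\{\pi_{\mathrm{odd}}(z): z\in S\}$, $A=\bigcup_{X\in\mathcal{S}}X$, $n=|A|$, and let $d$ be the dimension over $F=\mathbb{Z}/2\mathbb{Z}$ of the linear span of $v(\mathcal{S})=\{v(X):X\in\mathcal{S}\}$ in $F^n$. Then the set of odd primes $\{p: \chi_p(z)=1 \text{ for all } z\in S\}$ has asymptotic density $2^{-d}$.
   Context: For an integer $z$, $\pi_{\mathrm{odd}}(z)$ is the set of primes dividing $z$ with odd multiplicity. For an odd prime $p$, $\chi_p$ is the Legendre symbol ($\chi_p(m)=0$ if $p\mid m$, $1$ if $\gcd(m,p)=1$ and $m$ is a square mod $p$, $-1$ otherwise). If $A$ is a finite set of positive integers with elements $a_1<\dots<a_n$, the map $v:2^A\to F^n$ sends $B\subseteq A$ to the vector whose $i$-th coordinate is $1$ if $a_i\in B$ and $0$ otherwise (for $n=0$, $F^0=\{0\}$). The asymptotic density of a set $\Pi$ of primes is $\lim_{x\to+\infty}|\{p\in\Pi:p\le x\}|/|\{q \text{ prime}: q\le x\}|$, when this limit exists. *)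

theory Defs
  imports Complex_Main "HOL-Library.Z2" "HOL-Number_Theory.Number_Theory"
    "Jordan_Normal_Form.VS_Connect"
begin

definition pi_odd :: "int \<Rightarrow> nat set" where
  "pi_odd z = {p. prime p \<and> int p dvd z \<and> odd (multiplicity (int p) z)}"

text \<open>The field with two elements is the type \<^typ>\<open>bit\<close>. Vector coordinates are numbered
  from 0: coordinate \<open>i\<close> belongs to the element number \<open>i + 1\<close> of \<open>A\<close> in increasing order.\<close>

definition incidence_vec :: "nat set \<Rightarrow> nat set \<Rightarrow> bit vec" where
  "incidence_vec A B = vec (card A) (\<lambda>i. if sorted_list_of_set A ! i \<in> B then 1 else 0)"

definition span_dim :: "nat \<Rightarrow> 'a::field vec set \<Rightarrow> nat" where
  "span_dim n W = vectorspace.dim class_ring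
     (module.span_vs class_ring (module_vec TYPE('a) n) W)"

text \<open>\<open>P\<close> is meant to be a set of primes; the predicate includes the existence of the limit.\<close>

definition has_prime_density :: "nat set \<Rightarrow> real \<Rightarrow> bool" where
  "has_prime_density P \<delta> \<longleftrightarrow>
     ((\<lambda>x::real. real (card {p \<in> P. real p \<le> x}) / real (card {q::nat. prime q \<and> real q \<le> x}))
        \<longlongrightarrow> \<delta>) at_top"

end

theory Submission
  imports Defs "HOL-Complex_Analysis.Complex_Analysis" "HOL-Computational_Algebra.Squarefree"
    "HOL-Real_Asymp.Real_Asymp"
begin

text \<open>Modulo finitely many primes, a square-free product \<open>m > 1\<close> of primes in \<open>A\<close> gives the
  function \<open>p \<mapsto> (m/p)\<close>, which by quadratic reciprocity extends to a nonprincipal real character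
  \<open>h\<close>. All \<open>z \<in> S\<close> are squares mod \<open>p\<close> iff \<open>(m/p) = 1\<close> for all \<open>m\<close> in the span \<open>W\<close> of
  \<open>v(\<S>)\<close>, and the indicator of this event is the average of the \<open>2^d\<close> values \<open>(m/p)\<close>; so it suffices
  that \<open>\<Sum>\<^sub>p\<^sub>\<le>\<^sub>N h(p) = o(\<pi>(N))\<close>. For this, \<open>L(s,h)\<close> has no zero on \<open>Re s = 1\<close> (the 3-4-1 inequality
  off the real axis, Monsky's Lambert series argument at \<open>s = 1\<close>), so Newman's contour argument applied
  to \<open>1/L\<close> gives \<open>\<Sum>\<^sub>n\<^sub>\<le>\<^sub>N \<mu>(n)h(n) = o(N)\<close>. Because \<open>\<Lambda>h = \<mu>h * h ln\<close> and the partial sums of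
  \<open>h ln\<close> grow only logarithmically, the hyperbola method turns this into \<open>\<Sum>\<^sub>n\<^sub>\<le>\<^sub>N \<Lambda>(n)h(n) = o(N)\<close>,
  and Chebyshev's lower bound for \<open>\<pi>(N)\<close> finishes the proof.\<close>

section \<open>A Tauberian theorem of Newman\<close>

text \<open>The limit is a natural density, so the behaviour of L near s = 1 alone would not
  suffice: the whole line Re s = 1 has to be controlled. Newman's theorem asks for bounded
  coefficients. Those of -L'/L, \<open>mangoldt n * h n\<close>, are unbounded, while those of 1/L
  are bounded by 1; this is why the analysis is done for the twisted Moebius function and the primes
  are recovered afterwards by elementary means. Nonvanishing splits into two cases because the 3-4-1
  inequality at height t needs zeta to stay finite near 1 + 2it, which fails for t = 0. All
  continuation is by Abel summation: bounded partial sums of the coefficients give holomorphy for Re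
  s > 0, and zeta is multiplied by 1 - k^(1-s) to reach this situation. In the final average the
  zero vector contributes the prime count itself up to finitely many primes; a nonzero vector has
  nonempty support, hence a nonprincipal character, and contributes o(N / ln N), which Chebyshev's
  bound compares with the prime count.\<close>

lemma powr_diff_mvt:
  fixes a b e :: real
  assumes "0 < a" "a < b"
  obtains c where "a < c" "c < b" "b powr e - a powr e = (b - a) * (e * c powr (e - 1))"
proof -
  have "\<exists>c>a. c < b \<and> b powr e - a powr e = (b - a) * (e * c powr (e - 1))"
    using assms by (intro MVT2) (auto intro!: derivative_eq_intros)
  then show ?thesis using that by blast
qed

text \<open>The right side is the integral of \<open>t powr (-1 - x)\<close> over [N, M]; the mean
  value theorem on each unit interval replaces integration. Keeping the term at \<open>M\<close>
  makes the bound telescope in the induction.\<close>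

lemma sum_powr_tail_le:
  fixes x :: real
  assumes "x > 0" "N \<ge> 1" "N \<le> M"
  shows "(\<Sum>n=Suc N..M. real n powr (-1 - x)) \<le> (real N powr (-x) - real M powr (-x)) / x"
  using \<open>N \<le> M\<close>
proof (induction M rule: dec_induct)
  case base
  then show ?case by simp
next
  case (step M)
  obtain c where c: "real M < c" "c < real (Suc M)"
    "real (Suc M) powr (-x) - real M powr (-x) = (real (Suc M) - real M) * (-x * c powr (-x - 1))"
    using powr_diff_mvt[of "real M" "real (Suc M)" "-x"] step assms by auto
  have "real (Suc M) powr (-1 - x) \<le> c powr (-1 - x)"
    using c step assms by (intro powr_mono2') auto
  also have "c powr (-1 - x) = (real M powr (-x) - real (Suc M) powr (-x)) / x"
  proof -
    have "real M powr (-x) - real (Suc M) powr (-x) = x * c powr (-1 - x)"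
      using c(3) minus_diff_commute[of x 1] by (simp add: algebra_simps)
    then show ?thesis using assms by (simp add: field_simps)
  qed
  finally show ?case using step by (simp add: diff_divide_distrib)
qed

text \<open>Comparison with the integral of \<open>t powr (y - 1)\<close>. For
  \<open>y \<le> 1\<close> the summands decrease and the integral from 0 dominates. For
  \<open>y > 1\<close> they increase, the integral only covers the terms before \<open>N\<close>,
  and the extra summand is the last term.\<close>

lemma sum_powr_le:
  fixes y :: real
  assumes "y > 0" "N \<ge> 1"
  shows "(\<Sum>n=1..N. real n powr (y - 1)) \<le> real N powr y / y + real N powr (y - 1)"
proof (cases "y \<le> 1")
  case True
  have "(\<Sum>n=1..N. real n powr (y - 1)) \<le> real N powr y / y"
  proof (induction N)
    case 0
    then show ?case by simp
  next
    case (Suc M)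
    have "real (Suc M) powr (y - 1) \<le> (real (Suc M) powr y - real M powr y) / y"
    proof (cases "M = 0")
      case True
      then show ?thesis using \<open>y \<le> 1\<close> assms by simp
    next
      case False
      obtain c where c: "real M < c" "c < real (Suc M)"
        "real (Suc M) powr y - real M powr y = (real (Suc M) - real M) * (y * c powr (y - 1))"
        using powr_diff_mvt[of "real M" "real (Suc M)" y] False by auto
      have "real (Suc M) powr (y - 1) \<le> c powr (y - 1)"
        using c True False by (intro powr_mono2') auto
      also have "\<dots> = (real (Suc M) powr y - real M powr y) / y"
        using c(3) assms by (simp add: field_simps)
      finally show ?thesis .
    qed
    then show ?case using Suc by (simp add: diff_divide_distrib)
  qed
  then show ?thesis by (smt (verit) powr_ge_zero)
next
  case False
  have "(\<Sum>n=1..N. real n powr (y - 1)) \<le> (real N powr y - 1) / y + real N powr (y - 1)"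
    using \<open>N \<ge> 1\<close>
  proof (induction N rule: dec_induct)
    case base
    then show ?case by simp
  next
    case (step M)
    obtain c where c: "real M < c" "c < real (Suc M)"
      "real (Suc M) powr y - real M powr y = (real (Suc M) - real M) * (y * c powr (y - 1))"
      using powr_diff_mvt[of "real M" "real (Suc M)" y] step by auto
    have "real M powr (y - 1) \<le> c powr (y - 1)"
      using c False step by (intro powr_mono2) auto
    also have "\<dots> = (real (Suc M) powr y - real M powr y) / y"
      using c(3) assms by (simp add: field_simps)
    finally show ?case using step by (simp add: diff_divide_distrib)
  qed
  also have "\<dots> \<le> real N powr y / y + real N powr (y - 1)"
    using assms by (simp add: divide_right_mono)
  finally show ?thesis .
qed

lemma norm_of_nat_powr:
  "norm (of_nat n powr z :: complex) = (if n = 0 then 0 else real n powr Re z)"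
proof (cases "n = 0")
  case False
  then show ?thesis using norm_powr_real_powr[of "of_nat n" z] by simp
qed auto

text \<open>Dirichlet series are summed over all \<open>n\<close>, including 0: the term \<open>n = 0\<close> vanishes because
  \<open>0 powr z = 0\<close>.\<close>

lemma dirichlet_partial_sum_bound:
  fixes a :: "nat \<Rightarrow> complex"
  assumes a: "\<And>n. norm (a n) \<le> C" and z: "Re z < 0" and N: "N \<ge> 1"
  shows "norm (\<Sum>n\<le>N. a n * of_nat n powr (-1 - z)) \<le>
           C * (real N powr (- Re z) / (- Re z) + real N powr (- Re z - 1))"
proof -
  have "C \<ge> 0" using a[of 0] norm_ge_zero order_trans by blast
  have "(\<Sum>n\<le>N. a n * of_nat n powr (-1 - z)) = (\<Sum>n=1..N. a n * of_nat n powr (-1 - z))"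
    by (rule sum.mono_neutral_right) auto
  also have "norm \<dots> \<le> (\<Sum>n=1..N. C * real n powr (- Re z - 1))"
  proof (rule sum_norm_le)
    fix n assume "n \<in> {1..N}"
    then show "norm (a n * of_nat n powr (-1 - z)) \<le> C * real n powr (- Re z - 1)"
      using a[of n] by (simp add: norm_mult norm_of_nat_powr mult_right_mono minus_diff_commute)
  qed
  also have "\<dots> = C * (\<Sum>n=1..N. real n powr (- Re z - 1))" by (simp add: sum_distrib_left)
  also have "\<dots> \<le> C * (real N powr (- Re z) / (- Re z) + real N powr (- Re z - 1))"
    using sum_powr_le[of "- Re z" N] z N \<open>C \<ge> 0\<close> by (intro mult_left_mono) auto
  finally show ?thesis .
qed

lemma dirichlet_tail_bound:
  fixes a :: "nat \<Rightarrow> complex"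
  assumes a: "\<And>n. norm (a n) \<le> C" and z: "Re z > 0" and N: "N \<ge> 1"
    and f: "(\<lambda>n. a n * of_nat n powr (-1 - z)) sums F"
  shows "norm (F - (\<Sum>n\<le>N. a n * of_nat n powr (-1 - z))) \<le> C * real N powr (- Re z) / Re z"
proof -
  have "C \<ge> 0" using a[of 0] norm_ge_zero order_trans by blast
  let ?t = "\<lambda>n. a n * of_nat n powr (-1 - z)"
  have lim: "(\<lambda>M. norm ((\<Sum>n\<le>M. ?t n) - (\<Sum>n\<le>N. ?t n))) \<longlonglongrightarrow> norm (F - (\<Sum>n\<le>N. ?t n))"
    using f unfolding sums_def_le by (intro tendsto_intros)
  have "norm ((\<Sum>n\<le>M. ?t n) - (\<Sum>n\<le>N. ?t n)) \<le> C * real N powr (- Re z) / Re z" if "M \<ge> N" for M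
  proof -
    have "(\<Sum>n\<le>M. ?t n) - (\<Sum>n\<le>N. ?t n) = (\<Sum>n=Suc N..M. ?t n)"
    proof -
      have "{..M} = {..N} \<union> {Suc N..M}" using that by auto
      then show ?thesis by (simp add: sum.union_disjoint)
    qed
    also have "norm \<dots> \<le> (\<Sum>n=Suc N..M. C * real n powr (-1 - Re z))"
    proof (rule sum_norm_le)
      fix n assume "n \<in> {Suc N..M}"
      then show "norm (?t n) \<le> C * real n powr (-1 - Re z)"
        using a[of n] by (simp add: norm_mult norm_of_nat_powr mult_right_mono minus_diff_commute)
    qed
    also have "\<dots> = C * (\<Sum>n=Suc N..M. real n powr (-1 - Re z))" by (simp add: sum_distrib_left)
    also have "\<dots> \<le> C * ((real N powr (-Re z) - real M powr (-Re z)) / Re z)"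
      using sum_powr_tail_le[OF z N that] \<open>C \<ge> 0\<close> by (intro mult_left_mono) auto
    also have "\<dots> \<le> C * (real N powr (- Re z) / Re z)"
      using z \<open>C \<ge> 0\<close> by (intro mult_left_mono divide_right_mono) auto
    finally show ?thesis by simp
  qed
  then show ?thesis
    by (intro tendsto_upperbound[OF lim]) (auto simp: eventually_at_top_linorder)
qed

text \<open>On the circle 1/z = cnj z / R^2, so the kernel 1/z + z/R^2 is 2 Re z / R^2. The factor
  Re z cancels the denominators Re z in the bounds for tails and partial sums.\<close>

lemma norm_newman_kernel:
  assumes "norm z = R" "R > 0"
  shows "norm ((1 + z\<^sup>2 / (of_real R)\<^sup>2) / z) = 2 * \<bar>Re z\<bar> / R\<^sup>2"
proof -
  have zz: "z * cnj z = (of_real R)\<^sup>2" using assms by (simp add: complex_norm_square[symmetric])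
  have "z \<noteq> 0" using assms by auto
  have "(1 + z\<^sup>2 / (of_real R)\<^sup>2) / z = (z * cnj z + z\<^sup>2) / ((of_real R)\<^sup>2 * z)"
    unfolding zz using assms by (simp add: field_simps)
  also have "\<dots> = (cnj z + z) / (of_real R)\<^sup>2"
    using \<open>z \<noteq> 0\<close> assms by (simp add: field_simps power2_eq_square)
  also have "cnj z + z = of_real (2 * Re z)" by (simp add: complex_eq_iff)
  finally show ?thesis using assms by (simp add: norm_divide norm_power norm_mult)
qed

text \<open>Parametrized by the angle, the integrand is constant. Two half circles then add up to 2
  pi i c.\<close>

lemma contour_integral_inverse_part_circlepath:
  assumes "r > 0" "s < t"
  shows "((\<lambda>z. c / z) has_contour_integral (c * \<i> * of_real (t - s))) (part_circlepath 0 r s t)"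
proof -
  have "((\<lambda>x. c / (0 + of_real r * cis x) * of_real r * \<i> * cis x) has_integral (t - s) *\<^sub>R (c * \<i>)) {s..t}"
  proof -
    have eq: "(\<lambda>x. c / (0 + of_real r * cis x) * of_real r * \<i> * cis x) = (\<lambda>_. c * \<i>)"
      using assms by (auto simp: field_simps)
    show ?thesis unfolding eq using has_integral_const_real[of "c * \<i>" s t] assms by simp
  qed
  then show ?thesis
    using assms by (subst has_contour_integral_part_circlepath_iff) (auto simp: scaleR_conv_of_real mult_ac)
qed

text \<open>As \<open>f 0 = 0\<close>, the integrand \<open>f(z)N\<^sup>z(1 + z\<^sup>2/R\<^sup>2)/z\<close> has no pole and no winding number is needed.
  The contour leaves the disc to the left along a rectangle of width \<open>\<eta>\<close>; as the bound \<open>M\<close> does not depend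
  on \<open>\<eta>\<close>, one can fix \<open>R\<close>, then \<open>\<eta>\<close>, and then let \<open>N\<close> tend to infinity.\<close>

lemma newman_contour_estimate:
  fixes a :: "nat \<Rightarrow> complex"
  assumes a: "\<And>n. norm (a n) \<le> C"
    and V: "open V" "{z. Re z \<ge> 0} \<subseteq> V" and f: "f holomorphic_on V" and f0: "f 0 = 0"
    and sums: "\<And>z. Re z > 0 \<Longrightarrow> (\<lambda>n. a n * of_nat n powr (-1 - z)) sums f z"
    and R: "R > 0"
  obtains M \<delta> where "\<delta> > 0" "M \<ge> 0"
    "\<And>N \<eta>. N \<ge> 1 \<Longrightarrow> 0 < \<eta> \<Longrightarrow> \<eta> \<le> \<delta> \<Longrightarrow>
       2 * pi * norm (\<Sum>n\<le>N. a n / of_nat n) \<le>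
         2 * C / R * pi + 2 * C / R * (1 + R / real N) * pi + (2 * M * \<eta> + 2 * R * M * real N powr (-\<eta>))"
proof -
  have C0: "C \<ge> 0" using a[of 0] norm_ge_zero order_trans by blast
  \<comment> \<open>Compactness of this segment of the imaginary axis yields one width
    \<open>\<epsilon>\<close> by which the domain of \<open>f\<close> extends to its left.\<close>
  let ?K = "(\<lambda>y. Complex 0 y) ` {-R-1..R+1}"
  have "compact ?K"
    by (intro compact_continuous_image) (auto simp: Complex_eq intro!: continuous_intros)
  moreover have "?K \<subseteq> V" using V by auto
  ultimately obtain \<epsilon> where \<epsilon>: "\<epsilon> > 0" "(\<Union>x\<in>?K. ball x \<epsilon>) \<subseteq> V"
    using compact_subset_open_imp_ball_epsilon_subset[of ?K V] V by blast
  \<comment> \<open>A convex neighbourhood of all the paths for \<open>g\<close>: the right arc and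
    the three sides of the box. Convexity lets the simple form of Cauchy's theorem apply.\<close>
  define U where "U = {z. Re z > - \<epsilon>} \<inter> {z. Im z < R + 1} \<inter> {z. Im z > - R - 1}"
  have UV: "U \<subseteq> V"
  proof
    fix z assume z: "z \<in> U"
    show "z \<in> V"
    proof (cases "Re z \<ge> 0")
      case False
      have "dist (Complex 0 (Im z)) z = \<bar>Re z\<bar>"
        by (simp add: dist_norm cmod_def)
      with z False have "z \<in> ball (Complex 0 (Im z)) \<epsilon>" by (auto simp: U_def)
      moreover have "Complex 0 (Im z) \<in> ?K" using z by (auto simp: U_def)
      ultimately show ?thesis using \<epsilon>(2) by blast
    qed (use V in auto)
  qed
  have "open U" unfolding U_def
    by (intro open_Int open_halfspace_Re_gt open_halfspace_Im_lt open_halfspace_Im_gt)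
  have "convex U" unfolding U_def
    by (intro convex_Int convex_halfspace_Re_gt convex_halfspace_Im_lt convex_halfspace_Im_gt)
  define g where "g = (\<lambda>z. if z = 0 then deriv f 0 else (f z - f 0) / (z - 0))"
  have g: "g holomorphic_on U"
    unfolding g_def by (rule pole_lemma_open) (use f UV holomorphic_on_subset \<open>open U\<close> in auto)
  define \<delta> where "\<delta> = \<epsilon> / 2"
  have \<delta>: "\<delta> > 0" "\<delta> < \<epsilon>" using \<epsilon> by (auto simp: \<delta>_def)
  define Q where "Q = cbox (Complex (-\<delta>) (-R)) (Complex 0 R)"
  have QU: "Q \<subseteq> U" using \<delta> by (auto simp: Q_def U_def in_cbox_complex_iff)
  have "compact Q" unfolding Q_def by (rule compact_cbox)
  moreover have "continuous_on Q (\<lambda>z. g z * (1 + z\<^sup>2 / (of_real R)\<^sup>2))"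
    using R by (intro continuous_intros holomorphic_on_imp_continuous_on holomorphic_on_subset[OF g QU]) auto
  ultimately have "bounded ((\<lambda>z. g z * (1 + z\<^sup>2 / (of_real R)\<^sup>2)) ` Q)"
    using compact_continuous_image compact_imp_bounded by blast
  then obtain M where M: "M > 0" "\<And>z. z \<in> Q \<Longrightarrow> norm (g z * (1 + z\<^sup>2 / (of_real R)\<^sup>2)) \<le> M"
    unfolding bounded_pos by blast
  have "2 * pi * norm (\<Sum>n\<le>N. a n / of_nat n) \<le>
         2 * C / R * pi + 2 * C / R * (1 + R / real N) * pi + (2 * M * \<eta> + 2 * R * M * real N powr (-\<eta>))"
    if N: "N \<ge> 1" and \<eta>: "0 < \<eta>" "\<eta> \<le> \<delta>" for N \<eta>
  proof -
    define A where "A = part_circlepath 0 R (-(pi/2)) (pi/2)"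
    define A' where "A' = part_circlepath 0 R (pi/2) (3*pi/2)"
    define B1 where "B1 = linepath (Complex 0 R) (Complex (-\<eta>) R)"
    define B2 where "B2 = linepath (Complex (-\<eta>) R) (Complex (-\<eta>) (-R))"
    define B3 where "B3 = linepath (Complex (-\<eta>) (-R)) (Complex 0 (-R))"
    have ends: "pathstart A = Complex 0 (-R)" "pathfinish A = Complex 0 R"
      "pathstart A' = Complex 0 R" "pathfinish A' = Complex 0 (-R)"
    proof -
      have e3: "exp (\<i> * (of_real (3*pi/2))) = -\<i>"
      proof -
        have "cos (3*pi/2) = 0" "sin (3*pi/2) = -1"
          using cos_periodic_pi[of "pi/2"] sin_periodic_pi[of "pi/2"] by (simp_all add: add.commute)
        then show ?thesis by (simp add: cis_conv_exp[symmetric] complex_eq_iff del: of_real_mult of_real_divide)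
      qed
      have e1: "exp (\<i> * (of_real (pi/2))) = \<i>" "exp (\<i> * (of_real (-(pi/2)))) = -\<i>"
        by (simp_all add: cis_conv_exp[symmetric] complex_eq_iff del: of_real_mult of_real_divide of_real_minus)
      show "pathstart A = Complex 0 (-R)" "pathfinish A = Complex 0 R"
        "pathstart A' = Complex 0 R" "pathfinish A' = Complex 0 (-R)"
        unfolding A_def A'_def pathstart_part_circlepath pathfinish_part_circlepath e1 e3
        by (simp_all add: complex_eq_iff)
    qed
    have imA: "norm z = R \<and> Re z \<ge> 0" if "z \<in> path_image A" for z
    proof -
      from that obtain x where x: "z = of_real R * exp (\<i> * of_real x)" "-(pi/2) \<le> x" "x \<le> pi/2"
        unfolding A_def by (subst (asm) path_image_part_circlepath) auto
      have "Re z = R * cos x" by (simp add: x(1) cis_conv_exp[symmetric])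
      moreover have "cos x \<ge> 0" using x by (intro cos_ge_zero) auto
      ultimately show ?thesis using R by (simp add: x(1) norm_mult)
    qed
    have imA': "norm z = R \<and> Re z \<le> 0" if "z \<in> path_image A'" for z
    proof -
      from that obtain x where x: "z = of_real R * exp (\<i> * of_real x)" "pi/2 \<le> x" "x \<le> 3*pi/2"
        unfolding A'_def by (subst (asm) path_image_part_circlepath) auto
      have "Re z = R * cos x" by (simp add: x(1) cis_conv_exp[symmetric])
      moreover have "cos (x - pi) \<ge> 0" using x by (intro cos_ge_zero) auto
      then have "cos x \<le> 0" by simp
      ultimately show ?thesis using R by (simp add: x(1) norm_mult mult_nonneg_nonpos)
    qed
    have z_endpoint: "z = Complex 0 R \<or> z = Complex 0 (-R)" if "norm z = R" "Re z = 0" for z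
      using that by (auto simp: complex_eq_iff cmod_def abs_if split: if_splits)
    define w where "w = (\<lambda>z::complex. of_nat N powr z * (1 + z\<^sup>2 / (of_real R)\<^sup>2))"
    have w_hol: "w holomorphic_on X" for X
      unfolding w_def using N R by (intro holomorphic_intros) auto
    have w0: "w 0 = 1" using N by (simp add: w_def)
    define S where "S = (\<lambda>z. \<Sum>n\<le>N. a n * of_nat n powr (-1 - z))"
    have S_hol: "S holomorphic_on X" for X
      unfolding S_def
    proof (intro holomorphic_on_sum)
      fix n
      show "(\<lambda>z. a n * of_nat n powr (-1 - z)) holomorphic_on X"
        by (cases "n = 0") (auto intro!: holomorphic_intros)
    qed
    have S0: "S 0 = (\<Sum>n\<le>N. a n / of_nat n)"
    proof -
      have "a n * of_nat n powr (-1 - 0) = a n / of_nat n" for n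
        by (cases "n = 0") (auto simp: powr_minus field_simps)
      then show ?thesis unfolding S_def by simp
    qed
    have validA: "valid_path A" "valid_path A'" unfolding A_def A'_def by simp_all
    have sphereA: "path_image A \<subseteq> sphere 0 R - {0}" "path_image A' \<subseteq> sphere 0 R - {0}"
      using imA imA' R by (auto simp: dist_norm)
    have integrableA: "h contour_integrable_on A" "h contour_integrable_on A'"
      if "continuous_on (sphere 0 R - {0}) h" for h
      unfolding A_def A'_def
      by (rule contour_integrable_continuous_part_circlepath;
          rule continuous_on_subset[OF that]; use sphereA in \<open>simp add: A_def A'_def\<close>)+
    define I1 where "I1 = contour_integral A (\<lambda>z. S z * w z / z)"
    define I2 where "I2 = contour_integral A' (\<lambda>z. S z * w z / z)"
    have cont_S: "continuous_on (sphere 0 R - {0}) (\<lambda>z. S z * w z / z)"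
      by (intro continuous_intros holomorphic_on_imp_continuous_on S_hol w_hol) auto
    have I1: "((\<lambda>z. S z * w z / z) has_contour_integral I1) A"
      and I2: "((\<lambda>z. S z * w z / z) has_contour_integral I2) A'"
      unfolding I1_def I2_def by (intro has_contour_integral_integral integrableA cont_S)+
    \<comment> \<open>The divided difference of the entire function \<open>S z * w z\<close> is
      entire, so its integral over the full circle vanishes. What remains is the integral of
      \<open>S 0 / z\<close>, computed on the two arcs.\<close>
    have I12: "I1 + I2 = 2 * of_real pi * \<i> * S 0"
    proof -
      define h where "h = (\<lambda>z. if z = 0 then deriv (\<lambda>z. S z * w z) 0 else (S z * w z - S 0 * w 0) / (z - 0))"
      have "h holomorphic_on UNIV"
        unfolding h_def by (rule pole_lemma_open) (auto intro!: holomorphic_intros S_hol w_hol)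
      then have h0: "(h has_contour_integral 0) (A +++ A')"
        by (rule Cauchy_theorem_convex_simple) (use ends validA in \<open>auto intro!: valid_path_join\<close>)
      have c1: "((\<lambda>z. S 0 / z) has_contour_integral (S 0 * \<i> * of_real (pi/2 - (-(pi/2))))) A"
        and c2: "((\<lambda>z. S 0 / z) has_contour_integral (S 0 * \<i> * of_real (3*pi/2 - pi/2))) A'"
        unfolding A_def A'_def using R by (intro contour_integral_inverse_part_circlepath; simp)+
      have "((\<lambda>z. S z * w z / z - S 0 / z) has_contour_integral
               (I1 - S 0 * \<i> * of_real (pi/2 - (-(pi/2))) + (I2 - S 0 * \<i> * of_real (3*pi/2 - pi/2)))) (A +++ A')"
        using ends validA by (intro has_contour_integral_join has_contour_integral_diff I1 I2 c1 c2) auto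
      then have "(h has_contour_integral
               (I1 - S 0 * \<i> * of_real (pi/2 - (-(pi/2))) + (I2 - S 0 * \<i> * of_real (3*pi/2 - pi/2)))) (A +++ A')"
      proof (rule has_contour_integral_eq)
        fix z assume "z \<in> path_image (A +++ A')"
        then have "z \<noteq> 0" using sphereA ends by (auto simp: path_image_join)
        then show "S z * w z / z - S 0 / z = h z" by (simp add: h_def w0 field_simps)
      qed
      from has_contour_integral_unique[OF this h0] show ?thesis
        by (simp add: field_simps)
    qed
    have pathB: "path_image B1 \<subseteq> Q" "path_image B2 \<subseteq> Q" "path_image B3 \<subseteq> Q"
    proof -
      have "convex Q" by (simp add: Q_def)
      then show "path_image B1 \<subseteq> Q" "path_image B2 \<subseteq> Q" "path_image B3 \<subseteq> Q"
        unfolding B1_def B2_def B3_def path_image_linepath using \<eta> R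
        by (intro closed_segment_subset; auto simp: Q_def in_cbox_complex_iff)+
    qed
    have gw_cont: "continuous_on X (\<lambda>z. g z * w z)" if "X \<subseteq> U" for X
      by (intro continuous_intros holomorphic_on_imp_continuous_on w_hol holomorphic_on_subset[OF g that])
    have AU: "path_image A \<subseteq> U"
    proof
      fix z assume "z \<in> path_image A"
      then have "norm z = R" "Re z \<ge> 0" using imA by auto
      then show "z \<in> U" using abs_Im_le_cmod[of z] \<epsilon> by (auto simp: U_def)
    qed
    define J where "J = (\<lambda>p. contour_integral p (\<lambda>z. g z * w z))"
    have JA: "((\<lambda>z. g z * w z) has_contour_integral J A) A"
      unfolding J_def A_def
      by (intro has_contour_integral_integral contour_integrable_continuous_part_circlepath gw_cont)
         (use AU in \<open>simp add: A_def\<close>)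
    have JB: "((\<lambda>z. g z * w z) has_contour_integral J B1) B1"
       "((\<lambda>z. g z * w z) has_contour_integral J B2) B2"
       "((\<lambda>z. g z * w z) has_contour_integral J B3) B3"
      unfolding J_def B1_def B2_def B3_def
      by (intro has_contour_integral_integral contour_integrable_continuous_linepath gw_cont;
          use pathB QU in \<open>auto simp: B1_def B2_def B3_def\<close>)+
    \<comment> \<open>For \<open>f\<close> the left arc is replaced by three sides of the box,
      inside the domain where \<open>g\<close> is holomorphic.\<close>
    have Jsum: "J A + (J B1 + (J B2 + J B3)) = 0"
    proof -
      have v: "valid_path B1" "valid_path B2" "valid_path B3" by (simp_all add: B1_def B2_def B3_def)
      have e: "pathstart B1 = Complex 0 R" "pathfinish B1 = pathstart B2" "pathfinish B2 = pathstart B3"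
        "pathfinish B3 = Complex 0 (-R)" by (simp_all add: B1_def B2_def B3_def)
      have "((\<lambda>z. g z * w z) has_contour_integral (J A + (J B1 + (J B2 + J B3)))) (A +++ B1 +++ B2 +++ B3)"
        using e ends v validA by (intro has_contour_integral_join JA JB valid_path_join) auto
      moreover have "((\<lambda>z. g z * w z) has_contour_integral 0) (A +++ B1 +++ B2 +++ B3)"
      proof (rule Cauchy_theorem_convex_simple)
        show "(\<lambda>z. g z * w z) holomorphic_on U" by (intro holomorphic_intros g w_hol)
        show "path_image (A +++ B1 +++ B2 +++ B3) \<subseteq> U"
          using e ends subset_trans[OF pathB(1) QU] subset_trans[OF pathB(2) QU] subset_trans[OF pathB(3) QU] AU
            by (simp add: path_image_join)
      qed (use e ends v validA \<open>convex U\<close> in \<open>auto intro!: valid_path_join\<close>)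
      ultimately show ?thesis by (rule has_contour_integral_unique)
    qed
    have gw_bound: "norm (g z * w z) \<le> M * real N powr Re z" if "z \<in> Q" for z
    proof -
      have "norm (g z * w z) = norm (g z * (1 + z\<^sup>2 / (of_real R)\<^sup>2)) * norm (of_nat N powr z :: complex)"
        by (simp add: w_def norm_mult)
      also have "\<dots> \<le> M * norm (of_nat N powr z :: complex)"
        using M(2)[OF that] by (intro mult_right_mono) auto
      also have "norm (of_nat N powr z :: complex) = real N powr Re z" using N by (simp add: norm_of_nat_powr)
      finally show ?thesis .
    qed
    \<comment> \<open>For the horizontal sides \<open>N powr z\<close> is bounded by 1 in norm and
      the smallness comes from their length \<open>\<eta>\<close>. The far vertical side has length
      \<open>2 * R\<close> and gets its decay from \<open>N powr (-\<eta>)\<close>.\<close>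
    have segment_bound: "norm (J (linepath a b)) \<le> M * norm (b - a)"
      if "((\<lambda>z. g z * w z) has_contour_integral J (linepath a b)) (linepath a b)" "path_image (linepath a b) \<subseteq> Q" for a b
      using that(1)
    proof (rule has_contour_integral_bound_linepath)
      fix z assume "z \<in> closed_segment a b"
      then have zQ: "z \<in> Q" using that by auto
      then have "real N powr Re z \<le> real N powr 0" using N by (intro powr_mono) (auto simp: Q_def in_cbox_complex_iff)
      then have "M * real N powr Re z \<le> M" using M N by simp
      then show "norm (g z * w z) \<le> M" using gw_bound[OF zQ] by linarith
    qed (use M in auto)
    have B1bd: "norm (J B1) \<le> M * \<eta>"
    proof -
      have "norm (J B1) \<le> M * norm (Complex (-\<eta>) R - Complex 0 R)"
        using JB(1) pathB(1) unfolding B1_def by (rule segment_bound)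
      also have "Complex (-\<eta>) R - Complex 0 R = of_real (-\<eta>)" by (simp add: complex_eq_iff)
      finally show ?thesis using \<eta> by simp
    qed
    have B3bd: "norm (J B3) \<le> M * \<eta>"
    proof -
      have "norm (J B3) \<le> M * norm (Complex 0 (-R) - Complex (-\<eta>) (-R))"
        using JB(3) pathB(3) unfolding B3_def by (rule segment_bound)
      also have "Complex 0 (-R) - Complex (-\<eta>) (-R) = of_real \<eta>" by (simp add: complex_eq_iff)
      finally show ?thesis using \<eta> by simp
    qed
    have B2bd: "norm (J B2) \<le> 2 * R * M * real N powr (-\<eta>)"
    proof -
      have "norm (J B2) \<le> (M * real N powr (-\<eta>)) * norm (Complex (-\<eta>) (-R) - Complex (-\<eta>) R)"
      proof (rule has_contour_integral_bound_linepath)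
        fix z assume z: "z \<in> closed_segment (Complex (-\<eta>) R) (Complex (-\<eta>) (-R))"
        then have zQ: "z \<in> Q" using pathB by (auto simp: B2_def)
        obtain u where zu: "z = (1 - u) *\<^sub>R Complex (-\<eta>) R + u *\<^sub>R Complex (-\<eta>) (-R)"
          using z unfolding closed_segment_def by auto
        have "Re z = -\<eta>" unfolding zu by (simp add: algebra_simps)
        then show "norm (g z * w z) \<le> M * real N powr (-\<eta>)" using gw_bound[OF zQ] by simp
      qed (use JB M in \<open>auto simp: B2_def\<close>)
      also have "Complex (-\<eta>) (-R) - Complex (-\<eta>) R = of_real (-2*R) * \<i>" by (simp add: complex_eq_iff)
      finally show ?thesis using R by (simp add: norm_mult mult_ac)
    qed
    have kernel: "norm (w z / z) = real N powr Re z * (2 * \<bar>Re z\<bar> / R\<^sup>2)" if "norm z = R" for z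
    proof -
      have "norm (w z / z) = norm (of_nat N powr z :: complex) * norm ((1 + z\<^sup>2 / (of_real R)\<^sup>2) / z)"
        by (simp add: w_def norm_mult norm_divide)
      then show ?thesis using norm_newman_kernel[OF that R] N by (simp add: norm_of_nat_powr)
    qed
    \<comment> \<open>The tail bound has the factor N^(-Re z) / Re z, the kernel N^(Re z) Re z, so
      the product is a constant. The tail bound needs Re z > 0; the two ends of the arc are exempted
      by the strong form of the arc estimate.\<close>
    have D: "norm (J A - I1) \<le> (2 * C / R\<^sup>2) * R * (pi/2 - (-(pi/2)))"
    proof (rule has_contour_integral_bound_part_circlepath_strong)
      show "((\<lambda>z. g z * w z - S z * w z / z) has_contour_integral (J A - I1)) (part_circlepath 0 R (-(pi/2)) (pi/2))"
        using has_contour_integral_diff[OF JA I1] by (simp add: A_def)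
      fix z assume z: "z \<in> path_image (part_circlepath 0 R (-(pi/2)) (pi/2)) - {Complex 0 R, Complex 0 (-R)}"
      then have z1: "norm z = R" "Re z \<ge> 0" using imA by (auto simp: A_def)
      then have pos: "Re z > 0" using z_endpoint[of z] z by force
      have "z \<noteq> 0" using z1 R by auto
      have "g z * w z - S z * w z / z = (f z - S z) * (w z / z)"
        using \<open>z \<noteq> 0\<close> by (simp add: g_def f0 field_simps)
      also have "norm \<dots> \<le> (C * real N powr (- Re z) / Re z) * (real N powr Re z * (2 * \<bar>Re z\<bar> / R\<^sup>2))"
        unfolding norm_mult kernel[OF z1(1)]
        using dirichlet_tail_bound[OF a pos N sums[OF pos]] unfolding S_def
        by (intro mult_right_mono) auto
      also have "\<dots> = 2 * C / R\<^sup>2 * (real N powr (- Re z) * real N powr Re z)" using pos by (simp add: field_simps)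
      also have "real N powr (- Re z) * real N powr Re z = 1" using N by (simp add: powr_add[symmetric])
      finally show "norm (g z * w z - S z * w z / z) \<le> 2 * C / R\<^sup>2" by simp
    qed (use R C0 in auto)
    \<comment> \<open>The same cancellation for the partial sum alone on the left arc. The second
      term of \<open>dirichlet_partial_sum_bound\<close> leaves the correction
      \<open>R / N\<close>.\<close>
    have E: "norm I2 \<le> (2 * C / R\<^sup>2 * (1 + R / real N)) * R * (3*pi/2 - pi/2)"
    proof (rule has_contour_integral_bound_part_circlepath_strong)
      show "((\<lambda>z. S z * w z / z) has_contour_integral I2) (part_circlepath 0 R (pi/2) (3*pi/2))"
        using I2 by (simp add: A'_def)
      fix z assume z: "z \<in> path_image (part_circlepath 0 R (pi/2) (3*pi/2)) - {Complex 0 R, Complex 0 (-R)}"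
      then have z1: "norm z = R" "Re z \<le> 0" using imA' by (auto simp: A'_def)
      then have neg: "Re z < 0" using z_endpoint[of z] z by force
      have "norm (S z * w z / z) = norm (S z) * norm (w z / z)" by (simp add: norm_mult norm_divide)
      also have "\<dots> \<le> (C * (real N powr (- Re z) / (- Re z) + real N powr (- Re z - 1))) * (real N powr Re z * (2 * \<bar>Re z\<bar> / R\<^sup>2))"
        unfolding kernel[OF z1(1)]
        using dirichlet_partial_sum_bound[OF a neg N] unfolding S_def
        by (intro mult_right_mono) auto
      also have "\<dots> = 2 * C / R\<^sup>2 * (real N powr (- Re z) * real N powr Re z + (- Re z) * (real N powr (-Re z - 1) * real N powr Re z))"
      proof -
        have *: "(C * (p / u + q)) * (v * (2 * u / R\<^sup>2)) = 2 * C / R\<^sup>2 * (p * v + u * (q * v))"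
          if "u \<noteq> 0" for p q u v :: real
          using that R by (simp add: field_simps)
        have "\<bar>Re z\<bar> = - Re z" using neg by simp
        then show ?thesis using neg by (simp only:) (rule *, simp)
      qed
      also have "real N powr (- Re z) * real N powr Re z = 1" using N by (simp add: powr_add[symmetric])
      also have "real N powr (-Re z - 1) * real N powr Re z = 1 / real N"
        using N by (simp add: powr_add[symmetric] powr_minus field_simps)
      also have "2 * C / R\<^sup>2 * (1 + (- Re z) * (1 / real N)) \<le> 2 * C / R\<^sup>2 * (1 + R / real N)"
        using abs_Re_le_cmod[of z] z1 N C0 by (intro mult_left_mono add_left_mono) (auto simp: divide_simps)
      finally show "norm (S z * w z / z) \<le> 2 * C / R\<^sup>2 * (1 + R / real N)" .
    qed (use R C0 in auto)
    \<comment> \<open>By \<open>I12\<close> the left side is \<open>I1 + I2\<close>; subtracting the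
      vanishing sum of \<open>Jsum\<close> pairs \<open>I1\<close> with \<open>J A\<close>, so that
      only the tail \<open>f - S\<close> occurs on the right arc.\<close>
    have "2 * of_real pi * \<i> * S 0 = - (J A - I1) + I2 - (J B1 + (J B2 + J B3))"
      using I12 Jsum by (simp add: algebra_simps eq_neg_iff_add_eq_0)
    then have "2 * pi * norm (S 0) = norm (- (J A - I1) + I2 - (J B1 + (J B2 + J B3)))"
      by (metis (no_types, opaque_lifting) mult.commute mult.left_commute norm_mult norm_ii norm_numeral norm_of_real abs_of_pos pi_gt_zero mult.right_neutral)
    also have "\<dots> \<le> norm (J A - I1) + norm I2 + (norm (J B1) + (norm (J B2) + norm (J B3)))"
      by norm
    also have "\<dots> \<le> 2 * C / R * pi + 2 * C / R * (1 + R / real N) * pi + (M * \<eta> + (2 * R * M * real N powr (-\<eta>) + M * \<eta>))"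
      using D E B1bd B2bd B3bd R by (intro add_mono) (auto simp: power2_eq_square)
    finally show ?thesis unfolding S0 by (simp add: algebra_simps)
  qed
  then show ?thesis using \<delta>(1) less_imp_le[OF M(1)] by (rule that[rotated 2])
qed


lemma newman_limit_zero:
  fixes a :: "nat \<Rightarrow> complex"
  assumes a: "\<And>n. norm (a n) \<le> C"
    and V: "open V" "{z. Re z \<ge> 0} \<subseteq> V" and f: "f holomorphic_on V" and f0: "f 0 = 0"
    and sums: "\<And>z. Re z > 0 \<Longrightarrow> (\<lambda>n. a n * of_nat n powr (-1 - z)) sums f z"
  shows "(\<lambda>N. \<Sum>n\<le>N. a n / of_nat n) \<longlonglongrightarrow> 0"
proof (rule LIMSEQ_I)
  fix e :: real assume e: "e > 0"
  have C0: "C \<ge> 0" using a[of 0] norm_ge_zero order_trans by blast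
  \<comment> \<open>The arcs contribute at most \<open>4 * pi * (C / R)\<close>, hence at most
    \<open>pi * e\<close>; the sides of length \<open>\<eta>\<close> and the terms vanishing with
    \<open>N\<close> get \<open>e\<close> each. The total is below \<open>2 * pi * e\<close> because
    \<open>pi > 2\<close>.\<close>
  define R where "R = 4 * (C + 1) / e"
  have R: "R > 0" using C0 e by (simp add: R_def)
  obtain M \<delta> where M: "\<delta> > 0" "M \<ge> 0"
    "\<And>N \<eta>. N \<ge> 1 \<Longrightarrow> 0 < \<eta> \<Longrightarrow> \<eta> \<le> \<delta> \<Longrightarrow>
       2 * pi * norm (\<Sum>n\<le>N. a n / of_nat n) \<le>
         2 * C / R * pi + 2 * C / R * (1 + R / real N) * pi + (2 * M * \<eta> + 2 * R * M * real N powr (-\<eta>))"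
    by (rule newman_contour_estimate[OF a V f f0 sums R]) (assumption, (rule that; assumption))
  define \<eta> where "\<eta> = min \<delta> (e / (2 * (M + 1)))"
  have \<eta>: "\<eta> > 0" "\<eta> \<le> \<delta>" using M e by (auto simp: \<eta>_def)
  have "2 * M * \<eta> \<le> 2 * M * (e / (2 * (M + 1)))" using M by (intro mult_left_mono) (auto simp: \<eta>_def)
  also have "\<dots> \<le> e" using M e by (simp add: field_simps)
  finally have M\<eta>: "2 * M * \<eta> \<le> e" .
  have CR: "C / R \<le> e / 4" using C0 e by (simp add: R_def field_simps)
  have "(\<lambda>N. 2 * C * pi * (1 / real N) + 2 * R * M * real N powr (-\<eta>)) \<longlonglongrightarrow> 2 * C * pi * 0 + 2 * R * M * 0"
    using \<eta> by (intro tendsto_intros lim_1_over_n tendsto_neg_powr filterlim_real_sequentially) auto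
  then have "eventually (\<lambda>N. 2 * C * pi * (1 / real N) + 2 * R * M * real N powr (-\<eta>) < e) sequentially"
    using e by (intro order_tendstoD) auto
  then obtain N0 where N0: "\<And>N. N \<ge> N0 \<Longrightarrow> 2 * C * pi * (1 / real N) + 2 * R * M * real N powr (-\<eta>) < e"
    unfolding eventually_sequentially by blast
  show "\<exists>no. \<forall>N\<ge>no. norm ((\<Sum>n\<le>N. a n / of_nat n) - 0) < e"
  proof (intro exI[of _ "max 1 N0"] allI impI)
    fix N assume N: "N \<ge> max 1 N0"
    have "2 * pi * norm (\<Sum>n\<le>N. a n / of_nat n) \<le>
         2 * C / R * pi + 2 * C / R * (1 + R / real N) * pi + (2 * M * \<eta> + 2 * R * M * real N powr (-\<eta>))"
      using M(3)[of N \<eta>] \<eta> N by auto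
    also have "\<dots> = 4 * pi * (C / R) + 2 * M * \<eta> + (2 * C * pi * (1 / real N) + 2 * R * M * real N powr (-\<eta>))"
      using R N by (simp add: field_simps)
    also have "\<dots> < 4 * pi * (e / 4) + e + e"
      using N0[of N] N M\<eta> CR by (intro add_le_less_mono add_mono mult_left_mono) auto
    also have "\<dots> < 2 * pi * e"
    proof -
      have "2 * e < pi * e" using pi_gt3 e by (intro mult_strict_right_mono) auto
      then show ?thesis by simp
    qed
    finally show "norm ((\<Sum>n\<le>N. a n / of_nat n) - 0) < e" using e by simp
  qed
qed

text \<open>The substitution s = 1 + z moves the critical point to 0. Lowering the coefficient of n
  = 1 by \<open>G 1\<close> lowers the function by the constant \<open>G 1\<close>, which makes it
  vanish there as \<open>newman_limit_zero\<close> requires.\<close>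

theorem newman_tauberian:
  fixes a :: "nat \<Rightarrow> complex"
  assumes a: "\<And>n. norm (a n) \<le> C"
    and V: "open V" "{s. Re s \<ge> 1} \<subseteq> V" and G: "G holomorphic_on V"
    and sums: "\<And>s. Re s > 1 \<Longrightarrow> (\<lambda>n. a n * of_nat n powr (-s)) sums G s"
  shows "(\<lambda>n. a n / of_nat n) sums G 1"
proof -
  define a' where "a' = a(1 := a 1 - G 1)"
  have "norm (a' n) \<le> C + norm (G 1)" for n
    using a[of n] norm_triangle_ineq4[of "a 1" "G 1"] by (auto simp: a'_def intro: add_increasing2)
  moreover have "open ((\<lambda>z. 1 + z) -` V)"
    by (rule continuous_open_vimage[OF V(1)]) (intro continuous_intros)
  moreover have "{z. Re z \<ge> 0} \<subseteq> (\<lambda>z. 1 + z) -` V" using V(2) by (auto intro!: subsetD[OF V(2)])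
  moreover have "(\<lambda>z. G (1 + z) - G 1) holomorphic_on ((\<lambda>z. 1 + z) -` V)"
  proof (intro holomorphic_on_diff holomorphic_on_const)
    have "(G \<circ> (\<lambda>z. 1 + z)) holomorphic_on ((\<lambda>z. 1 + z) -` V)"
      by (rule holomorphic_on_compose_gen[OF _ G]) (auto intro!: holomorphic_intros)
    then show "(\<lambda>z. G (1 + z)) holomorphic_on ((\<lambda>z. 1 + z) -` V)" by (simp add: o_def)
  qed
  moreover have "(\<lambda>n. a' n * of_nat n powr (-1 - z)) sums (G (1 + z) - G 1)" if "Re z > 0" for z
  proof -
    have "(\<lambda>n. a n * of_nat n powr (-(1 + z)) - (if n = 1 then G 1 else 0)) sums (G (1 + z) - G 1)"
      using that by (intro sums_diff sums sums_single) auto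
    also have "(\<lambda>n. a n * of_nat n powr (-(1 + z)) - (if n = 1 then G 1 else 0)) = (\<lambda>n. a' n * of_nat n powr (-1 - z))"
      by (auto simp: a'_def fun_eq_iff)
    finally show ?thesis .
  qed
  ultimately have "(\<lambda>N. \<Sum>n\<le>N. a' n / of_nat n) \<longlonglongrightarrow> 0"
    by (intro newman_limit_zero[where C = "C + norm (G 1)" and V = "(\<lambda>z. 1 + z) -` V" and f = "\<lambda>z. G (1 + z) - G 1"]) auto
  then have "(\<lambda>n. a' n / of_nat n) sums 0" by (simp add: sums_def_le)
  moreover have "(\<lambda>n. if n = 1 then G 1 else 0) sums G 1" by (rule sums_single)
  ultimately have "(\<lambda>n. a' n / of_nat n + (if n = 1 then G 1 else 0)) sums (0 + G 1)" by (rule sums_add)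
  also have "(\<lambda>n. a' n / of_nat n + (if n = 1 then G 1 else 0)) = (\<lambda>n. a n / of_nat n)"
    by (auto simp: a'_def fun_eq_iff)
  finally show ?thesis by simp
qed

section \<open>From convergent series to sublinear partial sums\<close>

lemma cesaro_zero:
  fixes t :: "nat \<Rightarrow> 'a :: real_normed_field"
  assumes "t \<longlonglongrightarrow> 0"
  shows "(\<lambda>N. (\<Sum>n<N. t n) / of_nat N) \<longlonglongrightarrow> 0"
proof (rule LIMSEQ_I)
  fix e :: real assume e: "e > 0"
  obtain n0 where n0: "\<And>n. n \<ge> n0 \<Longrightarrow> norm (t n) < e / 2"
    using LIMSEQ_D[OF assms, of "e / 2"] e by auto
  define B where "B = (\<Sum>n<n0. norm (t n))"
  have B: "B \<ge> 0" by (simp add: B_def sum_nonneg)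
  obtain N0 where N0: "real N0 > 2 * B / e" using reals_Archimedean2 by blast
  show "\<exists>no. \<forall>N\<ge>no. norm ((\<Sum>n<N. t n) / of_nat N - 0) < e"
  proof (intro exI[of _ "max 1 (max n0 N0)"] allI impI)
    fix N assume N: "N \<ge> max 1 (max n0 N0)"
    have "{..<N} = {..<n0} \<union> {n0..<N}" using N by auto
    then have "(\<Sum>n<N. t n) = (\<Sum>n<n0. t n) + (\<Sum>n=n0..<N. t n)"
      by (metis finite_lessThan finite_atLeastLessThan ivl_disj_int_one(2) sum.union_disjoint)
    also have "norm \<dots> \<le> norm (\<Sum>n<n0. t n) + norm (\<Sum>n=n0..<N. t n)" by (rule norm_triangle_ineq)
    also have "norm (\<Sum>n<n0. t n) \<le> B" unfolding B_def by (rule norm_sum)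
    also have "norm (\<Sum>n=n0..<N. t n) \<le> (\<Sum>n=n0..<N. e / 2)"
      using n0 by (intro sum_norm_le) (auto intro: less_imp_le)
    also have "\<dots> \<le> real N * (e / 2)" using e by (simp add: mult_right_mono)
    also have "B < real N * (e / 2)"
    proof -
      have "2 * B / e < real N" using N0 N by linarith
      then show ?thesis using e by (simp add: field_simps)
    qed
    finally have "norm (\<Sum>n<N. t n) < real N * e" by (simp add: field_simps)
    then show "norm ((\<Sum>n<N. t n) / of_nat N - 0) < e"
      using N by (simp add: norm_divide field_simps)
  qed
qed

text \<open>A case of Kronecker's lemma. By Abel summation the quotient is \<open>S N\<close> minus
  the mean of the earlier \<open>S n\<close>, and both have the limit \<open>G\<close>.\<close>

lemma sum_sublinear_of_sums:
  fixes a :: "nat \<Rightarrow> complex"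
  assumes "(\<lambda>n. a n / of_nat n) sums G" "a 0 = 0"
  shows "(\<lambda>N. (\<Sum>n\<le>N. a n) / of_nat N) \<longlonglongrightarrow> 0"
proof -
  define S where "S = (\<lambda>N. \<Sum>n\<le>N. a n / of_nat n)"
  have S: "S \<longlonglongrightarrow> G" using assms(1) by (simp add: sums_def_le S_def)
  have abel: "(\<Sum>n\<le>N. a n) = of_nat N * S N - (\<Sum>n<N. S n)" for N
  proof (induction N)
    case (Suc N)
    have "S (Suc N) = S N + a (Suc N) / of_nat (Suc N)" by (simp add: S_def)
    then have "of_nat (Suc N) * S (Suc N) = of_nat (Suc N) * S N + a (Suc N)" 
      by (simp add: distrib_left del: of_nat_Suc)
    then show ?case using Suc by (simp add: algebra_simps)
  qed (use assms in \<open>simp add: S_def\<close>)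
  have cesaro: "(\<lambda>N. (\<Sum>n<N. S n) / of_nat N) \<longlonglongrightarrow> G"
  proof -
    have "(\<lambda>N. (\<Sum>n<N. S n - G) / of_nat N + G) \<longlonglongrightarrow> 0 + G"
      by (intro tendsto_add tendsto_const cesaro_zero) (use S LIM_zero in blast)
    moreover have "eventually (\<lambda>N. (\<Sum>n<N. S n - G) / of_nat N + G = (\<Sum>n<N. S n) / of_nat N) sequentially"
      using eventually_gt_at_top[of 0] by eventually_elim (simp add: sum_subtractf field_simps)
    ultimately show ?thesis by (simp add: Lim_transform_eventually)
  qed
  have "(\<lambda>N. S N - (\<Sum>n<N. S n) / of_nat N) \<longlonglongrightarrow> G - G"
    by (intro tendsto_diff S cesaro)
  moreover have "eventually (\<lambda>N. S N - (\<Sum>n<N. S n) / of_nat N = (\<Sum>n\<le>N. a n) / of_nat N) sequentially"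
    using eventually_gt_at_top[of 0] by eventually_elim (simp add: abel field_simps)
  ultimately show ?thesis by (simp add: Lim_transform_eventually)
qed

section \<open>L-functions of real characters off the real axis\<close>

text \<open>The Dirichlet series with coefficients \<open>b\<close> after Abel summation. In this
  form it converges absolutely for Re s > 0 as soon as the partial sums of \<open>b\<close> are
  bounded. If \<open>b 0 = 0\<close>, the term n = 0 vanishes.\<close>

definition dirichlet_fun :: "(nat \<Rightarrow> complex) \<Rightarrow> complex \<Rightarrow> complex" where
  "dirichlet_fun b s = (\<Sum>n. (\<Sum>k\<le>n. b k) * (of_nat n powr (-s) - of_nat (Suc n) powr (-s)))"

lemma norm_powr_diff_le:
  assumes "n > 0" "Re s > 0"
  shows "norm (of_nat n powr (-s) - of_nat (Suc n) powr (-s) :: complex) \<le> norm s * real n powr (- Re s - 1)"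
proof -
  have pos: "Re z \<ge> real n" "Im z = 0" if "z \<in> closed_segment (of_nat n) (of_nat (Suc n) :: complex)" for z
  proof -
    obtain u where u: "0 \<le> u" "z = (1 - u) *\<^sub>R of_nat n + u *\<^sub>R (of_nat (Suc n) :: complex)"
      using \<open>z \<in> _\<close> unfolding closed_segment_def by auto
    then show "Re z \<ge> real n" "Im z = 0" by (auto simp: u(2) algebra_simps)
  qed
  have "norm (of_nat n powr (-s) - of_nat (Suc n) powr (-s) :: complex)
      \<le> (norm s * real n powr (- Re s - 1)) * norm (of_nat n - of_nat (Suc n) :: complex)"
  proof (rule field_differentiable_bound[of "closed_segment (of_nat n) (of_nat (Suc n))" "\<lambda>z. z powr (-s)"
        "\<lambda>z. -s * z powr (-s - 1)"])
    fix z :: complex assume z: "z \<in> closed_segment (of_nat n) (of_nat (Suc n))"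
    have z0: "z \<notin> \<real>\<^sub>\<le>\<^sub>0" using pos[OF z] assms complex_nonpos_Reals_iff by force
    show "((\<lambda>z. z powr (-s)) has_field_derivative -s * z powr (-s - 1))
        (at z within closed_segment (of_nat n) (of_nat (Suc n)))"
      using z0 by (auto intro!: derivative_eq_intros)
    have "norm (z powr (-s - 1)) = Re z powr (- Re s - 1)"
      using norm_powr_real_powr[of z "-s - 1"] pos[OF z] assms by (simp add: complex_is_Real_iff)
    also have "\<dots> \<le> real n powr (- Re s - 1)" using pos[OF z] assms by (intro powr_mono2') auto
    finally show "norm (-s * z powr (-s - 1)) \<le> norm s * real n powr (- Re s - 1)"
      by (simp add: norm_mult mult_left_mono)
  qed auto
  then show ?thesis by simp
qed

lemma dirichlet_fun_term_le:
  fixes b :: "nat \<Rightarrow> complex"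
  assumes "b 0 = 0" "\<And>N. norm (\<Sum>n\<le>N. b n) \<le> C" "Re s > 0"
  shows "norm ((\<Sum>k\<le>n. b k) * (of_nat n powr (-s) - of_nat (Suc n) powr (-s))) \<le>
     C * norm s * real n powr (- Re s - 1)"
proof (cases "n = 0")
  case False
  then show ?thesis
    using mult_mono[OF assms(2)[of n] norm_powr_diff_le[of n s]] assms(3) norm_ge_zero[of "\<Sum>k\<le>0. b k"]
      order_trans[OF norm_ge_zero assms(2)[of 0]]
    by (simp add: norm_mult mult_ac)
qed (use assms in auto)

lemma dirichlet_fun_holomorphic:
  fixes b :: "nat \<Rightarrow> complex"
  assumes "b 0 = 0" "\<And>N. norm (\<Sum>n\<le>N. b n) \<le> C"
  shows "dirichlet_fun b holomorphic_on {s. Re s > 0}"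
proof (rule holomorphic_uniform_sequence)
  show "open {s. Re s > 0}" by (rule open_halfspace_Re_gt)
  let ?t = "\<lambda>n s. (\<Sum>k\<le>n. b k) * (of_nat n powr (-s) - of_nat (Suc n) powr (-s))"
  show "(\<lambda>s. \<Sum>n<N. ?t n s) holomorphic_on {s. Re s > 0}" for N
  proof (intro holomorphic_on_sum)
    show "?t n holomorphic_on {s. Re s > 0}" for n
      using assms(1) by (cases "n = 0") (auto intro!: holomorphic_intros simp del: of_nat_Suc)
  qed
  fix s assume "s \<in> {s. Re s > 0}"
  then have s: "Re s > 0" by simp
  \<comment> \<open>Half the distance to the imaginary axis: on the disc Re z is at least
    \<open>d\<close>, so one summable majorant with exponent \<open>-d - 1\<close> serves all its
    points.\<close>
  define d where "d = Re s / 2"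
  have C: "C \<ge> 0" using order_trans[OF norm_ge_zero assms(2)[of 0]] .
  have z: "Re z \<ge> d \<and> norm z \<le> norm s + d" if "z \<in> cball s d" for z
  proof -
    have "norm (s - z) \<le> d" using that by (simp add: dist_norm)
    then show ?thesis using abs_Re_le_cmod[of "s - z"] norm_triangle_ineq2[of z s] by (auto simp: d_def norm_minus_commute field_simps abs_le_iff)
  qed
  show "\<exists>d>0. cball s d \<subseteq> {s. 0 < Re s} \<and>
      uniform_limit (cball s d) (\<lambda>N s. \<Sum>n<N. ?t n s) (dirichlet_fun b) sequentially"
  proof (intro exI[of _ d] conjI)
    show "d > 0" using s by (simp add: d_def)
    then show "cball s d \<subseteq> {s. 0 < Re s}" using z by force
    show "uniform_limit (cball s d) (\<lambda>N s. \<Sum>n<N. ?t n s) (dirichlet_fun b) sequentially"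
      unfolding dirichlet_fun_def
    proof (rule Weierstrass_m_test)
      show "summable (\<lambda>n. C * (norm s + d) * real n powr (-d - 1))"
        using \<open>d > 0\<close> by (intro summable_mult) (simp add: summable_real_powr_iff)
      fix n w assume w: "w \<in> cball s d"
      have "norm (?t n w) \<le> C * norm w * real n powr (- Re w - 1)"
        using z[OF w] \<open>d > 0\<close> by (intro dirichlet_fun_term_le assms) auto
      also have "\<dots> \<le> C * (norm s + d) * real n powr (- d - 1)"
      proof (cases "n = 0")
        case False
        then show ?thesis using z[OF w] C \<open>d > 0\<close> by (intro mult_mono powr_mono) auto
      qed auto
      finally show "norm (?t n w) \<le> C * (norm s + d) * real n powr (- d - 1)" .
    qed
  qed
qed

text \<open>Abel summation leaves the boundary term (b 0 + ... + b N) (N+1)^(-s), which vanishes in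
  the limit since the partial sums are bounded and Re s > 0.\<close>

lemma dirichlet_fun_sums:
  fixes b :: "nat \<Rightarrow> complex"
  assumes b: "b 0 = 0" "\<And>N. norm (\<Sum>n\<le>N. b n) \<le> C" and s: "Re s > 0"
  shows "(\<lambda>n. b n * of_nat n powr (-s)) sums dirichlet_fun b s"
proof -
  let ?t = "\<lambda>n. (\<Sum>k\<le>n. b k) * (of_nat n powr (-s) - of_nat (Suc n) powr (-s))"
  have abel: "(\<Sum>n\<le>N. b n * of_nat n powr (-s)) = (\<Sum>k\<le>N. b k) * of_nat (Suc N) powr (-s) + (\<Sum>n\<le>N. ?t n)" for N
    by (induction N) (auto simp: b(1) algebra_simps)
  have "summable ?t"
  proof (rule summable_comparison_test')
    show "summable (\<lambda>n. C * norm s * real n powr (- Re s - 1))"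
      using s by (intro summable_mult) (simp add: summable_real_powr_iff)
  qed (rule dirichlet_fun_term_le[OF b s])
  then have "?t sums dirichlet_fun b s" unfolding dirichlet_fun_def by (rule summable_sums)
  then have lim: "(\<lambda>N. \<Sum>n\<le>N. ?t n) \<longlonglongrightarrow> dirichlet_fun b s" by (simp add: sums_def_le)
  have "(\<lambda>N. C * real (Suc N) powr (- Re s)) \<longlonglongrightarrow> C * 0"
    using s by (intro tendsto_mult tendsto_const tendsto_neg_powr
        filterlim_compose[OF filterlim_real_sequentially filterlim_Suc]) auto
  have "(\<lambda>N. (\<Sum>k\<le>N. b k) * of_nat (Suc N) powr (-s)) \<longlonglongrightarrow> 0"
  proof (rule Lim_null_comparison[rotated])
    show "(\<lambda>N. C * real (Suc N) powr (- Re s)) \<longlonglongrightarrow> 0"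
      using \<open>(\<lambda>N. C * real (Suc N) powr (- Re s)) \<longlonglongrightarrow> C * 0\<close> by simp
    show "\<forall>\<^sub>F N in sequentially. norm ((\<Sum>k\<le>N. b k) * of_nat (Suc N) powr (-s)) \<le> C * real (Suc N) powr (- Re s)"
    proof (intro always_eventually allI)
      fix N
      have "norm ((\<Sum>k\<le>N. b k) * of_nat (Suc N) powr (-s)) = norm (\<Sum>k\<le>N. b k) * real (Suc N) powr (- Re s)"
        by (simp add: norm_mult norm_of_nat_powr del: of_nat_Suc)
      also have "\<dots> \<le> C * real (Suc N) powr (- Re s)" by (intro mult_right_mono b) auto
      finally show "norm ((\<Sum>k\<le>N. b k) * of_nat (Suc N) powr (-s)) \<le> C * real (Suc N) powr (- Re s)" .
    qed
  qed
  from tendsto_add[OF this lim] show ?thesis unfolding sums_def_le abel by simp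
qed

text \<open>The 3-4-1 inequality for a single Euler factor. With w = exp(i t), the logarithm of the
  left side is minus the sum of (r^n / n) (3 + 4 cos(nt) + cos(2nt)), and the bracket equals 2 (1 +
  cos(nt))^2.\<close>

lemma norm_one_minus_powers_le_1:
  fixes w :: complex and r :: real
  assumes w: "norm w = 1" and r: "0 \<le> r" "r < 1"
  shows "(1 - r) ^ 3 * norm (1 - of_real r * w) ^ 4 * norm (1 - of_real r * w\<^sup>2) \<le> 1"
proof -
  have Lns: "(\<lambda>n. - (z ^ n) / of_nat n) sums ln (1 - z)" if "norm z < 1" for z :: complex
    using Ln_series'[of "-z"] that by simp
  have Re_Ln: "Re (ln (1 - z)) = ln (norm (1 - z))" if "norm z < 1" for z :: complex
    using that by (intro Re_Ln) auto
  have n: "norm (of_real r :: complex) < 1" "norm (of_real r * w) < 1" "norm (of_real r * w\<^sup>2) < 1"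
    using w r by (auto simp: norm_mult norm_power)
  have S: "(\<lambda>n. 3 * Re (- (of_real r ^ n) / of_nat n) + 4 * Re (- ((of_real r * w) ^ n) / of_nat n)
            + Re (- ((of_real r * w\<^sup>2) ^ n) / of_nat n)) sums
        (3 * Re (ln (1 - of_real r)) + 4 * Re (ln (1 - of_real r * w)) + Re (ln (1 - of_real r * w\<^sup>2)))"
    by (intro sums_add sums_mult sums_Re Lns n)
  have "3 * Re (ln (1 - of_real r)) + 4 * Re (ln (1 - of_real r * w)) + Re (ln (1 - of_real r * w\<^sup>2)) \<le> 0"
  proof (rule sums_le[OF _ S sums_zero])
    fix n
    define c where "c = Re (w ^ n)"
    have "norm (w ^ n) = 1" using w by (simp add: norm_power)
    then have "c\<^sup>2 + (Im (w ^ n))\<^sup>2 = 1" unfolding c_def by (simp add: cmod_def)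
    then have c2: "Re ((w ^ n)\<^sup>2) = 2 * c\<^sup>2 - 1" by (simp add: power2_eq_square c_def)
    have e: "Re (- ((of_real r * v) ^ n) / of_nat n) = - (r ^ n / real n * Re (v ^ n))" for v :: complex
    proof -
      have "- ((of_real r * v) ^ n) / of_nat n = of_real (- (r ^ n / real n)) * v ^ n"
        by (simp add: power_mult_distrib)
      then show ?thesis by (simp only: Re_complex_of_real mult_minus_left times_complex.sel Im_complex_of_real)
    qed
    have e1: "Re (- (of_real r ^ n) / of_nat n :: complex) = - (r ^ n / real n)"
      using e[of 1] by simp
    have w2: "w\<^sup>2 ^ n = (w ^ n)\<^sup>2" by (simp add: power_mult[symmetric] mult.commute)
    have "3 * Re (- (of_real r ^ n) / of_nat n :: complex) + 4 * Re (- ((of_real r * w) ^ n) / of_nat n)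
            + Re (- ((of_real r * w\<^sup>2) ^ n) / of_nat n) = - (r ^ n / real n * (2 * (1 + c)\<^sup>2))"
      unfolding e e1 w2 c2 c_def[symmetric] by (simp add: power2_eq_square algebra_simps)
    also have "\<dots> \<le> 0" using r by simp
    finally show "3 * Re (- (of_real r ^ n) / of_nat n :: complex) + 4 * Re (- ((of_real r * w) ^ n) / of_nat n)
            + Re (- ((of_real r * w\<^sup>2) ^ n) / of_nat n) \<le> 0" .
  qed
  then have le: "3 * ln (1 - r) + 4 * ln (norm (1 - of_real r * w)) + ln (norm (1 - of_real r * w\<^sup>2)) \<le> 0"
    unfolding Re_Ln[OF n(1)] Re_Ln[OF n(2)] Re_Ln[OF n(3)] using r
    by (simp add: norm_of_real[of "1 - r", where 'a = complex, unfolded of_real_diff of_real_1])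
  have pos: "1 - r > 0" "norm (1 - of_real r * w) > 0" "norm (1 - of_real r * w\<^sup>2) > 0"
    using n r by auto
  have "ln ((1 - r) ^ 3 * norm (1 - of_real r * w) ^ 4 * norm (1 - of_real r * w\<^sup>2)) \<le> 0"
    using le pos by (simp add: ln_mult ln_realpow del: zero_less_norm_iff)
  then show ?thesis using pos by (subst (asm) ln_le_zero_iff) (auto intro!: mult_pos_pos zero_less_power simp del: zero_less_norm_iff)
qed

section \<open>Euler products\<close>

abbreviation primes_upto :: "nat \<Rightarrow> nat set" where
  "primes_upto N \<equiv> {p. prime p \<and> p \<le> N}"

lemma finite_primes_upto: "finite (primes_upto N)"
  by (rule finite_subset[of _ "{..N}"]) auto

text \<open>Multiplying by \<open>1 - g p\<close> sieves out the multiples of \<open>p\<close>.\<close>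

lemma euler_product_tendsto_1:
  fixes g :: "nat \<Rightarrow> complex"
  assumes g: "g 0 = 0" "g 1 = 1" "\<And>m n. g (m * n) = g m * g n" and sm: "summable (\<lambda>n. norm (g n))"
  shows "(\<lambda>N. suminf g * (\<Prod>p\<in>primes_upto N. 1 - g p)) \<longlonglongrightarrow> 1"
proof -
  define P where "P = (\<lambda>(N::nat) (n::nat). \<forall>p. prime p \<and> p \<le> N \<longrightarrow> \<not> p dvd n)"
  define F where "F = (\<lambda>N n. if P N n then g n else 0)"
  have smF: "summable (\<lambda>n. norm (F N n))" for N
    by (rule summable_comparison_test'[OF sm]) (auto simp: F_def)
  have F_prod: "suminf g * (\<Prod>p\<in>primes_upto N. 1 - g p) = suminf (F N)" for N
  proof (induction N)
    case 0
    have "{p. prime p \<and> p \<le> (0::nat)} = {}" by auto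
    moreover have "F 0 = g" by (auto simp: F_def P_def fun_eq_iff)
    ultimately show ?case by (simp only: prod.empty mult_1_right)
  next
    case (Suc N)
    show ?case
    proof (cases "prime (Suc N)")
      case False
      then have "{p. prime p \<and> p \<le> Suc N} = primes_upto N" "F (Suc N) = F N"
        by (auto simp: F_def P_def fun_eq_iff le_Suc_eq)
      then show ?thesis using Suc by simp
    next
      case True
      define q where "q = Suc N"
      have q: "prime q" using True by (simp add: q_def)
      have set: "{p. prime p \<and> p \<le> Suc N} = insert q (primes_upto N)"
        using q by (auto simp: q_def le_Suc_eq)
      define G where "G = (\<lambda>n. if q dvd n then F N n else 0)"
      \<comment> \<open>Primes up to \<open>N\<close> do not divide \<open>q = N + 1\<close>, so a
        factor \<open>q\<close> is invisible to the sieve. Hence the multiples of \<open>q\<close>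
        contribute \<open>g q\<close> times the whole sum.\<close>
      have PN: "P N (q * m) \<longleftrightarrow> P N m" for m
      proof -
        have "p dvd q * m \<longleftrightarrow> p dvd m" if "prime p" "p \<le> N" for p
        proof -
          have "p \<noteq> q" using that by (simp add: q_def)
          then have "\<not> p dvd q" using that q primes_dvd_imp_eq by blast
          then show ?thesis using prime_dvd_mult_iff[OF that(1)] by auto
        qed
        then show ?thesis by (auto simp: P_def)
      qed
      have "(\<lambda>m. G (q * m)) sums (g q * suminf (F N))"
      proof -
        have "G (q * m) = g q * F N m" for m by (simp add: G_def F_def PN g)
        then show ?thesis using summable_sums[OF summable_norm_cancel[OF smF]] by (simp add: sums_mult)
      qed
      then have "G sums (g q * suminf (F N))"
        by (subst (asm) sums_mono_reindex)
           (use q in \<open>auto simp: G_def strict_mono_def prime_gt_0_nat dvd_def image_def\<close>)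
      then have "(\<lambda>n. F N n - G n) sums (suminf (F N) - g q * suminf (F N))"
        by (intro sums_diff summable_sums summable_norm_cancel[OF smF])
      moreover have "(\<lambda>n. F N n - G n) = F (Suc N)"
        using q by (auto simp: F_def G_def P_def fun_eq_iff q_def le_Suc_eq)
      ultimately have "suminf (F (Suc N)) = suminf (F N) * (1 - g q)"
        by (simp add: sums_iff algebra_simps)
      moreover have "q \<notin> primes_upto N" by (simp add: q_def)
      ultimately show ?thesis unfolding set using Suc by (simp add: mult_ac)
    qed
  qed
  have tail: "norm (suminf (F N) - 1) \<le> (\<Sum>n. norm (g (n + Suc N)))" if "N \<ge> 2" for N
  proof -
    \<comment> \<open>An integer between 2 and \<open>N\<close> has a prime factor at most
      \<open>N\<close> and is sieved out; n = 0 is removed by \<open>g 0 = 0\<close>. Only n = 1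
      survives in this range.\<close>
    have "(\<Sum>n<Suc N. F N n) = (\<Sum>n\<in>{1}. F N n)"
    proof (rule sum.mono_neutral_right)
      show "\<forall>n\<in>{..<Suc N} - {1}. F N n = 0"
      proof
        fix n assume n: "n \<in> {..<Suc N} - {1}"
        obtain p where p: "prime p" "p dvd n" using n prime_factor_nat[of n] by auto
        show "F N n = 0"
        proof (cases "n = 0")
          case False
          then have "p \<le> N" using p n dvd_imp_le[of p n] by auto
          then show ?thesis using p by (auto simp: F_def P_def)
        qed (use g in \<open>simp add: F_def\<close>)
      qed
    qed (use that in auto)
    also have "\<dots> = 1" using g by (auto simp: F_def P_def)
    finally have eq: "suminf (F N) - 1 = (\<Sum>n. F N (n + Suc N))"
      using suminf_split_initial_segment[OF summable_norm_cancel[OF smF], of N "Suc N"] by simp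
    have shift: "summable (\<lambda>n. f (n + Suc N))" if "summable f" for f :: "nat \<Rightarrow> real"
      using that by (rule iffD2[OF summable_iff_shift])
    have "norm (\<Sum>n. F N (n + Suc N)) \<le> (\<Sum>n. norm (F N (n + Suc N)))"
      by (rule summable_norm) (rule shift[OF smF])
    also have "\<dots> \<le> (\<Sum>n. norm (g (n + Suc N)))"
      by (rule suminf_le[OF _ shift[OF smF] shift[OF sm]]) (simp add: F_def)
    finally show ?thesis unfolding eq .
  qed
  have "(\<lambda>N. \<Sum>n. norm (g (n + Suc N))) \<longlonglongrightarrow> 0"
  proof -
    have "(\<lambda>N. suminf (\<lambda>n. norm (g n)) - (\<Sum>n<Suc N. norm (g n))) \<longlonglongrightarrow> suminf (\<lambda>n. norm (g n)) - suminf (\<lambda>n. norm (g n))"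
      using summable_LIMSEQ[OF sm] by (intro tendsto_diff tendsto_const LIMSEQ_Suc)
    then show ?thesis unfolding suminf_minus_initial_segment[OF sm] by (simp only: diff_self)
  qed
  then have "(\<lambda>N. suminf (F N) - 1) \<longlonglongrightarrow> 0"
    by (rule Lim_null_comparison[rotated]) (use tail in \<open>auto simp: eventually_at_top_linorder\<close>)
  then show ?thesis unfolding F_prod using LIM_zero_iff by blast
qed


lemma of_nat_mult_powr:
  "(of_nat (m * n) :: complex) powr z = of_nat m powr z * of_nat n powr z"
  by (simp add: powr_times_real)

lemma summable_norm_dirichlet:
  fixes a :: "nat \<Rightarrow> complex"
  assumes "\<And>n. norm (a n) \<le> C" "Re s > 1"
  shows "summable (\<lambda>n. norm (a n * of_nat n powr (-s)))"
proof (rule summable_comparison_test')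
  show "summable (\<lambda>n. C * real n powr (- Re s))"
    using assms by (intro summable_mult) (simp add: summable_real_powr_iff)
  show "norm (norm (a n * of_nat n powr (-s))) \<le> C * real n powr (- Re s)" if "n \<ge> 0" for n
    using assms(1)[of n] by (simp add: norm_mult norm_of_nat_powr mult_right_mono)
qed

lemma summable_norm_powr:
  assumes "Re s > 1"
  shows "summable (\<lambda>n. norm (of_nat n powr (-s) :: complex))"
proof -
  have "(\<lambda>n. norm (of_nat n powr (-s) :: complex)) = (\<lambda>n. real n powr (- Re s))"
    by (auto simp: norm_of_nat_powr)
  then show ?thesis using assms by (simp add: summable_real_powr_iff)
qed

section \<open>Zeta near the line Re s = 1\<close>

definition zeta_sum :: "complex \<Rightarrow> complex" where
  "zeta_sum s = (\<Sum>n. of_nat n powr (-s))"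

lemma zeta_sum_sums: "Re s > 1 \<Longrightarrow> (\<lambda>n. of_nat n powr (-s)) sums zeta_sum s"
  unfolding zeta_sum_def by (rule summable_sums[OF summable_norm_cancel[OF summable_norm_powr]])

lemma norm_zeta_sum_le:
  assumes "\<sigma> > 1"
  shows "norm (zeta_sum (of_real \<sigma>)) \<le> \<sigma> / (\<sigma> - 1)"
proof -
  have "norm (zeta_sum (of_real \<sigma>) - (\<Sum>n\<le>1. 1 * of_nat n powr (-1 - of_real (\<sigma> - 1))))
     \<le> 1 * real 1 powr (- Re (of_real (\<sigma> - 1))) / Re (of_real (\<sigma> - 1))"
    using zeta_sum_sums[of "of_real \<sigma>"] assms by (intro dirichlet_tail_bound) auto
  then have "norm (zeta_sum (of_real \<sigma>) - 1) \<le> 1 / (\<sigma> - 1)" by simp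
  then have "norm (zeta_sum (of_real \<sigma>)) \<le> 1 + 1 / (\<sigma> - 1)"
    using norm_triangle_ineq2[of "zeta_sum (of_real \<sigma>)" 1] by simp
  also have "\<dots> = \<sigma> / (\<sigma> - 1)" using assms by (simp add: field_simps)
  finally show ?thesis .
qed

text \<open>If both k and k + 1 failed, \<tau> ln((k+1)/k) would be a multiple of 2 pi. It is
  nonzero, and smaller than 1 in absolute value once k exceeds |\<tau>|.\<close>

lemma exists_powr_imaginary_neq_1:
  assumes "\<tau> \<noteq> (0::real)"
  obtains k :: nat where "k \<ge> 2" "(of_nat k :: complex) powr (- (\<i> * of_real \<tau>)) \<noteq> 1"
proof -
  obtain k :: nat where k: "real k > \<bar>\<tau>\<bar> + 2" using reals_Archimedean2 by blast
  have e: "(of_nat m :: complex) powr (- (\<i> * of_real \<tau>)) = exp (\<i> * of_real (- \<tau> * ln (real m)))" if "m > 0" for m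
    using that by (simp add: powr_def Ln_of_nat mult_ac)
  have False if 1: "(of_nat k :: complex) powr (- (\<i> * of_real \<tau>)) = 1"
      "(of_nat (Suc k) :: complex) powr (- (\<i> * of_real \<tau>)) = 1"
  proof -
    define x where "x = \<tau> * (ln (real (Suc k)) - ln (real k))"
    have "exp (\<i> * of_real x) = exp (\<i> * of_real (- \<tau> * ln (real k))) / exp (\<i> * of_real (- \<tau> * ln (real (Suc k))))"
      by (simp add: exp_diff[symmetric] x_def algebra_simps)
    also have "\<dots> = 1" using 1 k e[of k] e[of "Suc k"] by simp
    finally obtain n :: int where n: "x = of_int (2 * n) * pi" by (auto simp: exp_eq_1)
    have d: "ln (real (Suc k)) - ln (real k) = ln (1 + 1 / real k)"
    proof -
      have "1 + 1 / real k = real (Suc k) / real k" using k by (simp add: field_simps)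
      then show ?thesis using k by (simp add: ln_div del: of_nat_Suc)
    qed
    have "ln (1 + 1 / real k) \<le> 1 / real k" using k by (intro ln_add_one_self_le_self) auto
    moreover have pos: "ln (1 + 1 / real k) > 0" using k by (intro ln_gt_zero) auto
    ultimately have "\<bar>x\<bar> \<le> \<bar>\<tau>\<bar> * (1 / real k)" unfolding x_def d abs_mult by (intro mult_left_mono) auto
    also have "\<dots> < 1" using k by (simp add: field_simps)
    finally have "\<bar>of_int (2 * n) * pi\<bar> < 1" using n by simp
    then have "n = 0"
    proof (rule contrapos_pp)
      assume "n \<noteq> 0"
      then have "\<bar>real_of_int (2 * n)\<bar> \<ge> 1" by linarith
      then have "\<bar>real_of_int (2 * n)\<bar> * pi \<ge> 1 * 1" using pi_gt3 by (intro mult_mono) auto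
      then show "\<not> \<bar>of_int (2 * n) * pi\<bar> < 1" by (simp add: abs_mult)
    qed
    then have "x = 0" using n by simp
    then show False using assms pos d by (simp add: x_def)
  qed
  then consider "(of_nat k :: complex) powr (- (\<i> * of_real \<tau>)) \<noteq> 1"
    | "(of_nat (Suc k) :: complex) powr (- (\<i> * of_real \<tau>)) \<noteq> 1" by blast
  then show ?thesis
  proof cases
    case 1
    then show ?thesis by (rule that[rotated]) (use k in linarith)
  next
    case 2
    then show ?thesis by (rule that[rotated]) (use k in linarith)
  qed
qed

text \<open>(1 - k^(1-s)) zeta(s) is the Dirichlet series with coefficients 1, except 1 - k at
  multiples of k. Their partial sums are \<open>N mod k\<close>, hence bounded, so the series is
  holomorphic for Re s > 0. The choice of k keeps the factor nonzero at the limit point 1 +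
  i\<tau>.\<close>

lemma zeta_sum_tendsto:
  assumes "\<tau> \<noteq> 0"
  obtains l where "((\<lambda>\<sigma>. zeta_sum (of_real \<sigma> + \<i> * of_real \<tau>)) \<longlongrightarrow> l) (at_right 1)"
proof -
  obtain k where k: "k \<ge> 2" "(of_nat k :: complex) powr (- (\<i> * of_real \<tau>)) \<noteq> 1"
    using exists_powr_imaginary_neq_1[OF assms] .
  define b :: "nat \<Rightarrow> complex" where "b = (\<lambda>n. if n = 0 then 0 else 1 - (if k dvd n then of_nat k else 0))"
  have partial: "(\<Sum>n\<le>N. b n) = of_nat (N mod k)" for N
  proof (induction N)
    case (Suc N)
    have "b (Suc N) = 1 - (if Suc (N mod k) = k then of_nat k else 0)"
      using k by (auto simp: b_def dvd_eq_mod_eq_0 mod_Suc)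
    moreover have "(of_nat k :: complex) = 1 + of_nat (N mod k)" if "Suc (N mod k) = k"
      using that by (metis of_nat_Suc)
    ultimately show ?case using Suc k by (auto simp: mod_Suc)
  qed (simp add: b_def)
  have b: "b 0 = 0" "norm (\<Sum>n\<le>N. b n) \<le> real k" for N
    using k unfolding partial by (auto simp: b_def less_imp_le)
  have E: "dirichlet_fun b s = (1 - of_nat k powr (1 - s)) * zeta_sum s" if s: "Re s > 1" for s
  proof -
    let ?m = "\<lambda>n. if k dvd n then of_nat k * of_nat n powr (-s) else 0 :: complex"
    have "(\<lambda>n. of_nat k * (of_nat k powr (-s) * of_nat n powr (-s))) sums (of_nat k * (of_nat k powr (-s) * zeta_sum s))"
      by (intro sums_mult zeta_sum_sums s)
    also have "(\<lambda>n. of_nat k * (of_nat k powr (-s) * of_nat n powr (-s))) = (\<lambda>n. ?m (k * n))"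
      by (simp add: of_nat_mult_powr del: of_nat_mult)
    finally have "?m sums (of_nat k * (of_nat k powr (-s) * zeta_sum s))"
      by (subst (asm) sums_mono_reindex) (use k in \<open>auto simp: strict_mono_def dvd_def image_def\<close>)
    then have "(\<lambda>n. of_nat n powr (-s) - ?m n) sums (zeta_sum s - of_nat k * (of_nat k powr (-s) * zeta_sum s))"
      by (intro sums_diff zeta_sum_sums s)
    also have "(\<lambda>n. of_nat n powr (-s) - ?m n) = (\<lambda>n. b n * of_nat n powr (-s))"
      by (auto simp: b_def fun_eq_iff algebra_simps)
    finally have "dirichlet_fun b s = zeta_sum s - of_nat k * (of_nat k powr (-s) * zeta_sum s)"
      using dirichlet_fun_sums[OF b, of s] s by (auto intro: sums_unique2)
    moreover have "of_nat k powr (1 - s) = of_nat k * (of_nat k powr (-s) :: complex)"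
      using k by (simp add: powr_diff powr_minus field_simps)
    ultimately show ?thesis by (simp add: algebra_simps)
  qed
  define s where "s = (\<lambda>\<sigma>::real. of_real \<sigma> + \<i> * of_real \<tau> :: complex)"
  have s_lim: "(s \<longlongrightarrow> s 1) (at_right 1)" unfolding s_def by (intro tendsto_intros)
  have "isCont (dirichlet_fun b) (s 1)"
    using dirichlet_fun_holomorphic[of b "real k"] b
    by (intro continuous_on_interior[OF holomorphic_on_imp_continuous_on])
       (auto simp: s_def interior_open open_halfspace_Re_gt)
  from isCont_tendsto_compose[OF this s_lim]
  have lim: "((\<lambda>\<sigma>. dirichlet_fun b (s \<sigma>)) \<longlongrightarrow> dirichlet_fun b (s 1)) (at_right 1)" .
  have klim: "((\<lambda>\<sigma>. 1 - of_nat k powr (1 - s \<sigma>)) \<longlongrightarrow> 1 - of_nat k powr (1 - s 1)) (at_right 1)"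
    using k by (intro tendsto_intros s_lim) auto
  have nz: "1 - of_nat k powr (1 - s 1) \<noteq> (0 :: complex)" using k by (simp add: s_def)
  have "((\<lambda>\<sigma>. dirichlet_fun b (s \<sigma>) / (1 - of_nat k powr (1 - s \<sigma>))) \<longlongrightarrow>
      dirichlet_fun b (s 1) / (1 - of_nat k powr (1 - s 1))) (at_right 1)"
    by (intro tendsto_divide lim klim nz)
  moreover have "eventually (\<lambda>\<sigma>. dirichlet_fun b (s \<sigma>) / (1 - of_nat k powr (1 - s \<sigma>)) = zeta_sum (s \<sigma>)) (at_right 1)"
  proof -
    have "eventually (\<lambda>\<sigma>. 1 - of_nat k powr (1 - s \<sigma>) \<noteq> 0) (at_right 1)"
      using tendsto_imp_eventually_ne[OF klim nz] .
    moreover have "eventually (\<lambda>\<sigma>::real. \<sigma> > 1) (at_right 1)" by (simp add: eventually_at_filter)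
    ultimately show ?thesis by eventually_elim (simp add: E s_def)
  qed
  ultimately have "((\<lambda>\<sigma>. zeta_sum (s \<sigma>)) \<longlongrightarrow>
      dirichlet_fun b (s 1) / (1 - of_nat k powr (1 - s 1))) (at_right 1)"
    by (rule Lim_transform_eventually)
  then show ?thesis unfolding s_def by (rule that)
qed

text \<open>An axiomatic nonprincipal real Dirichlet character. Nonprincipality is expressed by
  bounded partial sums, the form in which Abel summation consumes it.\<close>

locale quadratic_character =
  fixes h :: "nat \<Rightarrow> real" and C :: real
  assumes h_0: "h 0 = 0" and h_1: "h 1 = 1" and h_mult: "h (m * n) = h m * h n"
    and h_values: "h n \<in> {-1, 0, 1}" and h_bounded: "\<bar>\<Sum>n\<le>N. h n\<bar> \<le> C"
begin

lemma abs_h_le_1: "\<bar>h n\<bar> \<le> 1"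
  using h_values[of n] by auto

lemma C_nonneg: "C \<ge> 0"
  using order_trans[OF abs_ge_zero h_bounded[of 0]] .

definition L :: "complex \<Rightarrow> complex" where "L = dirichlet_fun (\<lambda>n. of_real (h n))"

lemma partial_bound: "norm (\<Sum>n\<le>N. complex_of_real (h n)) \<le> C"
  using h_bounded[of N] by (simp flip: of_real_sum)

lemma L_holomorphic: "L holomorphic_on {s. Re s > 0}"
  unfolding L_def by (rule dirichlet_fun_holomorphic) (use h_0 partial_bound in auto)

lemma L_sums: "Re s > 0 \<Longrightarrow> (\<lambda>n. of_real (h n) * of_nat n powr (-s)) sums L s"
  unfolding L_def by (rule dirichlet_fun_sums) (use h_0 partial_bound in auto)

text \<open>The last factor may be zeta instead of the L-function of \<open>h\<^sup>2\<close>: if \<open>h p = 0\<close>, then the factor at \<open>p\<close>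
  is harmless since \<open>(1 - r)\<^sup>3(1 + r) \<le> 1\<close>.\<close>

lemma zeta_L_product_ge_1:
  assumes \<sigma>: "\<sigma> > 1"
  shows "norm (zeta_sum (of_real \<sigma>)) ^ 3 * norm (L (of_real \<sigma> + \<i> * of_real t)) ^ 4
     * norm (zeta_sum (of_real \<sigma> + \<i> * of_real (2 * t))) \<ge> 1"
proof -
  define s1 s2 s3 :: complex where
    "s1 = of_real \<sigma>" "s2 = of_real \<sigma> + \<i> * of_real t" "s3 = of_real \<sigma> + \<i> * of_real (2 * t)"
  note s_defs = this
  have Re: "Re s1 = \<sigma>" "Re s2 = \<sigma>" "Re s3 = \<sigma>" by (auto simp: s_defs)
  define g1 g2 g3 :: "nat \<Rightarrow> complex" where
    "g1 = (\<lambda>n. of_nat n powr (-s1))" "g2 = (\<lambda>n. of_real (h n) * of_nat n powr (-s2))" "g3 = (\<lambda>n. of_nat n powr (-s3))"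
  note g_defs = this
  have sums: "suminf g1 = zeta_sum s1" "suminf g2 = L s2" "suminf g3 = zeta_sum s3"
    using L_sums[of s2] \<sigma> Re by (auto simp: g_defs zeta_sum_def sums_iff)
  define P :: "(nat \<Rightarrow> complex) \<Rightarrow> nat \<Rightarrow> complex" where "P = (\<lambda>g N. \<Prod>p\<in>primes_upto N. 1 - g p)"
  have lim: "(\<lambda>N. suminf g1 * P g1 N) \<longlonglongrightarrow> 1" "(\<lambda>N. suminf g2 * P g2 N) \<longlonglongrightarrow> 1"
    "(\<lambda>N. suminf g3 * P g3 N) \<longlonglongrightarrow> 1"
    unfolding P_def
  proof -
    show "(\<lambda>N. suminf g1 * (\<Prod>p\<in>primes_upto N. 1 - g1 p)) \<longlonglongrightarrow> 1"
      by (rule euler_product_tendsto_1) (use \<sigma> Re in \<open>simp_all add: g_defs of_nat_mult_powr summable_norm_powr del: of_nat_mult\<close>)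
    show "(\<lambda>N. suminf g3 * (\<Prod>p\<in>primes_upto N. 1 - g3 p)) \<longlonglongrightarrow> 1"
      by (rule euler_product_tendsto_1) (use \<sigma> Re in \<open>simp_all add: g_defs of_nat_mult_powr summable_norm_powr del: of_nat_mult\<close>)
    have "summable (\<lambda>n. norm (of_real (h n) * of_nat n powr (-s2)))"
      using \<sigma> Re abs_h_le_1 by (intro summable_norm_dirichlet[where C = 1]) auto
    then show "(\<lambda>N. suminf g2 * (\<Prod>p\<in>primes_upto N. 1 - g2 p)) \<longlonglongrightarrow> 1"
      unfolding g_defs
      by (intro euler_product_tendsto_1) (simp_all add: h_0 h_1[simplified] h_mult of_nat_mult_powr del: of_nat_mult)
  qed
  have "(\<lambda>N. norm (suminf g1 * P g1 N) ^ 3 * norm (suminf g2 * P g2 N) ^ 4 * norm (suminf g3 * P g3 N))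
     \<longlonglongrightarrow> norm (1::complex) ^ 3 * norm (1::complex) ^ 4 * norm (1::complex)"
    by (intro tendsto_intros lim)
  then have lim: "(\<lambda>N. norm (suminf g1 * P g1 N) ^ 3 * norm (suminf g2 * P g2 N) ^ 4 * norm (suminf g3 * P g3 N)) \<longlonglongrightarrow> 1"
    by simp
  have factor: "norm (1 - g1 p) ^ 3 * norm (1 - g2 p) ^ 4 * norm (1 - g3 p) \<le> 1" if p: "prime p" for p
  proof -
    define r where "r = real p powr (-\<sigma>)"
    define w :: complex where "w = of_nat p powr (- (\<i> * of_real t))"
    have p1: "real p > 1" using prime_gt_1_nat[OF p] by simp
    have r: "0 \<le> r" "r < 1" using p1 \<sigma> powr_less_mono[of "-\<sigma>" 0 "real p"] by (auto simp: r_def)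
    have w: "norm w = 1" using p1 by (simp add: w_def norm_of_nat_powr)
    have pr: "(of_nat p :: complex) powr (- of_real \<sigma>) = of_real r"
      using p1 powr_of_real[of "real p" "-\<sigma>"] by (simp add: r_def)
    have g1: "g1 p = of_real r" by (simp add: g_defs s_defs pr)
    have g2: "g2 p = of_real r * (of_real (h p) * w)"
      by (simp add: g_defs s_defs pr[symmetric] w_def powr_diff powr_minus powr_add field_simps)
    have g3: "g3 p = of_real r * w\<^sup>2"
    proof -
      have "w\<^sup>2 = of_nat p powr (- (\<i> * of_real (2 * t)))" by (simp add: w_def power2_eq_square powr_add[symmetric] algebra_simps)
      then show ?thesis by (simp add: g_defs s_defs pr[symmetric] powr_add[symmetric])
    qed
    have n1: "norm (1 - complex_of_real r) = 1 - r"
      using r norm_of_real[of "1 - r", where 'a = complex] by simp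
    show ?thesis
    proof (cases "h p = 0")
      case True
      have "norm (1 - g3 p) \<le> 1 + r"
        using norm_triangle_ineq4[of 1 "g3 p"] w r by (simp add: g3 norm_mult norm_power)
      then have "(1 - r) ^ 3 * norm (1 - g3 p) \<le> (1 - r) ^ 3 * (1 + r)" using r by (intro mult_left_mono) auto
      also have "\<dots> = (1 - r)\<^sup>2 * (1 - r\<^sup>2)"
        by (simp add: power2_eq_square power3_eq_cube algebra_simps)
      also have "\<dots> \<le> 1 * 1" using r by (intro mult_mono power_le_one) (auto simp: power_le_one)
      finally show ?thesis using True by (simp add: g1 g2 n1)
    next
      case False
      then have hp: "h p = 1 \<or> h p = -1" using h_values[of p] by auto
      \<comment> \<open>The sign is absorbed into the unimodular number:
        \<open>(h p * w)\<^sup>2 = w\<^sup>2\<close>, so the factor of zeta at twice the height is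
        the right companion.\<close>
      then have "norm (of_real (h p) * w) = 1" using w by (auto simp: norm_mult)
      from norm_one_minus_powers_le_1[OF this r] show ?thesis
        using hp unfolding g1 g2 g3 n1 by (auto simp: power_mult_distrib)
    qed
  qed
  have prod_le: "norm (P g1 N) ^ 3 * norm (P g2 N) ^ 4 * norm (P g3 N) \<le> 1" for N
  proof -
    have "norm (P g1 N) ^ 3 * norm (P g2 N) ^ 4 * norm (P g3 N) =
       (\<Prod>p\<in>primes_upto N. norm (1 - g1 p) ^ 3 * norm (1 - g2 p) ^ 4 * norm (1 - g3 p))"
      by (simp add: P_def prod_norm[symmetric] prod_power_distrib prod.distrib)
    also have "\<dots> \<le> 1" using factor by (intro prod_le_1) auto
    finally show ?thesis .
  qed
  \<comment> \<open>The truncated expressions tend to 1 and never exceed \<open>?K\<close>, because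
    the Euler factors multiply to at most 1.\<close>
  let ?K = "norm (suminf g1) ^ 3 * norm (suminf g2) ^ 4 * norm (suminf g3)"
  have "norm (suminf g1 * P g1 N) ^ 3 * norm (suminf g2 * P g2 N) ^ 4 * norm (suminf g3 * P g3 N) \<le> ?K" for N
  proof -
    have "norm (suminf g1 * P g1 N) ^ 3 * norm (suminf g2 * P g2 N) ^ 4 * norm (suminf g3 * P g3 N) =
       ?K * (norm (P g1 N) ^ 3 * norm (P g2 N) ^ 4 * norm (P g3 N))"
      by (simp add: norm_mult power_mult_distrib mult_ac)
    also have "\<dots> \<le> ?K * 1" by (intro mult_left_mono prod_le) auto
    finally show ?thesis by simp
  qed
  then have "1 \<le> ?K" by (intro tendsto_upperbound[OF lim]) auto
  then show ?thesis unfolding sums by (simp add: s_defs)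
qed

text \<open>A zero would make the fourth power of L of order (\<sigma> - 1)^4, while the cube of
  zeta grows at most like (\<sigma> - 1)^(-3) and zeta near 1 + 2it has a limit, as t is nonzero.
  The product of \<open>zeta_L_product_ge_1\<close> would then tend to 0.\<close>

lemma L_1_plus_it_nonzero:
  assumes t: "t \<noteq> (0::real)"
  shows "L (1 + \<i> * of_real t) \<noteq> 0"
proof
  assume L0: "L (1 + \<i> * of_real t) = 0"
  define s where "s = (\<lambda>\<sigma>::real. of_real \<sigma> + \<i> * of_real t :: complex)"
  obtain D where D: "(L has_field_derivative D) (at (s 1))"
    using holomorphic_derivI[OF L_holomorphic open_halfspace_Re_gt, of "s 1"] by (auto simp: s_def)
  have quot: "((\<lambda>\<sigma>. L (s \<sigma>) / of_real (\<sigma> - 1)) \<longlongrightarrow> D) (at_right 1)"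
  proof -
    have "((\<lambda>w. (L w - L (s 1)) / (w - s 1)) \<longlongrightarrow> D) (at (s 1))"
      using D by (simp add: has_field_derivative_iff)
    moreover have "filterlim s (at (s 1)) (at_right 1)"
    proof (rule filterlim_atI)
      show "(s \<longlongrightarrow> s 1) (at_right 1)" unfolding s_def by (intro tendsto_intros)
      show "\<forall>\<^sub>F \<sigma> in at_right 1. s \<sigma> \<noteq> s 1" by (simp add: s_def eventually_at_filter)
    qed
    ultimately have "((\<lambda>\<sigma>. (L (s \<sigma>) - L (s 1)) / (s \<sigma> - s 1)) \<longlongrightarrow> D) (at_right 1)"
      by (rule filterlim_compose)
    then show ?thesis using L0 by (simp add: s_def)
  qed
  obtain l where l: "((\<lambda>\<sigma>. zeta_sum (of_real \<sigma> + \<i> * of_real (2 * t))) \<longlongrightarrow> l) (at_right 1)"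
    using zeta_sum_tendsto[of "2 * t"] t by auto
  let ?B = "\<lambda>\<sigma>. \<sigma> ^ 3 * norm (L (s \<sigma>) / of_real (\<sigma> - 1)) ^ 4 * norm (zeta_sum (of_real \<sigma> + \<i> * of_real (2 * t))) * (\<sigma> - 1)"
  have lim: "(?B \<longlongrightarrow> 1 ^ 3 * norm D ^ 4 * norm l * (1 - 1)) (at_right 1)"
    by (intro tendsto_intros quot l)
  have "?B \<sigma> \<ge> 1" if \<sigma>: "\<sigma> > 1" for \<sigma>
  proof -
    have "1 \<le> norm (zeta_sum (of_real \<sigma>)) ^ 3 * norm (L (s \<sigma>)) ^ 4
         * norm (zeta_sum (of_real \<sigma> + \<i> * of_real (2 * t)))"
      using zeta_L_product_ge_1[OF \<sigma>, of t] by (simp add: s_def)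
    also have "\<dots> \<le> (\<sigma> / (\<sigma> - 1)) ^ 3 * norm (L (s \<sigma>)) ^ 4 * norm (zeta_sum (of_real \<sigma> + \<i> * of_real (2 * t)))"
      using norm_zeta_sum_le[OF \<sigma>] by (intro mult_right_mono power_mono) auto
    also have "\<dots> = ?B \<sigma>"
    proof -
      have n: "norm (complex_of_real (\<sigma> - 1)) = \<sigma> - 1" using \<sigma> by (simp del: of_real_diff)
      have alg: "(\<sigma> / u) ^ 3 * x ^ 4 * y = \<sigma> ^ 3 * (x / u) ^ 4 * y * u" if "u > 0" for u x y :: real
        using that by (simp add: field_simps eval_nat_numeral)
      show ?thesis unfolding norm_divide n by (rule alg) (use \<sigma> in simp)
    qed
    finally show ?thesis .
  qed
  then have "1 \<le> 1 ^ 3 * norm D ^ 4 * norm l * (1 - 1 :: real)"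
    by (intro tendsto_lowerbound[OF lim]) (auto simp: eventually_at_filter)
  then show False by simp
qed

end

section \<open>Nonvanishing at \<open>s = 1\<close>; partial sums of the twisted Moebius function\<close>

text \<open>An absolutely convergent double series regrouped along n = d k. Both Dirichlet products
  and the Lambert series of \<open>L_1_nonzero\<close> are instances.\<close>

lemma divisor_sum_sums:
  fixes F :: "nat \<Rightarrow> nat \<Rightarrow> 'a :: banach"
  assumes zero: "\<And>k. F 0 k = 0" "\<And>d. F d 0 = 0"
    and row: "\<And>d. F d sums G d" and norms: "\<And>d. (\<lambda>k. norm (F d k)) sums N d" and N: "summable N"
  shows "(\<lambda>n. \<Sum>d | d dvd n. F d (n div d)) sums suminf G"
proof -
  have GN: "norm (G d) \<le> N d" for d
    using summable_norm[of "F d"] row[of d] norms[of d] by (simp add: sums_iff)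
  have N0: "N d \<ge> 0" for d using GN[of d] norm_ge_zero order_trans by blast
  have Gsum: "(G has_sum suminf G) UNIV"
  proof (rule norm_summable_imp_has_sum)
    show "summable (\<lambda>d. norm (G d))" by (rule summable_comparison_test'[OF N, of 0]) (use GN in auto)
    then show "G sums suminf G" by (intro summable_sums summable_norm_cancel[of G])
  qed
  have "(\<lambda>p. norm (case p of (d, k) \<Rightarrow> F d k)) summable_on (UNIV \<times> UNIV)"
  proof (rule summable_on_SigmaI)
    show "((\<lambda>k. norm (case (d, k) of (d, k) \<Rightarrow> F d k)) has_sum N d) UNIV" for d
      using norms[of d] by (intro sums_nonneg_imp_has_sum) auto
    show "N summable_on UNIV"
      using sums_nonneg_imp_has_sum[OF summable_sums[OF N] N0] by (auto simp: summable_on_def)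
  qed auto
  then have "(\<lambda>(d, k). F d k) summable_on (UNIV \<times> UNIV)" by (rule abs_summable_summable)
  then have "((\<lambda>(d, k). F d k) has_sum suminf G) (UNIV \<times> UNIV)"
  proof (intro has_sum_SigmaI[OF _ Gsum])
    show "((\<lambda>k. case (d, k) of (d, k) \<Rightarrow> F d k) has_sum G d) UNIV" for d
      using row[of d] norms[of d] by (auto intro!: norm_summable_imp_has_sum simp: sums_iff)
  qed
  \<comment> \<open>Restricting to positive indices is what makes (d, k) correspond bijectively to
    (d k, d): divisors of 0 would spoil it.\<close>
  also have "?this \<longleftrightarrow> ((\<lambda>(d, k). F d k) has_sum suminf G) ({0<..} \<times> {0<..})"
  proof (rule has_sum_cong_neutral)
    fix p :: "nat \<times> nat" assume "p \<in> UNIV \<times> UNIV - {0<..} \<times> {0<..}"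
    then have "fst p = 0 \<or> snd p = 0" by (auto simp: mem_Times_iff)
    then show "(case p of (d, k) \<Rightarrow> F d k) = 0" using zero by (cases p) auto
  qed auto
  also have "\<dots> \<longleftrightarrow> ((\<lambda>p. case (case p of (n, d) \<Rightarrow> (d, n div d)) of (d, k) \<Rightarrow> F d k) has_sum suminf G)
      (SIGMA n:{0<..}. {d. d dvd n})"
  proof (rule has_sum_reindex_bij_betw[symmetric])
    show "bij_betw (\<lambda>(n, d). (d, n div d)) (SIGMA n:{0<..}. {d. d dvd n}) ({0<..} \<times> {0<..} :: (nat \<times> nat) set)"
      by (rule bij_betwI[where g = "\<lambda>(d, k). (d * k, d)"]) (auto elim!: dvdE)
  qed
  finally have "((\<lambda>n. \<Sum>d | d dvd n. F d (n div d)) has_sum suminf G) {0<..}"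
    by (rule has_sum_SigmaD) (auto intro!: has_sum_finiteI)
  also have "?this \<longleftrightarrow> ((\<lambda>n. \<Sum>d | d dvd n. F d (n div d)) has_sum suminf G) UNIV"
    by (rule has_sum_cong_neutral) auto
  finally show ?thesis by (rule has_sum_imp_sums)
qed

lemma dirichlet_product_sums:
  fixes a b :: "nat \<Rightarrow> complex"
  assumes "summable (\<lambda>n. norm (a n * of_nat n powr (-s)))" "summable (\<lambda>n. norm (b n * of_nat n powr (-s)))"
  shows "(\<lambda>n. (\<Sum>d | d dvd n. a d * b (n div d)) * of_nat n powr (-s)) sums
     ((\<Sum>n. a n * of_nat n powr (-s)) * (\<Sum>n. b n * of_nat n powr (-s)))"
proof -
  let ?a = "\<lambda>n. a n * of_nat n powr (-s)" and ?b = "\<lambda>n. b n * of_nat n powr (-s)"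
  have "(\<lambda>n. \<Sum>d | d dvd n. ?a d * ?b (n div d)) sums (\<Sum>d. ?a d * suminf ?b)"
  proof (rule divisor_sum_sums)
    show "(\<lambda>k. ?a d * ?b k) sums (?a d * suminf ?b)" for d
      by (intro sums_mult summable_sums summable_norm_cancel[OF assms(2)])
    show "(\<lambda>k. norm (?a d * ?b k)) sums (norm (?a d) * (\<Sum>k. norm (?b k)))" for d
      unfolding norm_mult[of "?a d"] by (intro sums_mult summable_sums assms(2))
    show "summable (\<lambda>d. norm (?a d) * (\<Sum>k. norm (?b k)))"
      by (intro summable_mult2 assms)
  qed auto
  also have "(\<Sum>d. ?a d * suminf ?b) = suminf ?a * suminf ?b"
    by (rule suminf_mult2[symmetric, OF summable_norm_cancel[OF assms(1)]])
  also have "(\<lambda>n. \<Sum>d | d dvd n. ?a d * ?b (n div d)) = (\<lambda>n. (\<Sum>d | d dvd n. a d * b (n div d)) * of_nat n powr (-s))"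
  proof
    fix n
    have "?a d * ?b (n div d) = a d * b (n div d) * of_nat n powr (-s)" if "d dvd n" for d
    proof -
      have "n = d * (n div d)" using that by simp
      then have "(of_nat n :: complex) powr (-s) = of_nat d powr (-s) * of_nat (n div d) powr (-s)"
        by (metis of_nat_mult_powr)
      then show ?thesis by (simp add: mult_ac)
    qed
    then show "(\<Sum>d | d dvd n. ?a d * ?b (n div d)) = (\<Sum>d | d dvd n. a d * b (n div d)) * of_nat n powr (-s)"
      unfolding sum_distrib_right by (intro sum.cong) auto
  qed
  finally show ?thesis .
qed

section \<open>The Moebius function\<close>

definition moebius :: "nat \<Rightarrow> real" where
  "moebius n = (if squarefree n then (-1) ^ card (prime_factors n) else 0)"

lemma abs_moebius_le_1: "\<bar>moebius n\<bar> \<le> 1"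
  by (simp add: moebius_def power_abs)

lemma moebius_prime_mult:
  assumes p: "prime p" and d: "\<not> p dvd d"
  shows "moebius (p * d) = - moebius d"
proof -
  have cop: "coprime p d" using p d by (simp add: prime_imp_coprime)
  have d0: "d \<noteq> 0" using d by (metis dvd_0_right)
  have sq: "squarefree (p * d) \<longleftrightarrow> squarefree d"
    using squarefree_mult_coprime[OF cop squarefree_prime[of p]] squarefree_multD(2)[of p d] p by auto
  have pf: "prime_factors (p * d) = insert p (prime_factors d)"
    using p d0 by (subst prime_factors_product) (auto simp: prime_factorization_prime)
  have "p \<notin> prime_factors d" using d by auto
  then show ?thesis by (simp add: moebius_def sq pf)
qed

text \<open>For a prime p dividing n, the squarefree divisors of n come in pairs d, p d with p not
  dividing d, and the two values cancel.\<close>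

lemma sum_moebius_divisors:
  assumes "n > 0"
  shows "(\<Sum>d | d dvd n. moebius d) = (if n = 1 then 1 else 0)"
proof (cases "n = 1")
  case True
  then show ?thesis by (simp add: moebius_def)
next
  case False
  obtain p where p: "prime p" "p dvd n" using prime_factor_nat[OF False] by blast
  define D where "D = {d. d dvd n \<and> \<not> p dvd d \<and> squarefree d}"
  have fin: "finite {d. d dvd n}" using assms by simp
  have finD: "finite D" by (rule finite_subset[OF _ fin]) (auto simp: D_def)
  have "(\<Sum>d | d dvd n. moebius d) = (\<Sum>d\<in>D \<union> (*) p ` D. moebius d)"
  proof (rule sum.mono_neutral_right[OF fin])
    show "D \<union> (*) p ` D \<subseteq> {d. d dvd n}"
    proof -
      have "p * d dvd n" if "d \<in> D" for d
        using that p by (intro divides_mult) (auto simp: D_def prime_imp_coprime)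
      then show ?thesis by (auto simp: D_def)
    qed
    show "\<forall>d\<in>{d. d dvd n} - (D \<union> (*) p ` D). moebius d = 0"
    proof
      fix d assume d: "d \<in> {d. d dvd n} - (D \<union> (*) p ` D)"
      show "moebius d = 0"
      proof (rule ccontr)
        assume "moebius d \<noteq> 0"
        then have sq: "squarefree d" by (auto simp: moebius_def split: if_splits)
        then have "p dvd d" using d by (auto simp: D_def)
        then obtain e where e: "d = p * e" by (auto elim: dvdE)
        have "\<not> p dvd e"
        proof
          assume "p dvd e"
          then have "p ^ 2 dvd d" by (auto simp: e power2_eq_square)
          then have "p dvd 1" using sq squarefreeD by blast
          then show False using p by auto
        qed
        moreover have "squarefree e" using sq squarefree_multD(2) e by blast
        moreover have "e dvd n" using d e by (auto intro: dvd_trans)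
        ultimately have "e \<in> D" by (simp add: D_def)
        then show False using d e by auto
      qed
    qed
  qed
  also have "\<dots> = (\<Sum>d\<in>D. moebius d) + (\<Sum>d\<in>(*) p ` D. moebius d)"
    using finD by (intro sum.union_disjoint) (auto simp: D_def)
  also have "(\<Sum>d\<in>(*) p ` D. moebius d) = (\<Sum>d\<in>D. moebius (p * d))"
    using p by (subst sum.reindex) (auto intro!: inj_onI)
  also have "\<dots> = - (\<Sum>d\<in>D. moebius d)"
    unfolding sum_negf[symmetric] by (intro sum.cong moebius_prime_mult p) (auto simp: D_def)
  finally show ?thesis using False by simp
qed

section \<open>Monsky's argument at s = 1\<close>

lemma geometric_sum_ge:
  fixes y :: real
  assumes "0 \<le> y"
  shows "real d * y ^ (d - 1) \<le> (\<Sum>i<d. (y\<^sup>2) ^ i)"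
proof -
  \<comment> \<open>The sum is added to its reversal: the exponents \<open>i\<close> and
    \<open>d - Suc i\<close> are paired, and the geometric mean of each pair is
    \<open>y ^ (d - 1)\<close>.\<close>
  have "2 * (\<Sum>i<d. (y\<^sup>2) ^ i) = (\<Sum>i<d. (y\<^sup>2) ^ i) + (\<Sum>i<d. (y\<^sup>2) ^ (d - Suc i))"
    by (simp add: sum.nat_diff_reindex)
  also have "\<dots> = (\<Sum>i<d. (y\<^sup>2) ^ i + (y\<^sup>2) ^ (d - Suc i))" by (simp add: sum.distrib)
  also have "\<dots> \<ge> (\<Sum>i<d. 2 * y ^ (d - 1))"
  proof (rule sum_mono)
    fix i assume "i \<in> {..<d}"
    then have "y ^ (d - 1) = y ^ i * y ^ (d - Suc i)" by (simp add: power_add[symmetric])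
    moreover have "(y ^ i - y ^ (d - Suc i))\<^sup>2 \<ge> 0" by simp
    ultimately show "2 * y ^ (d - 1) \<le> (y\<^sup>2) ^ i + (y\<^sup>2) ^ (d - Suc i)"
      by (simp add: power2_eq_square algebra_simps power_mult_distrib)
  qed
  finally show ?thesis by simp
qed

text \<open>These are the weights of Monsky's proof that \<open>L(1) \<noteq> 0\<close>.\<close>

lemma lambert_weight_antimono:
  fixes x :: real
  assumes x: "0 < x" "x < 1" and d: "d > 0"
  defines "b \<equiv> \<lambda>d. 1 / (real d * (1 - x)) - x ^ d / (1 - x ^ d)"
  shows "b (Suc d) \<le> b d" "b d \<ge> 0"
proof -
  define S where "S = (\<lambda>d. \<Sum>i<d. x ^ i)"
  have S: "1 - x ^ d = (1 - x) * S d" for d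
    unfolding S_def by (rule one_diff_power_eq)
  have Spos: "S d > 0" if "d > 0" for d
    using that x unfolding S_def by (intro sum_pos) auto
  have b_eq: "b d = (1 / real d - x ^ d / S d) / (1 - x)" if "d > 0" for d
    unfolding b_def S by (simp add: diff_divide_distrib divide_divide_eq_left mult.commute)
  have Sd: "real d * x ^ d \<le> S d"
  proof -
    have "(\<Sum>i<d. x ^ d) \<le> S d" unfolding S_def using x by (intro sum_mono power_decreasing) auto
    then show ?thesis by simp
  qed
  then show "b d \<ge> 0"
    unfolding b_eq[OF d] using x d Spos[OF d] by (intro divide_nonneg_pos) (auto simp: field_simps)
  \<comment> \<open>After dividing by 1 - x, monotonicity amounts to d (d+1) x^d being at most
    \<open>S d * S (Suc d)\<close>. With y^2 = x, \<open>geometric_sum_ge\<close> bounds both sums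
    below, and the resulting exponent 2d - 1 of y is smaller than 2d.\<close>
  define y where "y = sqrt x"
  have y: "y\<^sup>2 = x" "0 < y" "y < 1" using x by (auto simp: y_def)
  have "real d * y ^ (d - 1) * (real (Suc d) * y ^ d) \<le> S d * S (Suc d)"
    using geometric_sum_ge[of y d] geometric_sum_ge[of y "Suc d"] y Spos[OF d]
    unfolding S_def y(1) by (intro mult_mono) auto
  moreover have "x ^ d \<le> y ^ (d - 1) * y ^ d"
  proof -
    have "x ^ d = y ^ (2 * d)" using y by (simp add: power_mult)
    also have "\<dots> \<le> y ^ (d - 1 + d)" using y by (intro power_decreasing) auto
    finally show ?thesis by (simp add: power_add)
  qed
  then have "real d * real (Suc d) * x ^ d \<le> real d * y ^ (d - 1) * (real (Suc d) * y ^ d)"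
    using mult_left_mono[of "x ^ d" "y ^ (d - 1) * y ^ d" "real d * real (Suc d)"] by (simp add: mult_ac)
  ultimately have key: "real d * real (Suc d) * x ^ d \<le> S d * S (Suc d)" by linarith
  have "x ^ d / S d - x ^ Suc d / S (Suc d) = x ^ d / (S d * S (Suc d))"
  proof -
    have "S (Suc d) = 1 + x * S d" unfolding S_def by (subst sum.lessThan_Suc_shift) (simp add: sum_distrib_left)
    then have "S (Suc d) - x * S d = 1" by simp
    moreover have "x ^ d / S d - x ^ Suc d / S (Suc d) = x ^ d * (S (Suc d) - x * S d) / (S d * S (Suc d))"
      using Spos[OF d] Spos[of "Suc d"] by (simp add: field_simps)
    ultimately show ?thesis by simp
  qed
  also have "\<dots> \<le> 1 / (real d * real (Suc d))"
    using key d Spos[OF d] Spos[of "Suc d"] by (simp add: field_simps del: of_nat_Suc)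
  also have "\<dots> = 1 / real d - 1 / real (Suc d)" using d by (simp add: field_simps)
  finally show "b (Suc d) \<le> b d"
    unfolding b_eq[OF d] b_eq[OF zero_less_Suc] using x
    by (intro divide_right_mono) auto
qed

text \<open>Abel summation. With the boundary term at \<open>N\<close> split off, the remaining
  bound \<open>C * (b 1 - b N)\<close> telescopes, and the boundary term costs the missing
  \<open>C * b N\<close>.\<close>

lemma abel_bound_antimono:
  fixes h b :: "nat \<Rightarrow> real"
  assumes h: "h 0 = 0" "\<And>N. \<bar>\<Sum>n\<le>N. h n\<bar> \<le> C"
    and b: "\<And>n. n > 0 \<Longrightarrow> b (Suc n) \<le> b n" "\<And>n. n > 0 \<Longrightarrow> b n \<ge> 0" and N: "N > 0"
  shows "\<bar>\<Sum>n\<le>N. h n * b n\<bar> \<le> C * b 1"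
proof -
  have "\<bar>(\<Sum>n\<le>N. h n * b n) - (\<Sum>n\<le>N. h n) * b N\<bar> \<le> C * (b 1 - b N)"
    using N
  proof (induction N rule: nat_induct_non_zero)
    case 1
    then show ?case using h by simp
  next
    case (Suc N)
    have "(\<Sum>n\<le>Suc N. h n * b n) - (\<Sum>n\<le>Suc N. h n) * b (Suc N)
       = ((\<Sum>n\<le>N. h n * b n) - (\<Sum>n\<le>N. h n) * b N) + (\<Sum>n\<le>N. h n) * (b N - b (Suc N))"
      by (simp add: algebra_simps)
    also have "\<bar>\<dots>\<bar> \<le> C * (b 1 - b N) + C * (b N - b (Suc N))"
    proof (rule order_trans[OF abs_triangle_ineq add_mono[OF Suc.IH]])
      show "\<bar>(\<Sum>n\<le>N. h n) * (b N - b (Suc N))\<bar> \<le> C * (b N - b (Suc N))"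
        unfolding abs_mult using h(2)[of N] b(1)[OF Suc.hyps] by (simp add: mult_right_mono)
    qed
    finally show ?case by (simp add: algebra_simps)
  qed
  moreover have "\<bar>(\<Sum>n\<le>N. h n) * b N\<bar> \<le> C * b N"
    unfolding abs_mult using h(2)[of N] b(2)[OF N] by (simp add: mult_right_mono)
  ultimately show ?thesis by (simp add: algebra_simps)
qed

context quadratic_character begin

text \<open>The coefficients of zeta(s) L(s).\<close>

definition r :: "nat \<Rightarrow> real" where "r n = (\<Sum>d | d dvd n. h d)"

lemma h_power: "h (p ^ i) = h p ^ i"
  by (induction i) (use h_1 h_mult in auto)

lemma r_prime_power_mult:
  assumes p: "prime p" and m: "\<not> p dvd m"
  shows "r (p ^ k * m) = (\<Sum>i\<le>k. h p ^ i) * r m"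
proof -
  have m0: "m \<noteq> 0" using m by (metis dvd_0_right)
  have bij: "bij_betw (\<lambda>x. p ^ fst x * snd x) ({..k} \<times> {e. e dvd m}) {d. d dvd p ^ k * m}"
  proof (rule bij_betw_imageI)
    show "inj_on (\<lambda>x. p ^ fst x * snd x) ({..k} \<times> {e. e dvd m})"
    proof (rule inj_onI)
      fix x y assume xy: "x \<in> {..k} \<times> {e. e dvd m}" "y \<in> {..k} \<times> {e. e dvd m}"
        "p ^ fst x * snd x = p ^ fst y * snd y"
      have mult: "multiplicity p (p ^ fst z * snd z) = fst z" if "z \<in> {..k} \<times> {e. e dvd m}" for z
      proof (rule multiplicity_decomposeI)
        show "\<not> p dvd snd z" using that m by (auto intro: dvd_trans)
      qed (use p that m0 in auto)
      have "fst x = fst y" using mult[OF xy(1)] mult[OF xy(2)] xy(3) by simp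
      then show "x = y" using xy(3) p by (auto simp: prod_eq_iff)
    qed
    show "(\<lambda>x. p ^ fst x * snd x) ` ({..k} \<times> {e. e dvd m}) = {d. d dvd p ^ k * m}"
    proof safe
      fix d assume "d dvd p ^ k * m"
      then obtain a e where ae: "d = a * e" "a dvd p ^ k" "e dvd m" by (metis division_decomp)
      then obtain i where "i \<le> k" "a = p ^ i" using divides_primepow_nat[OF p] by auto
      then show "d \<in> (\<lambda>x. p ^ fst x * snd x) ` ({..k} \<times> {e. e dvd m})" using ae
        by (intro image_eqI[of _ _ "(i, e)"]) auto
    qed (auto intro!: mult_dvd_mono le_imp_power_dvd)
  qed
  have "r (p ^ k * m) = (\<Sum>x\<in>{..k} \<times> {e. e dvd m}. h (p ^ fst x * snd x))"
    unfolding r_def by (rule sum.reindex_bij_betw[OF bij, symmetric])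
  also have "\<dots> = (\<Sum>i\<le>k. \<Sum>e | e dvd m. h p ^ i * h e)"
    by (simp add: sum.cartesian_product h_mult h_power case_prod_unfold)
  also have "\<dots> = (\<Sum>i\<le>k. h p ^ i) * r m"
    by (simp add: r_def sum_product)
  finally show ?thesis .
qed

text \<open>Induction by splitting off a prime power. The local factor 1 + h(p) + ... + h(p)^k is 1,
  k + 1, or an alternating sum equal to 0 or 1; it is nonnegative, and at least 1 for even k. All
  exponents in a square are even.\<close>

lemma r_bounds:
  assumes "n > 0"
  shows "r n \<ge> 0 \<and> (\<forall>j. n = j\<^sup>2 \<longrightarrow> r n \<ge> 1)"
  using assms
proof (induction n rule: less_induct)
  case (less n)
  show ?case
  proof (cases "n = 1")
    case True
    have "r 1 = 1" using h_1 by (simp add: r_def)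
    then show ?thesis using True by (metis order_refl zero_le_one)
  next
    case False
    obtain p where p: "prime p" "p dvd n" using prime_factor_nat[OF False] by blast
    define k where "k = multiplicity p n"
    obtain m where m: "n = p ^ k * m" "\<not> p dvd m"
    proof -
      have "p \<noteq> 1" using p by auto
      then show ?thesis using multiplicity_decompose'[of n p] less.prems that unfolding k_def by fastforce
    qed
    have "k > 0" using p less.prems unfolding k_def
      by (simp add: prime_multiplicity_gt_zero_iff)
    then have "p ^ k > 1" using prime_gt_1_nat[OF p(1)] by (rule one_less_power[rotated])
    moreover have "m > 0" using m less.prems by (cases "m = 0") auto
    ultimately have "m < n" using m by simp
    from less.IH[OF this \<open>m > 0\<close>] have IH: "r m \<ge> 0" "\<And>j. m = j\<^sup>2 \<Longrightarrow> r m \<ge> 1" by auto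
    define g where "g = (\<Sum>i\<le>k. h p ^ i)"
    have rn: "r n = g * r m" unfolding m(1) g_def by (rule r_prime_power_mult[OF p(1) m(2)])
    have g: "g \<ge> 0" "even k \<Longrightarrow> g \<ge> 1"
    proof -
      consider "h p = 0" | "h p = 1" | "h p = -1" using h_values[of p] by auto
      then have "g \<ge> 0 \<and> (even k \<longrightarrow> g \<ge> 1)"
      proof cases
        case 1
        then show ?thesis by (simp add: g_def power_0_left sum.delta)
      next
        case 3
        have "(\<Sum>i\<le>k. (-1 :: real) ^ i) = (if even k then 1 else 0)" by (induction k) auto
        then show ?thesis using 3 by (simp add: g_def)
      qed (simp add: g_def)
      then show "g \<ge> 0" "even k \<Longrightarrow> g \<ge> 1" by auto
    qed
    show ?thesis
    proof (intro conjI allI impI)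
      show "r n \<ge> 0" using rn g IH by simp
      fix j assume j: "n = j\<^sup>2"
      have j0: "j \<noteq> 0" using j less.prems by auto
      have k: "k = 2 * multiplicity p j"
        unfolding k_def j using p j0 by (simp add: prime_elem_multiplicity_power_distrib)
      obtain j' where j': "j = p ^ multiplicity p j * j'"
        using multiplicity_dvd by blast
      have "n = p ^ k * j'\<^sup>2" unfolding j by (subst j') (simp add: k power_mult_distrib power_mult[symmetric] mult.commute)
      then have "m = j'\<^sup>2" using m(1) p by auto
      then have "r m \<ge> 1" by (rule IH(2))
      then have "1 * 1 \<le> g * r m" using g k by (intro mult_mono) auto
      then show "r n \<ge> 1" using rn by simp
    qed
  qed
qed

text \<open>The Lambert series of \<open>h\<close> at x equals the sum of r(n) x^n and so dominates
  the sum of x^(j^2), which becomes arbitrarily large as x tends to 1 from below. If L(1) = 0, it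
  would be bounded by \<open>C\<close> uniformly in x.\<close>

lemma L_1_nonzero: "L 1 \<noteq> 0"
proof
  assume "L 1 = 0"
  have "(\<lambda>n. complex_of_real (h n / real n)) sums of_real 0"
  proof -
    have "of_real (h n) * of_nat n powr (-1) = complex_of_real (h n / real n)" for n
      by (cases "n = 0") (auto simp: powr_minus field_simps)
    then show ?thesis using L_sums[of 1] \<open>L 1 = 0\<close> by simp
  qed
  then have L1: "(\<lambda>n. h n / real n) sums 0" unfolding sums_of_real_iff .
  have bound: "(\<Sum>j=1..J. x ^ (j\<^sup>2)) \<le> C" if x: "0 < x" "x < 1" for x :: real and J
  proof -
    define b where "b = (\<lambda>d. 1 / (real d * (1 - x)) - x ^ d / (1 - x ^ d))"
    define F where "F = (\<lambda>d k. if d = 0 \<or> k = 0 then 0 else h d * x ^ (d * k))"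
    have xd: "x ^ d < 1" if "d > 0" for d using x that by (simp add: power_less_one_iff)
    have geo: "(\<lambda>k. if k = 0 then 0 else x ^ (d * k)) sums (x ^ d / (1 - x ^ d))" if "d > 0" for d
    proof -
      have "(\<lambda>k. (x ^ d) ^ k) sums (1 / (1 - x ^ d))"
        using xd[OF that] x by (intro geometric_sums) auto
      then have "(\<lambda>k. (x ^ d) ^ k - (if k = 0 then 1 else 0)) sums (1 / (1 - x ^ d) - 1)"
        by (intro sums_diff sums_single)
      also have "1 / (1 - x ^ d) - 1 = x ^ d / (1 - x ^ d)" using xd[OF that] by (simp add: field_simps)
      also have "(\<lambda>k. (x ^ d) ^ k - (if k = 0 then 1 else 0)) = (\<lambda>k. if k = 0 then 0 else x ^ (d * k))"
        by (auto simp: power_mult)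
      finally show ?thesis .
    qed
    define G where "G = (\<lambda>d. if d = 0 then 0 else h d * (x ^ d / (1 - x ^ d)))"
      have sumN: "summable (\<lambda>d. if d = 0 then 0 else \<bar>h d\<bar> * (x ^ d / (1 - x ^ d)))"
      proof (rule summable_comparison_test')
        show "summable (\<lambda>d. x ^ d * (1 / (1 - x)))" using x by (intro summable_mult2 summable_geometric) auto
        fix d :: nat
        show "norm (if d = 0 then 0 else \<bar>h d\<bar> * (x ^ d / (1 - x ^ d))) \<le> x ^ d * (1 / (1 - x))"
        proof (cases "d = 0")
          case False
          define q where "q = x ^ d / (1 - x ^ d)"
          have "x ^ d \<le> x" using power_decreasing[of 1 d x] False x by simp
          then have "q \<le> x ^ d / (1 - x)" unfolding q_def using x by (intro divide_left_mono mult_pos_pos) auto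
          moreover have "q \<ge> 0" using xd[of d] False x by (simp add: q_def)
          ultimately have "\<bar>h d\<bar> * q \<le> 1 * (x ^ d / (1 - x))"
            using abs_h_le_1[of d] by (intro mult_mono) auto
          then show ?thesis using False \<open>q \<ge> 0\<close> by (simp add: abs_mult flip: q_def)
        qed (use x in auto)
      qed
    have "(\<lambda>n. \<Sum>d | d dvd n. F d (n div d)) sums suminf G"
    proof (rule divisor_sum_sums)
      show "F d sums G d" for d
      proof (cases "d = 0")
        case False
        have "(\<lambda>k. h d * (if k = 0 then 0 else x ^ (d * k))) sums (h d * (x ^ d / (1 - x ^ d)))"
          using False by (intro sums_mult geo) auto
        also have "(\<lambda>k. h d * (if k = 0 then 0 else x ^ (d * k))) = F d" using False by (auto simp: F_def)
        finally show ?thesis using False by (simp add: G_def)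
      qed (simp add: F_def G_def)
      show "(\<lambda>k. norm (F d k)) sums (if d = 0 then 0 else \<bar>h d\<bar> * (x ^ d / (1 - x ^ d)))" for d
      proof (cases "d = 0")
        case False
        have "(\<lambda>k. \<bar>h d\<bar> * (if k = 0 then 0 else x ^ (d * k))) sums (\<bar>h d\<bar> * (x ^ d / (1 - x ^ d)))"
          using False by (intro sums_mult geo) auto
        also have "(\<lambda>k. \<bar>h d\<bar> * (if k = 0 then 0 else x ^ (d * k))) = (\<lambda>k. norm (F d k))"
          using False x by (auto simp: F_def abs_mult)
        finally show ?thesis using False by simp
      qed (simp add: F_def)
      show "summable (\<lambda>d. if d = 0 then 0 else \<bar>h d\<bar> * (x ^ d / (1 - x ^ d)))" by (rule sumN)
    qed (simp_all add: F_def)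
    also have "(\<lambda>n. \<Sum>d | d dvd n. F d (n div d)) = (\<lambda>n. if n = 0 then 0 else r n * x ^ n)"
    proof
      fix n :: nat
      have "F d (n div d) = h d * x ^ n" if "n > 0" "d dvd n" for d
        using that by (auto simp: F_def dvd_div_eq_0_iff)
      then show "(\<Sum>d | d dvd n. F d (n div d)) = (if n = 0 then 0 else r n * x ^ n)"
        by (auto simp: r_def sum_distrib_right)
    qed
    finally have rsum: "(\<lambda>n. if n = 0 then 0 else r n * x ^ n) sums suminf G" .
    have "(\<Sum>j=1..J. x ^ (j\<^sup>2)) = (\<Sum>n\<in>(\<lambda>j. j\<^sup>2) ` {1..J}. x ^ n)"
      by (subst sum.reindex) (auto simp: inj_on_def power2_eq_iff_nonneg)
    also have "\<dots> \<le> (\<Sum>n\<in>(\<lambda>j. j\<^sup>2) ` {1..J}. if n = 0 then 0 else r n * x ^ n)"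
    proof (rule sum_mono)
      fix n assume "n \<in> (\<lambda>j. j\<^sup>2) ` {1..J}"
      then obtain j where j: "j \<ge> 1" "n = j\<^sup>2" by auto
      then have "r n \<ge> 1" using r_bounds[of n] by auto
      then have "1 * x ^ n \<le> r n * x ^ n" using x by (intro mult_right_mono) auto
      then show "x ^ n \<le> (if n = 0 then 0 else r n * x ^ n)" using j by auto
    qed
    also have "\<dots> \<le> (\<Sum>n. if n = 0 then 0 else r n * x ^ n)"
      by (rule sum_le_suminf[OF sums_summable[OF rsum]]) (use r_bounds x in auto)
    also have "\<dots> = suminf G" using rsum by (simp add: sums_iff)
    also have "suminf G \<le> C"
    proof -
      have Gs: "summable G"
      proof (rule summable_comparison_test'[OF sumN])
        fix d :: nat
        show "norm (G d) \<le> (if d = 0 then 0 else \<bar>h d\<bar> * (x ^ d / (1 - x ^ d)))"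
          using xd[of d] x by (auto simp: G_def abs_mult)
      qed
      \<comment> \<open>The series of h(n)/n vanishes, so it may be subtracted with the factor 1/(1
        - x). This turns the Lambert weights into the decreasing weights \<open>b\<close>, and
        \<open>b 1 = 1\<close> makes the Abel bound independent of x.\<close>
      have "(\<lambda>n. (1 / (1 - x)) * (h n / real n) - G n) sums ((1 / (1 - x)) * 0 - suminf G)"
        by (intro sums_diff sums_mult L1 summable_sums Gs)
      also have "(\<lambda>n. (1 / (1 - x)) * (h n / real n) - G n) = (\<lambda>n. h n * b n)"
      proof
        fix n
        have e: "1 / (1 - x) * (h n / real n) = h n * (1 / (real n * (1 - x)))"
          by (simp add: divide_divide_eq_left mult.commute)
        show "(1 / (1 - x)) * (h n / real n) - G n = h n * b n"
        proof (cases "n = 0")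
          case False
          then show ?thesis unfolding e G_def b_def right_diff_distrib by (simp only: if_False)
        qed (simp add: G_def h_0)
      qed
      finally have "(\<lambda>N. \<Sum>n\<le>N. h n * b n) \<longlonglongrightarrow> - suminf G" by (simp add: sums_def_le)
      then have lim: "(\<lambda>N. - (\<Sum>n\<le>N. h n * b n)) \<longlonglongrightarrow> suminf G"
        using tendsto_minus[of _ "- suminf G"] by simp
      have "- (\<Sum>n\<le>N. h n * b n) \<le> C" if "N > 0" for N
      proof -
        have "\<bar>\<Sum>n\<le>N. h n * b n\<bar> \<le> C * b 1"
          unfolding b_def by (intro abel_bound_antimono h_0 h_bounded lambert_weight_antimono x that)
        also have "b 1 = 1" using x by (simp add: b_def field_simps)
        finally show ?thesis by simp
      qed
      then show ?thesis
        by (intro tendsto_upperbound[OF lim]) (auto intro: eventually_mono[OF eventually_gt_at_top[of 0]])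
    qed
    finally show ?thesis .
  qed
  obtain J :: nat where J: "real J > C" using reals_Archimedean2 by blast
  have "((\<lambda>x::real. \<Sum>j=1..J. x ^ (j\<^sup>2)) \<longlongrightarrow> (\<Sum>j=1..J. 1 ^ (j\<^sup>2))) (at_left 1)"
    by (intro tendsto_intros)
  moreover have "eventually (\<lambda>x::real. (\<Sum>j=1..J. x ^ (j\<^sup>2)) \<le> C) (at_left 1)"
    by (rule eventually_mono[OF eventually_at_left_real[of 0 1]]) (use bound in auto)
  ultimately have "(\<Sum>j=1..J. 1 ^ (j\<^sup>2)) \<le> C" by (intro tendsto_upperbound) auto
  then show False using J by simp
qed

lemma L_nonzero:
  assumes "Re s = 1"
  shows "L s \<noteq> 0"
proof -
  have "s = 1 + \<i> * of_real (Im s)" using assms by (simp add: complex_eq_iff)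
  then show ?thesis using L_1_plus_it_nonzero[of "Im s"] L_1_nonzero by (cases "Im s = 0") auto
qed

section \<open>The twisted Moebius function and 1/L\<close>

definition u :: "nat \<Rightarrow> real" where "u n = moebius n * h n"

lemma abs_u_le_1: "\<bar>u n\<bar> \<le> 1"
  unfolding u_def abs_mult using mult_mono[OF abs_moebius_le_1[of n] abs_h_le_1[of n]] by simp

lemma u_convolution: "(\<Sum>d | d dvd n. u d * h (n div d)) = (if n = 1 then 1 else 0)"
proof (cases "n = 0")
  case False
  have "(\<Sum>d | d dvd n. u d * h (n div d)) = (\<Sum>d | d dvd n. moebius d * h n)"
  proof (rule sum.cong)
    fix d assume "d \<in> {d. d dvd n}"
    then have "h n = h d * h (n div d)" by (simp flip: h_mult)
    then show "u d * h (n div d) = moebius d * h n" by (simp add: u_def)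
  qed auto
  also have "\<dots> = (if n = 1 then 1 else 0) * h n"
    using sum_moebius_divisors[of n] False by (simp flip: sum_distrib_right)
  finally show ?thesis using h_1 by auto
qed auto

lemma u_dirichlet_sums:
  assumes s: "Re s > 1"
  shows "(\<lambda>n. of_real (u n) * of_nat n powr (-s)) sums (1 / L s)" "L s \<noteq> 0"
proof -
  have sm: "summable (\<lambda>n. norm (complex_of_real (u n) * of_nat n powr (-s)))"
    "summable (\<lambda>n. norm (complex_of_real (h n) * of_nat n powr (-s)))"
    using s abs_u_le_1 abs_h_le_1 by (auto intro!: summable_norm_dirichlet[where C = 1])
  let ?U = "\<Sum>n. complex_of_real (u n) * of_nat n powr (-s)"
  have "(\<lambda>n. (\<Sum>d | d dvd n. complex_of_real (u d) * of_real (h (n div d))) * of_nat n powr (-s)) sums (?U * L s)"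
    using dirichlet_product_sums[OF sm] L_sums[of s] s by (simp add: sums_iff)
  also have "(\<lambda>n. (\<Sum>d | d dvd n. complex_of_real (u d) * of_real (h (n div d))) * of_nat n powr (-s)) =
     (\<lambda>n. if n = 1 then 1 else 0)"
  proof
    fix n :: nat
    have "(\<Sum>d | d dvd n. complex_of_real (u d) * of_real (h (n div d))) = of_real (if n = 1 then 1 else 0)"
      using u_convolution[of n] by (simp flip: of_real_mult of_real_sum)
    then show "(\<Sum>d | d dvd n. complex_of_real (u d) * of_real (h (n div d))) * of_nat n powr (-s) = (if n = 1 then 1 else 0)"
      by simp
  qed
  finally have "?U * L s = 1" using sums_single[of 1 "\<lambda>_. 1 :: complex"] by (auto intro: sums_unique2)
  then have "L s \<noteq> 0" by auto
  moreover from this \<open>?U * L s = 1\<close> have "?U = 1 / L s" by (metis nonzero_eq_divide_eq)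
  ultimately show "(\<lambda>n. of_real (u n) * of_nat n powr (-s)) sums (1 / L s)" "L s \<noteq> 0"
    using summable_sums[OF summable_norm_cancel[OF sm(1)]] by auto
qed

lemma sum_u_sublinear: "(\<lambda>N. (\<Sum>n\<le>N. u n) / real N) \<longlonglongrightarrow> 0"
proof -
  \<comment> \<open>The domain of 1/L. It contains the line Re s = 1 by \<open>L_nonzero\<close>,
    and the points to the right of it because L has there an inverse Dirichlet series.\<close>
  define V where "V = {s. Re s > 0} \<inter> {s. Re s > 0 \<and> L s \<noteq> 0}"
  have V_eq: "V = {s. Re s > 0} \<inter> L -` (- {0})" by (auto simp: V_def)
  have "open V" unfolding V_eq
    by (intro continuous_open_preimage holomorphic_on_imp_continuous_on L_holomorphic open_halfspace_Re_gt) auto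
  moreover have "{s. Re s \<ge> 1} \<subseteq> V"
  proof
    fix s assume "s \<in> {s. Re s \<ge> 1}"
    then show "s \<in> V" using L_nonzero[of s] u_dirichlet_sums(2)[of s] by (cases "Re s = 1") (auto simp: V_def)
  qed
  moreover have "(\<lambda>s. 1 / L s) holomorphic_on V"
    by (intro holomorphic_intros holomorphic_on_subset[OF L_holomorphic]) (auto simp: V_def)
  ultimately have "(\<lambda>n. of_real (u n) / of_nat n) sums (1 / L 1)"
    using abs_u_le_1 u_dirichlet_sums(1) by (intro newman_tauberian[where C = 1 and V = V]) auto
  then have "(\<lambda>N. (\<Sum>n\<le>N. complex_of_real (u n)) / of_nat N) \<longlonglongrightarrow> 0"
    by (rule sum_sublinear_of_sums) (simp add: u_def h_0)
  then have "(\<lambda>N. complex_of_real ((\<Sum>n\<le>N. u n) / real N)) \<longlonglongrightarrow> of_real 0" by simp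
  then show ?thesis by (rule iffD1[OF tendsto_of_real_iff])
qed

end

section \<open>Character sums over primes\<close>

lemma sum_divisors_reindex:
  fixes f :: "nat \<Rightarrow> nat \<Rightarrow> 'a :: comm_monoid_add"
  shows "(\<Sum>n=1..N. \<Sum>d | d dvd n. f d (n div d)) = (\<Sum>d=1..N. \<Sum>e=1..N div d. f d e)"
proof -
  have "(\<Sum>n=1..N. \<Sum>d | d dvd n. f d (n div d)) = (\<Sum>(n, d)\<in>(SIGMA n:{1..N}. {d. d dvd n}). f d (n div d))"
    by (rule sum.Sigma) auto
  also have "\<dots> = (\<Sum>(d, e)\<in>(SIGMA d:{1..N}. {1..N div d}). f d e)"
  proof (rule sum.reindex_bij_witness[where i = "\<lambda>(d, e). (d * e, d)" and j = "\<lambda>(n, d). (d, n div d)"]; safe?)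
    fix n d assume "n \<in> {1..N}" "d dvd n"
    then obtain e where e: "n = d * e" "d > 0" "e > 0" "d * e \<le> N" by (auto elim!: dvdE)
    then have "d * 1 \<le> d * e" by (intro mult_le_mono) auto
    then have "d \<le> N" using e(4) by linarith
    with e show "d \<in> {1..N}" "n div d \<in> {1..N div d}"
      by (auto simp: less_eq_div_iff_mult_less_eq mult.commute)
  next
    fix d e assume "d \<in> {1..N}" "e \<in> {1..N div d}"
    then show "d * e \<in> {1..N}" by (auto simp: less_eq_div_iff_mult_less_eq mult.commute)
  qed auto
  also have "\<dots> = (\<Sum>d=1..N. \<Sum>e=1..N div d. f d e)"
    by (rule sum.Sigma[symmetric]) auto
  finally show ?thesis .
qed

text \<open>Moebius inversion of \<open>mangoldt_sum\<close>. After interchanging the sums, the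
  Moebius sum over the divisors of \<open>n div e\<close> vanishes unless
  \<open>e = n\<close>.\<close>

lemma sum_moebius_ln:
  assumes "n > 0"
  shows "(\<Sum>d | d dvd n. moebius d * ln (real (n div d))) = mangoldt n"
proof -
  let ?D = "{d. d dvd n}"
  have fin: "finite ?D" using assms by simp
  have div_iff: "e dvd n div d \<longleftrightarrow> e dvd n \<and> d * e dvd n" if "d dvd n" for d e
  proof -
    have "d \<noteq> 0" using that assms by auto
    then have "e dvd n div d \<longleftrightarrow> e * d dvd n" using that by (rule dvd_div_iff_mult)
    then show ?thesis using dvd_mult_left[of e d n] by (auto simp: mult.commute)
  qed
  have "(\<Sum>d\<in>?D. moebius d * ln (real (n div d))) = (\<Sum>d\<in>?D. \<Sum>e | e \<in> ?D \<and> d * e dvd n. moebius d * mangoldt e)"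
  proof (rule sum.cong)
    fix d assume d: "d \<in> ?D"
    then have "n div d \<noteq> 0" using assms by (auto simp: dvd_div_eq_0_iff)
    then have "ln (real (n div d)) = (\<Sum>e | e dvd n div d. mangoldt e)"
      using mangoldt_sum[of "n div d", where 'a = real] by simp
    also have "{e. e dvd n div d} = {e. e \<in> ?D \<and> d * e dvd n}" using div_iff d by auto
    finally show "moebius d * ln (real (n div d)) = (\<Sum>e | e \<in> ?D \<and> d * e dvd n. moebius d * mangoldt e)"
      by (simp add: sum_distrib_left)
  qed auto
  also have "\<dots> = (\<Sum>e\<in>?D. \<Sum>d | d \<in> ?D \<and> d * e dvd n. moebius d * mangoldt e)"
    by (rule sum.swap_restrict[OF fin fin])
  also have "\<dots> = (\<Sum>e\<in>?D. mangoldt e * (if e = n then 1 else 0))"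
  proof (rule sum.cong)
    fix e assume e: "e \<in> ?D"
    have "{d. d \<in> ?D \<and> d * e dvd n} = {d. d dvd n div e}" using div_iff[of e] e by (auto simp: mult.commute)
    then have "(\<Sum>d | d \<in> ?D \<and> d * e dvd n. moebius d * mangoldt e) = mangoldt e * (\<Sum>d | d dvd n div e. moebius d)"
      by (simp add: sum_distrib_left mult.commute)
    also have "(\<Sum>d | d dvd n div e. moebius d) = (if n div e = 1 then 1 else 0)"
    proof (rule sum_moebius_divisors)
      have "n div e \<noteq> 0" using e assms by (auto simp: dvd_div_eq_0_iff)
      then show "n div e > 0" by simp
    qed
    also have "n div e = 1 \<longleftrightarrow> e = n" using e assms by (auto elim!: dvdE)
    finally show "(\<Sum>d | d \<in> ?D \<and> d * e dvd n. moebius d * mangoldt e) = mangoldt e * (if e = n then 1 else 0)" .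
  qed auto
  also have "\<dots> = mangoldt n" using fin by (simp add: if_distrib[of "(*) _"] sum.delta cong: if_cong)
  finally show ?thesis .
qed

section \<open>Proper prime powers and removal of logarithmic weights\<close>

lemma card_squares_le: "real (card {n::nat. n * n \<le> N}) \<le> sqrt (real N) + 1"
proof -
  have "{n::nat. n * n \<le> N} \<subseteq> {..nat \<lfloor>sqrt (real N)\<rfloor>}"
  proof
    fix n assume "n \<in> {n::nat. n * n \<le> N}"
    then have "real n * real n \<le> real N" by (simp flip: of_nat_mult)
    then have "real n \<le> sqrt (real N)" by (simp add: real_le_rsqrt power2_eq_square)
    then show "n \<in> {..nat \<lfloor>sqrt (real N)\<rfloor>}" by (simp add: le_nat_floor)
  qed
  then have "card {n::nat. n * n \<le> N} \<le> nat \<lfloor>sqrt (real N)\<rfloor> + 1"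
    using card_mono[of "{..nat \<lfloor>sqrt (real N)\<rfloor>}"] by fastforce
  moreover have "real (nat \<lfloor>sqrt (real N)\<rfloor>) \<le> sqrt (real N)" by (simp add: of_nat_floor)
  ultimately show ?thesis by linarith
qed

lemma finite_squares: "finite {n::nat. n * n \<le> N}"
  by (rule finite_subset[of _ "{..N}"]) (auto dest: le_trans[OF le_square])

text \<open>A power p^k up to N with k at least 2 has p^2 and 2^k up to N. The number of such pairs
  (p, k) is coarsely bounded by a product, and each term is at most ln N; the result is still
  o(N).\<close>

lemma mangoldt_proper_powers_le:
  assumes "N \<ge> 1"
  shows "(\<Sum>n | n \<in> {1..N} \<and> \<not> prime n. mangoldt n :: real) \<le> (sqrt (real N) + 1) * (log 2 (real N) + 1) * ln (real N)"
proof -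
  define P where "P = {n. n \<in> {1..N} \<and> \<not> prime n \<and> primepow n}"
  define E where "E = {n::nat. n * n \<le> N} \<times> {k::nat. 2 ^ k \<le> N}"
  have k_le: "real k \<le> log 2 (real N)" if "2 ^ k \<le> N" for k
  proof -
    have "2 powr real k \<le> real N" using of_nat_mono[OF that, where 'a = real] by (simp add: powr_realpow)
    then show ?thesis using assms by (subst le_log_iff) auto
  qed
  have K_sub: "{k::nat. 2 ^ k \<le> N} \<subseteq> {..nat \<lfloor>log 2 (real N)\<rfloor>}"
    using k_le by (auto simp: le_nat_floor)
  then have finK: "finite {k::nat. 2 ^ k \<le> N}" by (rule finite_subset) simp
  have cardK: "real (card {k::nat. 2 ^ k \<le> N}) \<le> log 2 (real N) + 1"
  proof -
    have "card {k::nat. 2 ^ k \<le> N} \<le> nat \<lfloor>log 2 (real N)\<rfloor> + 1" using card_mono[OF _ K_sub] by simp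
    moreover have "real (nat \<lfloor>log 2 (real N)\<rfloor>) \<le> log 2 (real N)" using assms by (simp add: of_nat_floor)
    ultimately show ?thesis by linarith
  qed
  have P_sub: "P \<subseteq> (\<lambda>(p, k). p ^ k) ` E"
  proof
    fix n assume n: "n \<in> P"
    then obtain p k where pk: "prime p" "k > 0" "n = p ^ k" by (auto simp: P_def primepow_def)
    then have "k \<noteq> 1" using n by (auto simp: P_def)
    then have "p ^ 2 \<le> p ^ k" using pk prime_gt_0_nat[OF pk(1)] by (intro power_increasing) auto
    moreover have "2 ^ k \<le> p ^ k" using prime_ge_2_nat[OF pk(1)] by (intro power_mono) auto
    moreover have "p ^ k \<le> N" using n pk by (auto simp: P_def)
    ultimately have "(p, k) \<in> E" by (auto simp: E_def power2_eq_square)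
    then show "n \<in> (\<lambda>(p, k). p ^ k) ` E" using pk by force
  qed
  have finE: "finite E" unfolding E_def using finite_squares finK by simp
  have "card P \<le> card E" using surj_card_le[OF finE P_sub] .
  then have cardP: "real (card P) \<le> (sqrt (real N) + 1) * (log 2 (real N) + 1)"
    using mult_mono[OF card_squares_le[of N] cardK] by (simp add: E_def card_cartesian_product flip: of_nat_mult)
  have "(\<Sum>n | n \<in> {1..N} \<and> \<not> prime n. mangoldt n :: real) = (\<Sum>n\<in>P. mangoldt n)"
    by (rule sum.mono_neutral_right) (auto simp: P_def mangoldt_def)
  also have "\<dots> \<le> (\<Sum>n\<in>P. ln (real N))"
  proof (rule sum_mono)
    fix n assume n: "n \<in> P"
    then obtain p k where pk: "prime p" "k > 0" "n = p ^ k" by (auto simp: P_def primepow_def)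
    have "p \<le> p ^ k" using pk prime_gt_0_nat[OF pk(1)] by (intro self_le_power) auto
    then have "p \<le> N" using n pk by (auto simp: P_def)
    then show "mangoldt n \<le> ln (real N)" using pk prime_gt_0_nat[OF pk(1)] by simp
  qed
  also have "\<dots> = real (card P) * ln (real N)" by simp
  also have "\<dots> \<le> (sqrt (real N) + 1) * (log 2 (real N) + 1) * ln (real N)"
    using cardP assms by (intro mult_right_mono) auto
  finally show ?thesis .
qed

text \<open>Split at the square root of N: below it 1/ln n is at most 1/ln 2, above it ln n is at
  least half of ln N.\<close>

lemma sum_inverse_ln_le:
  assumes "N \<ge> 2"
  shows "(\<Sum>n=2..N. 1 / ln (real n)) \<le> (sqrt (real N) + 1) / ln 2 + 2 * real N / ln (real N)"
proof -
  have lnN: "ln (real N) > 0" using assms by simp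
  have "(\<Sum>n=2..N. 1 / ln (real n)) \<le> (\<Sum>n=2..N. (if n * n \<le> N then 1 / ln 2 else 0) + 2 / ln (real N))"
  proof (rule sum_mono)
    fix n assume n: "n \<in> {2..N}"
    show "1 / ln (real n) \<le> (if n * n \<le> N then 1 / ln 2 else 0) + 2 / ln (real N)"
    proof (cases "n * n \<le> N")
      case True
      have "1 / ln (real n) \<le> 1 / ln 2" using n by (intro divide_left_mono) auto
      moreover have "2 / ln (real N) \<ge> 0" using lnN by simp
      ultimately show ?thesis unfolding if_P[OF True] by linarith
    next
      case False
      then have "real N \<le> real n * real n" by (simp flip: of_nat_mult)
      then have "ln (real N) \<le> ln (real n * real n)" using assms n by simp
      also have "\<dots> = 2 * ln (real n)" using n by (simp add: ln_mult)
      finally have "1 / ln (real n) \<le> 2 / ln (real N)" using lnN n by (simp add: field_simps)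
      then show ?thesis using False by simp
    qed
  qed
  also have "\<dots> = (\<Sum>n=2..N. if n * n \<le> N then 1 / ln 2 else 0) + real (card {2..N}) * (2 / ln (real N))"
    by (simp add: sum.distrib)
  also have "(\<Sum>n=2..N. if n * n \<le> N then 1 / ln 2 else (0::real)) = real (card {n \<in> {2..N}. n * n \<le> N}) * (1 / ln 2)"
    by (simp add: sum.If_cases Int_def)
  also have "\<dots> \<le> (sqrt (real N) + 1) * (1 / ln 2)"
  proof (rule mult_right_mono)
    have "card {n \<in> {2..N}. n * n \<le> N} \<le> card {n. n * n \<le> N}" by (rule card_mono[OF finite_squares]) auto
    then show "real (card {n \<in> {2..N}. n * n \<le> N}) \<le> sqrt (real N) + 1" using card_squares_le[of N] by linarith
  qed auto
  also have "real (card {2..N}) * (2 / ln (real N)) \<le> real N * (2 / ln (real N))"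
    using lnN by (intro mult_right_mono) auto
  finally show ?thesis by (simp add: mult_ac)
qed

text \<open>The constant absorbs the initial segment, which gives an o(n) bound usable at all
  indices of a partial summation simultaneously.\<close>

lemma sublinear_affine_bound:
  fixes M :: "nat \<Rightarrow> real"
  assumes "(\<lambda>N. M N / real N) \<longlonglongrightarrow> 0" "\<epsilon> > 0"
  obtains A where "A \<ge> 0" "\<And>n. \<bar>M n\<bar> \<le> \<epsilon> * real n + A"
proof -
  obtain N0 where N0: "\<And>n. n \<ge> N0 \<Longrightarrow> \<bar>M n / real n\<bar> < \<epsilon>"
    using LIMSEQ_D[OF assms] by auto
  define A where "A = (\<Sum>n\<le>N0. \<bar>M n\<bar>)"
  have "\<bar>M n\<bar> \<le> \<epsilon> * real n + A" for n
  proof (cases "n \<le> N0")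
    case True
    then have "\<bar>M n\<bar> \<le> A" unfolding A_def by (intro member_le_sum) auto
    then show ?thesis using assms by (simp add: add_increasing)
  next
    case False
    then have "\<bar>M n\<bar> < \<epsilon> * real n" using N0[of n] by (simp add: abs_divide field_simps)
    moreover have "A \<ge> 0" by (simp add: A_def sum_nonneg)
    ultimately show ?thesis by linarith
  qed
  moreover have "A \<ge> 0" by (simp add: A_def sum_nonneg)
  ultimately show ?thesis using that by blast
qed

lemma sum_div_ln_small:
  fixes c :: "nat \<Rightarrow> real"
  assumes c: "c 0 = 0" "c 1 = 0" and T: "(\<lambda>N. (\<Sum>n\<le>N. c n) / real N) \<longlonglongrightarrow> 0"
  shows "(\<lambda>N. (\<Sum>n\<le>N. c n / ln (real n)) * ln (real N) / real N) \<longlonglongrightarrow> 0"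
proof (rule LIMSEQ_I)
  fix e :: real assume e: "e > 0"
  \<comment> \<open>The majorant \<open>X\<close> below, after scaling by ln N / N, tends to
    \<open>3 * \<epsilon>\<close>: one from the boundary term and two from
    \<open>sum_inverse_ln_le\<close>. It is eventually below
    \<open>4 * \<epsilon> = e / 2\<close>.\<close>
  define \<epsilon> where "\<epsilon> = e / 8"
  have \<epsilon>: "\<epsilon> > 0" using e by (simp add: \<epsilon>_def)
  define S where "S = (\<lambda>N. \<Sum>n\<le>N. c n)"
  obtain A where A: "A \<ge> 0" "\<And>n. \<bar>S n\<bar> \<le> \<epsilon> * real n + A"
    using sublinear_affine_bound[OF T \<epsilon>] unfolding S_def by blast
  define D where "D = (\<lambda>n::nat. 1 / ln (real n) - 1 / ln (real (Suc n)))"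
  have D: "D n \<ge> 0" if "n \<ge> 2" for n
    using that by (auto simp: D_def field_simps)
  \<comment> \<open>The partial summation starts at 2 since \<open>c\<close> vanishes at 0 and 1,
    where 1 / ln is not a genuine weight.\<close>
  have abel: "(\<Sum>n\<le>N. c n / ln (real n)) = S N / ln (real N) + (\<Sum>n=2..<N. S n * D n)" if "N \<ge> 2" for N
    using that
  proof (induction N rule: dec_induct)
    case base
    then show ?case using c by (simp add: S_def numeral_2_eq_2)
  next
    case (step N)
    then show ?case by (simp add: S_def D_def algebra_simps add_divide_distrib)
  qed
  \<comment> \<open>A second summation by parts: it turns the differences of 1/ln back into values
    of 1/ln.\<close>
  have nD: "(\<Sum>n=2..<N. real n * D n) \<le> 1 / ln 2 + (\<Sum>n=2..N. 1 / ln (real n))" if "N \<ge> 2" for N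
  proof -
    have "(\<Sum>n=2..<N. real n * D n) + real N / ln (real N) = 1 / ln 2 + (\<Sum>n=2..N. 1 / ln (real n))"
      using that
    proof (induction N rule: dec_induct)
      case (step N)
      then show ?case by (simp add: D_def algebra_simps add_divide_distrib)
    qed simp
    moreover have "real N / ln (real N) \<ge> 0" using that by simp
    ultimately show ?thesis by linarith
  qed
  have sumD: "(\<Sum>n=2..<N. D n) \<le> 1 / ln 2" if "N \<ge> 2" for N
  proof -
    have "(\<Sum>n=2..<N. D n) + 1 / ln (real N) = 1 / ln 2"
      using that by (induction N rule: dec_induct) (simp_all add: D_def)
    moreover have "1 / ln (real N) \<ge> 0" using that by simp
    ultimately show ?thesis by linarith
  qed
  have main: "\<bar>\<Sum>n\<le>N. c n / ln (real n)\<bar> \<le> (\<epsilon> * real N + A) / ln (real N)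
      + (\<epsilon> * (1 / ln 2 + ((sqrt (real N) + 1) / ln 2 + 2 * real N / ln (real N))) + A / ln 2)" if N: "N \<ge> 2" for N
  proof -
    have "\<bar>\<Sum>n\<le>N. c n / ln (real n)\<bar> \<le> \<bar>S N / ln (real N)\<bar> + \<bar>\<Sum>n=2..<N. S n * D n\<bar>"
      unfolding abel[OF N] by (rule abs_triangle_ineq)
    also have "\<bar>S N / ln (real N)\<bar> \<le> (\<epsilon> * real N + A) / ln (real N)"
      using A(2)[of N] N by (simp add: abs_divide divide_right_mono)
    also have "\<bar>\<Sum>n=2..<N. S n * D n\<bar> \<le> (\<Sum>n=2..<N. (\<epsilon> * real n + A) * D n)"
      using A(2) D by (intro order_trans[OF sum_abs] sum_mono) (auto simp: abs_mult intro!: mult_right_mono)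
    also have "\<dots> = \<epsilon> * (\<Sum>n=2..<N. real n * D n) + A * (\<Sum>n=2..<N. D n)"
      by (simp add: sum_distrib_left sum.distrib algebra_simps)
    also have "\<dots> \<le> \<epsilon> * (1 / ln 2 + ((sqrt (real N) + 1) / ln 2 + 2 * real N / ln (real N))) + A * (1 / ln 2)"
      using nD[OF N] sum_inverse_ln_le[OF N] sumD[OF N] A(1) \<epsilon> by (intro add_mono mult_left_mono) auto
    finally show ?thesis by simp
  qed
  define X where "X = (\<lambda>N::nat. (\<epsilon> * real N + A) / ln (real N)
      + (\<epsilon> * (1 / ln 2 + ((sqrt (real N) + 1) / ln 2 + 2 * real N / ln (real N))) + A / ln 2))"
  have "(\<lambda>N. X N * ln (real N) / real N) \<longlonglongrightarrow> 3 * \<epsilon>"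
    unfolding X_def by real_asymp
  then have "eventually (\<lambda>N. X N * ln (real N) / real N < 4 * \<epsilon>) sequentially"
    using \<epsilon> by (intro order_tendstoD) auto
  then obtain N0 where N0: "\<And>N. N \<ge> N0 \<Longrightarrow> X N * ln (real N) / real N < 4 * \<epsilon>"
    unfolding eventually_sequentially by blast
  show "\<exists>no. \<forall>N\<ge>no. norm ((\<Sum>n\<le>N. c n / ln (real n)) * ln (real N) / real N - 0) < e"
  proof (intro exI[of _ "max 2 N0"] allI impI)
    fix N assume N: "N \<ge> max 2 N0"
    have "norm ((\<Sum>n\<le>N. c n / ln (real n)) * ln (real N) / real N - 0)
        = \<bar>\<Sum>n\<le>N. c n / ln (real n)\<bar> * ln (real N) / real N"
      using N by (simp add: abs_mult abs_divide)
    also have "\<dots> \<le> X N * ln (real N) / real N"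
      using main[of N] N unfolding X_def by (intro divide_right_mono mult_right_mono) auto
    also have "\<dots> < 4 * \<epsilon>" using N0 N by auto
    also have "\<dots> < e" using e by (simp add: \<epsilon>_def)
    finally show "norm ((\<Sum>n\<le>N. c n / ln (real n)) * ln (real N) / real N - 0) < e" .
  qed
qed

section \<open>Chebyshev's lower bound\<close>

lemma ln_fact_mangoldt: "ln (fact N) = (\<Sum>d=1..N. mangoldt d * real (N div d))"
proof -
  have "ln (fact N) = (\<Sum>n=1..N. ln (real n))"
    by (induction N) (auto simp: ln_mult)
  also have "\<dots> = (\<Sum>n=1..N. \<Sum>d | d dvd n. mangoldt d)"
    using mangoldt_sum[where 'a = real] by (intro sum.cong) auto
  also have "\<dots> = (\<Sum>d=1..N. \<Sum>e=1..N div d. mangoldt d)"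
    by (rule sum_divisors_reindex[where f = "\<lambda>d e. mangoldt d"])
  finally show ?thesis by (simp add: mult.commute)
qed

text \<open>With \<open>n = N div 2\<close>, the central binomial coefficient is at least 2^n. Its
  logarithm weights \<open>mangoldt d\<close> by (2n div d) - 2 (n div d), which is at most 1. The
  shift in \<open>N - 1\<close> covers odd \<open>N\<close>.\<close>

lemma mangoldt_sum_ge: "(real N - 1) / 2 * ln 2 \<le> (\<Sum>n=1..N. mangoldt n)"
proof -
  define n where "n = N div 2"
  have div: "real ((2 * n) div d) \<le> 2 * real (n div d) + 1" for d
  proof (cases "d = 0")
    case False
    have "(2 * n) div d \<le> 2 * (n div d) + 1"
    proof -
      have "n < d * (n div d) + d" using False by (metis add.commute add_less_cancel_left div_mult_mod_eq mod_less_divisor mult.commute not_gr_zero)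
      then have "2 * n < d * (2 * (n div d) + 2)" by (simp add: algebra_simps)
      then have "(2 * n) div d < 2 * (n div d) + 2" using False by (subst div_less_iff_less_mult) (auto simp: mult.commute)
      then show ?thesis by simp
    qed
    then show ?thesis by linarith
  qed simp
  have "(2::real) ^ n \<le> real (2 * n choose n)"
    using binomial_ge_n_over_k_pow_k[of n "2 * n", where 'a = real] by (cases "n = 0") auto
  then have "real n * ln 2 \<le> ln (real (2 * n choose n))"
    using ln_mono[of "2 ^ n" "real (2 * n choose n)"] by (simp add: ln_realpow)
  also have "real (2 * n choose n) = fact (2 * n) / (fact n * fact n)"
    using binomial_fact[of n "2 * n", where 'a = real] by simp
  also have "ln \<dots> = ln (fact (2 * n)) - 2 * ln (fact n)"
    by (simp add: ln_div ln_mult)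
  also have "ln (fact n) = (\<Sum>d=1..2*n. mangoldt d * real (n div d))"
    unfolding ln_fact_mangoldt by (rule sum.mono_neutral_left) auto
  also have "ln (fact (2 * n)) - 2 * (\<Sum>d=1..2*n. mangoldt d * real (n div d)) =
      (\<Sum>d=1..2*n. mangoldt d * (real ((2 * n) div d) - 2 * real (n div d)))"
    unfolding ln_fact_mangoldt by (simp add: sum_distrib_left sum_subtractf right_diff_distrib mult_ac)
  also have "\<dots> \<le> (\<Sum>d=1..2*n. mangoldt d * 1)"
    using div by (intro sum_mono mult_left_mono mangoldt_nonneg) (simp add: diff_le_eq add.commute)
  also have "\<dots> \<le> (\<Sum>d=1..N. mangoldt d * 1)"
    by (intro sum_mono2) (auto simp: n_def mangoldt_nonneg)
  finally have "real n * ln 2 \<le> (\<Sum>d=1..N. mangoldt d)" by simp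
  moreover have "N \<le> 2 * n + 1" unfolding n_def by presburger
  then have "real N \<le> real (2 * n + 1)" by (simp only: of_nat_le_iff)
  then have "(real N - 1) / 2 \<le> real n" by simp
  then have "(real N - 1) / 2 * ln 2 \<le> real n * ln 2" by (intro mult_right_mono) auto
  ultimately show ?thesis by linarith
qed

text \<open>Each prime contributes at most ln N to the von Mangoldt sum and the proper powers are of
  lower order. Any constant below ln 2 / 2 would do; 1/4 leaves room since ln 2 is at least
  2/3.\<close>

lemma chebyshev_lower:
  "eventually (\<lambda>N. real (card (primes_upto N)) * ln (real N) \<ge> real N / 4) sequentially"
proof -
  have "eventually (\<lambda>N::nat. (real N - 1) / 2 * ln 2 - (sqrt (real N) + 1) * (log 2 (real N) + 1) * ln (real N) \<ge> real N / 4) sequentially"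
  proof -
    have "(1/4::real) < ln 2 / 2" using ln2_ge_two_thirds by simp
    have "eventually (\<lambda>N::nat. real N * (ln 2 / 2 - 1/4) - ln 2 / 2 - (sqrt (real N) + 1) * (log 2 (real N) + 1) * ln (real N) \<ge> 0) sequentially"
    proof -
      define a :: real where "a = ln 2 / 2 - 1/4"
      have "a > 0" using \<open>1/4 < _\<close> by (simp add: a_def)
      then have "eventually (\<lambda>N::nat. real N * a - ln 2 / 2 - (sqrt (real N) + 1) * (log 2 (real N) + 1) * ln (real N) \<ge> 0) sequentially"
        by real_asymp
      then show ?thesis by (simp add: a_def)
    qed
    then show ?thesis by (rule eventually_mono) (simp add: algebra_simps)
  qed
  moreover have "eventually (\<lambda>N. N \<ge> 1) sequentially" by (rule eventually_ge_at_top)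
  ultimately show ?thesis
  proof eventually_elim
    case (elim N)
    have split: "{1..N} = {n. n \<in> {1..N} \<and> \<not> prime n} \<union> primes_upto N"
      by (auto simp: prime_ge_1_nat Suc_le_eq prime_gt_0_nat)
    have "(\<Sum>n=1..N. mangoldt n :: real) = (\<Sum>n | n \<in> {1..N} \<and> \<not> prime n. mangoldt n) + (\<Sum>p\<in>primes_upto N. mangoldt p)"
      by (subst split, rule sum.union_disjoint) (use finite_primes_upto in auto)
    also have "(\<Sum>p\<in>primes_upto N. mangoldt p :: real) \<le> (\<Sum>p\<in>primes_upto N. ln (real N))"
      by (intro sum_mono) (auto dest!: prime_gt_0_nat)
    finally show ?case using mangoldt_proper_powers_le[of N] mangoldt_sum_ge[of N] elim by simp
  qed
qed

section \<open>The hyperbola method for the twisted von Mangoldt function\<close>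

context quadratic_character begin

lemma abs_sum_h_ln_le:
  assumes "y \<ge> 1"
  shows "\<bar>\<Sum>e=1..y. h e * ln (real e)\<bar> \<le> 4 * C * sqrt (real y)"
proof -
  have eq: "(\<Sum>e\<le>y. g e * h e) = (\<Sum>e=1..y. g e * h e)" for g
    by (rule sum.mono_neutral_right) (auto simp: h_0 Suc_le_eq)
  \<comment> \<open>Weights that decrease to 0 at \<open>y\<close>; the minimum continues them by 0,
    as \<open>abel_bound_antimono\<close> wants monotonicity at all indices.\<close>
  define b where "b = (\<lambda>n. ln (real y) - ln (real (min n y)))"
  have "\<bar>\<Sum>n\<le>y. h n * b n\<bar> \<le> C * b 1"
    using assms by (intro abel_bound_antimono h_0 h_bounded) (auto simp: b_def)
  also have "b 1 = ln (real y)" using assms by (simp add: b_def)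
  also have "(\<Sum>n\<le>y. h n * b n) = ln (real y) * (\<Sum>n\<le>y. h n) - (\<Sum>e=1..y. h e * ln (real e))"
  proof -
    have "(\<Sum>n\<le>y. h n * b n) = (\<Sum>n\<le>y. ln (real y) * h n - ln (real n) * h n)"
      by (intro sum.cong) (auto simp: b_def algebra_simps)
    also have "\<dots> = ln (real y) * (\<Sum>n\<le>y. h n) - (\<Sum>n\<le>y. ln (real n) * h n)"
      by (simp only: sum_subtractf sum_distrib_left)
    also have "(\<Sum>n\<le>y. ln (real n) * h n) = (\<Sum>e=1..y. h e * ln (real e))"
      by (subst eq) (simp add: mult.commute)
    finally show ?thesis .
  qed
  finally have "\<bar>\<Sum>e=1..y. h e * ln (real e)\<bar> \<le> \<bar>ln (real y) * (\<Sum>n\<le>y. h n)\<bar> + C * ln (real y)" by linarith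
  also have "\<bar>ln (real y) * (\<Sum>n\<le>y. h n)\<bar> \<le> ln (real y) * C"
    unfolding abs_mult using h_bounded[of y] assms by (intro mult_mono) auto
  also have "ln (real y) * C + C * ln (real y) = 2 * C * ln (real y)" by simp
  \<comment> \<open>The logarithm is traded for a square root so that the sum over d in
    \<open>hyperbola_bound\<close> becomes a power sum.\<close>
  also have "\<dots> \<le> 2 * C * (2 * sqrt (real y))"
  proof (intro mult_left_mono)
    have "ln (real y) = 2 * ln (sqrt (real y))" using assms by (simp add: ln_sqrt)
    also have "\<dots> \<le> 2 * sqrt (real y)" using ln_le_minus_one[of "sqrt (real y)"] assms by simp
    finally show "ln (real y) \<le> 2 * sqrt (real y)" .
  qed (use C_nonneg in auto)
  finally show ?thesis by simp
qed

text \<open>The sum runs over d e at most N with terms u(d) h(e) ln e. For d up to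
  \<open>N div K\<close> the inner sum over e is small by \<open>abs_sum_h_ln_le\<close>. A larger d
  forces e < K, and then summing over d first leaves differences of partial sums of
  \<open>u\<close>.\<close>

lemma hyperbola_bound:
  assumes K: "K \<ge> 1" and N: "N \<ge> 1"
  shows "\<bar>\<Sum>n=1..N. h n * mangoldt n\<bar> \<le> 12 * C * real N / sqrt (real K)
      + (\<Sum>e=1..<K. ln (real e) * (\<bar>\<Sum>n\<le>N div e. u n\<bar> + \<bar>\<Sum>n\<le>N div K. u n\<bar>))"
proof -
  let ?v = "\<lambda>e. h e * ln (real e)"
  have "(\<Sum>n=1..N. h n * mangoldt n) = (\<Sum>n=1..N. \<Sum>d | d dvd n. u d * ?v (n div d))"
  proof (rule sum.cong)
    fix n assume "n \<in> {1..N}"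
    then have n: "n > 0" by simp
    have "(\<Sum>d | d dvd n. u d * ?v (n div d)) = (\<Sum>d | d dvd n. h n * (moebius d * ln (real (n div d))))"
    proof (rule sum.cong)
      fix d assume "d \<in> {d. d dvd n}"
      then have "h n = h d * h (n div d)" by (simp flip: h_mult)
      then show "u d * ?v (n div d) = h n * (moebius d * ln (real (n div d)))" by (simp add: u_def)
    qed auto
    then show "h n * mangoldt n = (\<Sum>d | d dvd n. u d * ?v (n div d))"
      using sum_moebius_ln[OF n] by (simp flip: sum_distrib_left)
  qed auto
  also have "\<dots> = (\<Sum>d=1..N. \<Sum>e=1..N div d. u d * ?v e)" by (rule sum_divisors_reindex)
  also have "\<dots> = (\<Sum>d=1..N div K. \<Sum>e=1..N div d. u d * ?v e) + (\<Sum>d=Suc (N div K)..N. \<Sum>e=1..N div d. u d * ?v e)"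
  proof -
    have "{1..N} = {1..N div K} \<union> {Suc (N div K)..N}" using le_trans[OF _ div_le_dividend[of N K]] by auto
    moreover have "{1..N div K} \<inter> {Suc (N div K)..N} = {}" by auto
    ultimately show ?thesis by (metis (no_types, lifting) finite_atLeastAtMost sum.union_disjoint)
  qed
  also have "(\<Sum>d=Suc (N div K)..N. \<Sum>e=1..N div d. u d * ?v e) =
      (\<Sum>e=1..<K. ?v e * ((\<Sum>n\<le>N div e. u n) - (\<Sum>n\<le>N div K. u n)))"
  proof -
    have "(\<Sum>d=Suc (N div K)..N. \<Sum>e=1..N div d. u d * ?v e) =
        (\<Sum>d=Suc (N div K)..N. \<Sum>e | e \<in> {1..<K} \<and> d * e \<le> N. u d * ?v e)"
    proof (rule sum.cong)
      fix d assume d: "d \<in> {Suc (N div K)..N}"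
      have "{1..N div d} = {e \<in> {1..<K}. d * e \<le> N}"
      proof (rule Set.set_eqI)
        fix e
        have "e < K" if "d * e \<le> N"
        proof (rule ccontr)
          assume "\<not> e < K"
          then have "d * K \<le> N" using that by (meson le_trans mult_le_mono2 not_less)
          then have "d \<le> N div K" using K by (simp add: less_eq_div_iff_mult_less_eq)
          then show False using d by simp
        qed
        then show "e \<in> {1..N div d} \<longleftrightarrow> e \<in> {e \<in> {1..<K}. d * e \<le> N}"
          using d by (auto simp: less_eq_div_iff_mult_less_eq mult.commute)
      qed
      then show "(\<Sum>e=1..N div d. u d * ?v e) = (\<Sum>e | e \<in> {1..<K} \<and> d * e \<le> N. u d * ?v e)" by simp
    qed auto
    also have "\<dots> = (\<Sum>e\<in>{1..<K}. \<Sum>d | d \<in> {Suc (N div K)..N} \<and> d * e \<le> N. u d * ?v e)"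
      by (rule sum.swap_restrict) auto
    also have "\<dots> = (\<Sum>e=1..<K. ?v e * ((\<Sum>n\<le>N div e. u n) - (\<Sum>n\<le>N div K. u n)))"
    proof (rule sum.cong)
      fix e assume e: "e \<in> {1..<K}"
      have "{d. d \<in> {Suc (N div K)..N} \<and> d * e \<le> N} = {Suc (N div K)..N div e}"
        using e le_trans[OF _ div_le_dividend[of N e]] by (auto simp: less_eq_div_iff_mult_less_eq)
      moreover have "(\<Sum>n\<le>N div e. u n) = (\<Sum>n\<le>N div K. u n) + (\<Sum>d=Suc (N div K)..N div e. u d)"
      proof -
        have "N div K \<le> N div e" using e by (intro div_le_mono2) auto
        then have "{..N div e} = {..N div K} \<union> {Suc (N div K)..N div e}" by auto
        moreover have "{..N div K} \<inter> {Suc (N div K)..N div e} = {}" by auto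
        ultimately show ?thesis by (metis (no_types, lifting) finite_atLeastAtMost finite_atMost sum.union_disjoint)
      qed
      ultimately show "(\<Sum>d | d \<in> {Suc (N div K)..N} \<and> d * e \<le> N. u d * ?v e) =
          ?v e * ((\<Sum>n\<le>N div e. u n) - (\<Sum>n\<le>N div K. u n))"
        by (simp add: sum_distrib_right[symmetric] mult.commute)
    qed auto
    finally show ?thesis .
  qed
  finally have "\<bar>\<Sum>n=1..N. h n * mangoldt n\<bar> \<le> \<bar>\<Sum>d=1..N div K. \<Sum>e=1..N div d. u d * ?v e\<bar>
     + \<bar>\<Sum>e=1..<K. ?v e * ((\<Sum>n\<le>N div e. u n) - (\<Sum>n\<le>N div K. u n))\<bar>" by linarith
  also have "\<bar>\<Sum>d=1..N div K. \<Sum>e=1..N div d. u d * ?v e\<bar> \<le> 12 * C * real N / sqrt (real K)"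
  proof (cases "N div K = 0")
    case True
    then show ?thesis using C_nonneg by simp
  next
    case False
    have "\<bar>\<Sum>d=1..N div K. \<Sum>e=1..N div d. u d * ?v e\<bar> \<le> (\<Sum>d=1..N div K. 4 * C * sqrt (real N) * real d powr (1/2 - 1))"
    proof (rule order_trans[OF sum_abs sum_mono])
      fix d assume d: "d \<in> {1..N div K}"
      then have dN: "1 \<le> N div d" using le_trans[OF _ div_le_dividend[of N K]] by (simp add: less_eq_div_iff_mult_less_eq)
      have "\<bar>\<Sum>e=1..N div d. u d * ?v e\<bar> = \<bar>u d\<bar> * \<bar>\<Sum>e=1..N div d. ?v e\<bar>"
        by (simp add: sum_distrib_left[symmetric] abs_mult)
      also have "\<dots> \<le> 1 * (4 * C * sqrt (real (N div d)))"
        using abs_u_le_1 abs_sum_h_ln_le[OF dN] by (intro mult_mono) auto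
      also have "\<dots> \<le> 4 * C * sqrt (real N / real d)"
        using C_nonneg by (simp add: mult_left_mono of_nat_div_le_of_nat)
      also have "\<dots> = 4 * C * sqrt (real N) * real d powr (1/2 - 1)"
        using d by (simp add: real_sqrt_divide powr_minus powr_half_sqrt field_simps)
      finally show "\<bar>\<Sum>e=1..N div d. u d * ?v e\<bar> \<le> 4 * C * sqrt (real N) * real d powr (1/2 - 1)" .
    qed
    also have "\<dots> = 4 * C * sqrt (real N) * (\<Sum>d=1..N div K. real d powr (1/2 - 1))" by (simp add: sum_distrib_left)
    also have "\<dots> \<le> 4 * C * sqrt (real N) * (3 * sqrt (real (N div K)))"
    proof (rule mult_left_mono)
      \<comment> \<open>With exponent y = 1/2 the power sum is at most 2 + 1 times the square root;
        with the factor \<open>4 * C\<close> this is the origin of the constant 12.\<close>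
      have "(\<Sum>d=1..N div K. real d powr (1/2 - 1)) \<le> real (N div K) powr (1/2) / (1/2) + real (N div K) powr (1/2 - 1)"
        using False by (intro sum_powr_le) auto
      also have "real (N div K) powr (1/2 - 1) \<le> real (N div K) powr (1/2)" using False by (intro powr_mono) auto
      finally show "(\<Sum>d=1..N div K. real d powr (1/2 - 1)) \<le> 3 * sqrt (real (N div K))"
        by (simp add: powr_half_sqrt)
    qed (use C_nonneg in auto)
    also have "\<dots> \<le> 4 * C * sqrt (real N) * (3 * sqrt (real N / real K))"
      using C_nonneg by (intro mult_left_mono real_sqrt_le_mono of_nat_div_le_of_nat) auto
    also have "\<dots> = 12 * C * real N / sqrt (real K)" by (simp add: real_sqrt_divide)
    finally show ?thesis .
  qed
  also have "\<bar>\<Sum>e=1..<K. ?v e * ((\<Sum>n\<le>N div e. u n) - (\<Sum>n\<le>N div K. u n))\<bar> \<le>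
     (\<Sum>e=1..<K. ln (real e) * (\<bar>\<Sum>n\<le>N div e. u n\<bar> + \<bar>\<Sum>n\<le>N div K. u n\<bar>))"
  proof (rule order_trans[OF sum_abs sum_mono])
    fix e assume e: "e \<in> {1..<K}"
    have "\<bar>?v e\<bar> \<le> 1 * ln (real e)"
      unfolding abs_mult using e abs_h_le_1[of e] by (intro mult_mono) auto
    then show "\<bar>?v e * ((\<Sum>n\<le>N div e. u n) - (\<Sum>n\<le>N div K. u n))\<bar> \<le> ln (real e) * (\<bar>\<Sum>n\<le>N div e. u n\<bar> + \<bar>\<Sum>n\<le>N div K. u n\<bar>)"
      unfolding abs_mult[of "?v e"] using e by (intro mult_mono abs_triangle_ineq4) auto
  qed
  finally show ?thesis by simp
qed

lemma sum_h_mangoldt_sublinear: "(\<lambda>N. (\<Sum>n=1..N. h n * mangoldt n) / real N) \<longlonglongrightarrow> 0"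
proof (rule LIMSEQ_I)
  fix e :: real assume e: "e > 0"
  \<comment> \<open>The budget is three times e/3: \<open>K\<close> makes the first term of
    \<open>hyperbola_bound\<close> small, then \<open>\<epsilon>\<close>, depending on
    \<open>K\<close>, the linear part of the second, and finally \<open>N0\<close> its constant part
    with \<open>A\<close>.\<close>
  obtain K0 :: nat where K0: "real K0 > (36 * C / e)\<^sup>2" using reals_Archimedean2 by blast
  define K where "K = max 1 K0"
  have K: "K \<ge> 1" by (simp add: K_def)
  have "36 * C / e < sqrt (real K)"
    using K0 C_nonneg e by (intro real_less_rsqrt) (auto simp: K_def)
  then have K_small: "12 * C / sqrt (real K) < e / 3" using e K by (simp add: field_simps)
  define \<epsilon> where "\<epsilon> = e / (6 * (real K)\<^sup>2)"
  have \<epsilon>: "\<epsilon> > 0" using e K by (simp add: \<epsilon>_def)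
  obtain A where A: "A \<ge> 0" "\<And>n. \<bar>\<Sum>k\<le>n. u k\<bar> \<le> \<epsilon> * real n + A"
    using sublinear_affine_bound[OF sum_u_sublinear \<epsilon>] by blast
  obtain N0 :: nat where N0: "real N0 > 6 * (real K)\<^sup>2 * A / e" using reals_Archimedean2 by blast
  show "\<exists>no. \<forall>N\<ge>no. norm ((\<Sum>n=1..N. h n * mangoldt n) / real N - 0) < e"
  proof (intro exI[of _ "max 1 N0"] allI impI)
    fix N assume N: "N \<ge> max 1 N0"
    have "(\<Sum>e=1..<K. ln (real e) * (\<bar>\<Sum>n\<le>N div e. u n\<bar> + \<bar>\<Sum>n\<le>N div K. u n\<bar>)) \<le>
        (\<Sum>e=1..<K. real K * (2 * (\<epsilon> * real N + A)))"
    proof (rule sum_mono)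
      fix e assume e: "e \<in> {1..<K}"
      have "\<bar>\<Sum>n\<le>N div m. u n\<bar> \<le> \<epsilon> * real N + A" for m
      proof -
        have "\<epsilon> * real (N div m) \<le> \<epsilon> * real N" using \<epsilon> by (intro mult_left_mono) auto
        then show ?thesis using A(2)[of "N div m"] by linarith
      qed
      from add_mono[OF this[of e] this[of K]]
      have "\<bar>\<Sum>n\<le>N div e. u n\<bar> + \<bar>\<Sum>n\<le>N div K. u n\<bar> \<le> 2 * (\<epsilon> * real N + A)" by simp
      moreover have "ln (real e) \<le> real K" using e ln_le_minus_one[of "real e"] by auto
      ultimately show "ln (real e) * (\<bar>\<Sum>n\<le>N div e. u n\<bar> + \<bar>\<Sum>n\<le>N div K. u n\<bar>) \<le> real K * (2 * (\<epsilon> * real N + A))"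
        using e by (intro mult_mono) auto
    qed
    also have "\<dots> = real (K - 1) * (real K * (2 * (\<epsilon> * real N + A)))" by simp
    also have "\<dots> \<le> real K * (real K * (2 * (\<epsilon> * real N + A)))"
      using A \<epsilon> by (intro mult_right_mono) auto
    also have "\<dots> = 2 * (real K)\<^sup>2 * \<epsilon> * real N + 2 * (real K)\<^sup>2 * A" by (simp add: power2_eq_square algebra_simps)
    also have "2 * (real K)\<^sup>2 * \<epsilon> = e / 3" using K by (simp add: \<epsilon>_def)
    also have "2 * (real K)\<^sup>2 * A < e / 3 * real N"
    proof -
      have "6 * (real K)\<^sup>2 * A / e < real N" using N0 N by linarith
      then show ?thesis using e by (simp add: field_simps)
    qed
    finally have "(\<Sum>e=1..<K. ln (real e) * (\<bar>\<Sum>n\<le>N div e. u n\<bar> + \<bar>\<Sum>n\<le>N div K. u n\<bar>)) < 2 * (e / 3) * real N" by simp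
    moreover have "12 * C * real N / sqrt (real K) \<le> e / 3 * real N"
      using mult_right_mono[OF less_imp_le[OF K_small], of "real N"] by simp
    ultimately have "\<bar>\<Sum>n=1..N. h n * mangoldt n\<bar> < e * real N"
      using hyperbola_bound[OF K, of N] N by linarith
    then show "norm ((\<Sum>n=1..N. h n * mangoldt n) / real N - 0) < e"
      using N by (simp add: abs_divide field_simps)
  qed
qed

text \<open>Proper prime powers are dropped, \<open>sum_div_ln_small\<close> removes the weight ln,
  giving o(N / ln N), and Chebyshev's bound converts this into o of the prime count at the cost of a
  factor 4.\<close>

lemma sum_h_primes_small:
  "(\<lambda>N. (\<Sum>p\<in>primes_upto N. h p) / real (card (primes_upto N))) \<longlonglongrightarrow> 0"
proof -
  define c where "c = (\<lambda>n. if prime n then h n * ln (real n) else 0)"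
  have c_eq: "(\<Sum>n\<le>N. c n) = (\<Sum>n=1..N. h n * mangoldt n) - (\<Sum>n | n \<in> {1..N} \<and> \<not> prime n. h n * mangoldt n)" for N
  proof -
    have "(\<Sum>n=1..N. h n * mangoldt n) = (\<Sum>n=1..N. c n + (if \<not> prime n then h n * mangoldt n else 0))"
      by (intro sum.cong) (auto simp: c_def)
    also have "\<dots> = (\<Sum>n=1..N. c n) + (\<Sum>n | n \<in> {1..N} \<and> \<not> prime n. h n * mangoldt n)"
      by (simp only: sum.distrib sum.inter_filter[OF finite_atLeastAtMost])
    also have "(\<Sum>n=1..N. c n) = (\<Sum>n\<le>N. c n)" by (rule sum.mono_neutral_left) (auto simp: c_def Suc_le_eq)
    finally show ?thesis by simp
  qed
  have "(\<lambda>N. (\<Sum>n | n \<in> {1..N} \<and> \<not> prime n. h n * mangoldt n) / real N) \<longlonglongrightarrow> 0"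
  proof (rule Lim_null_comparison)
    show "(\<lambda>N::nat. (sqrt (real N) + 1) * (log 2 (real N) + 1) * ln (real N) / real N) \<longlonglongrightarrow> 0" by real_asymp
    show "\<forall>\<^sub>F N in sequentially. norm ((\<Sum>n | n \<in> {1..N} \<and> \<not> prime n. h n * mangoldt n) / real N) \<le>
       (sqrt (real N) + 1) * (log 2 (real N) + 1) * ln (real N) / real N"
      using eventually_ge_at_top[of 1]
    proof eventually_elim
      case (elim N)
      have "\<bar>\<Sum>n | n \<in> {1..N} \<and> \<not> prime n. h n * mangoldt n\<bar> \<le> (\<Sum>n | n \<in> {1..N} \<and> \<not> prime n. mangoldt n)"
      proof (rule order_trans[OF sum_abs sum_mono])
        fix n show "\<bar>h n * mangoldt n\<bar> \<le> mangoldt n"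
          unfolding abs_mult using mult_right_mono[OF abs_h_le_1[of n], of "\<bar>mangoldt n\<bar>"] mangoldt_nonneg[of n] by simp
      qed
      also note mangoldt_proper_powers_le[OF elim]
      finally show ?case by (simp add: abs_divide divide_right_mono)
    qed
  qed
  from tendsto_diff[OF sum_h_mangoldt_sublinear this]
  have "(\<lambda>N. (\<Sum>n\<le>N. c n) / real N) \<longlonglongrightarrow> 0" by (simp add: c_eq diff_divide_distrib)
  then have "(\<lambda>N. (\<Sum>n\<le>N. c n / ln (real n)) * ln (real N) / real N) \<longlonglongrightarrow> 0"
    by (intro sum_div_ln_small) (auto simp: c_def)
  also have "(\<lambda>N. \<Sum>n\<le>N. c n / ln (real n)) = (\<lambda>N. \<Sum>p\<in>primes_upto N. h p)"
  proof
    fix N :: nat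
    have "(\<Sum>n\<le>N. c n / ln (real n)) = (\<Sum>p\<in>primes_upto N. c p / ln (real p))"
      by (rule sum.mono_neutral_right) (auto simp: c_def)
    also have "\<dots> = (\<Sum>p\<in>primes_upto N. h p)"
      by (intro sum.cong) (auto simp: c_def dest!: prime_gt_1_nat)
    finally show "(\<Sum>n\<le>N. c n / ln (real n)) = (\<Sum>p\<in>primes_upto N. h p)" .
  qed
  finally have lim: "(\<lambda>N. (\<Sum>p\<in>primes_upto N. h p) * ln (real N) / real N) \<longlonglongrightarrow> 0" .
  show ?thesis
  proof (rule Lim_null_comparison)
    show "(\<lambda>N. 4 * \<bar>(\<Sum>p\<in>primes_upto N. h p) * ln (real N) / real N\<bar>) \<longlonglongrightarrow> 0"
      using tendsto_mult[OF tendsto_const[of "4::real"] tendsto_rabs[OF lim]] by simp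
    show "\<forall>\<^sub>F N in sequentially. norm ((\<Sum>p\<in>primes_upto N. h p) / real (card (primes_upto N))) \<le>
       4 * \<bar>(\<Sum>p\<in>primes_upto N. h p) * ln (real N) / real N\<bar>"
      using chebyshev_lower eventually_ge_at_top[of 2]
    proof eventually_elim
      case (elim N)
      define q where "q = real (card (primes_upto N))"
      define s where "s = \<bar>\<Sum>p\<in>primes_upto N. h p\<bar>"
      have s: "s \<ge> 0" by (simp add: s_def)
      have lnN: "ln (real N) > 0" using elim by simp
      have "q * ln (real N) > 0" using elim unfolding q_def by linarith
      then have q: "q > 0" using lnN by (simp add: zero_less_mult_iff)
      have "s * real N \<le> s * (4 * (q * ln (real N)))" using elim s unfolding q_def by (intro mult_left_mono) auto
      then have "s / q \<le> 4 * (s * ln (real N) / real N)" using q elim by (simp add: field_simps)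
      then show ?case using lnN elim by (simp add: abs_divide abs_mult s_def q_def)
    qed
  qed
qed

end

section \<open>Periodic characters from quadratic reciprocity\<close>

lemma Legendre_values: "Legendre a p \<in> {-1, 0, 1}"
  by (simp add: Legendre_def)

lemma Legendre_cong: "[a = b] (mod p) \<Longrightarrow> Legendre a p = Legendre b p"
  by (simp add: Legendre_def QuadRes_def Cong.cong_def)

text \<open>By Euler's criterion both sides agree modulo p; they differ by at most 2, which is less
  than p.\<close>

lemma Legendre_mult:
  assumes p: "prime p" "2 < p"
  shows "Legendre (a * b) (int p) = Legendre a (int p) * Legendre b (int p)"
proof -
  have "[Legendre (a * b) (int p) = (a * b) ^ ((p - 1) div 2)] (mod int p)"
    by (rule euler_criterion[OF p])
  also have "(a * b) ^ ((p - 1) div 2) = a ^ ((p - 1) div 2) * b ^ ((p - 1) div 2)"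
    by (rule power_mult_distrib)
  also have "[\<dots> = Legendre a (int p) * Legendre b (int p)] (mod int p)"
    by (intro cong_mult cong_sym[OF euler_criterion[OF p]])
  finally have "int p dvd Legendre (a * b) (int p) - Legendre a (int p) * Legendre b (int p)"
    by (simp add: cong_iff_dvd_diff)
  moreover have "\<bar>Legendre (a * b) (int p) - Legendre a (int p) * Legendre b (int p)\<bar> < int p"
    using Legendre_values[of "a * b" "int p"] Legendre_values[of a "int p"] Legendre_values[of b "int p"] p by auto
  ultimately show ?thesis using zdvd_imp_le[of "int p" "\<bar>Legendre (a * b) (int p) - Legendre a (int p) * Legendre b (int p)\<bar>"]
    by (auto simp: dvd_abs_iff)
qed

lemma Legendre_eq_0_iff: "Legendre a (int p) = 0 \<longleftrightarrow> int p dvd a"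
  by (simp add: Legendre_def cong_0_iff)

lemma Legendre_1: "2 < p \<Longrightarrow> Legendre 1 (int p) = 1"
  by (auto simp: Legendre_def QuadRes_def Cong.cong_def intro: exI[of _ 1])

lemma Legendre_prime_prod:
  assumes "prime p" "2 < p"
  shows "Legendre (\<Prod>x\<in>X. f x) (int p) = (\<Prod>x\<in>X. Legendre (f x) (int p))"
proof (induction X rule: infinite_finite_induct)
  case (insert x X)
  then show ?case by (simp add: Legendre_mult[OF assms])
qed (use assms in \<open>simp_all add: Legendre_1\<close>)

section \<open>Characters modulo 4 and 8 and the symbol of 2\<close>

definition char4 :: "nat \<Rightarrow> int" where
  "char4 n = (if n mod 4 = 1 then 1 else if n mod 4 = 3 then -1 else 0)"

text \<open>\<open>char4\<close> and \<open>char8\<close> are the Kronecker symbols (-4/n) and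
  (8/n).\<close>

definition char8 :: "nat \<Rightarrow> int" where
  "char8 n = (if n mod 8 = 1 \<or> n mod 8 = 7 then 1 else if n mod 8 = 3 \<or> n mod 8 = 5 then -1 else 0)"

lemma char4_mult: "char4 (m * n) = char4 m * char4 n"
proof -
  have "m mod 4 = 0 \<or> m mod 4 = 1 \<or> m mod 4 = 2 \<or> m mod 4 = 3"
    "n mod 4 = 0 \<or> n mod 4 = 1 \<or> n mod 4 = 2 \<or> n mod 4 = 3" by presburger+
  moreover have "(m * n) mod 4 = ((m mod 4) * (n mod 4)) mod 4" by (simp add: mod_mult_eq)
  ultimately show ?thesis unfolding char4_def by (elim disjE) simp_all
qed

lemma char8_mult: "char8 (m * n) = char8 m * char8 n"
proof -
  have "m mod 8 = 0 \<or> m mod 8 = 1 \<or> m mod 8 = 2 \<or> m mod 8 = 3 \<or> m mod 8 = 4 \<or> m mod 8 = 5 \<or> m mod 8 = 6 \<or> m mod 8 = 7"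
    "n mod 8 = 0 \<or> n mod 8 = 1 \<or> n mod 8 = 2 \<or> n mod 8 = 3 \<or> n mod 8 = 4 \<or> n mod 8 = 5 \<or> n mod 8 = 6 \<or> n mod 8 = 7"
    by presburger+
  moreover have "(m * n) mod 8 = ((m mod 8) * (n mod 8)) mod 8" by (simp add: mod_mult_eq)
  ultimately show ?thesis unfolding char8_def by (elim disjE) simp_all
qed

text \<open>Gauss's lemma. The multiples 2x with x up to (p-1)/2 are already reduced modulo p, and
  those beyond (p-1)/2 are the ones with x > (p-1) div 4; the parity of their number depends on p
  modulo 8.\<close>

lemma Legendre_2:
  assumes p: "prime p" "2 < p"
  shows "Legendre 2 (int p) = char8 p"
proof -
  have odd: "odd p" using p prime_odd_nat by auto
  interpret GAUSS p 2
  proof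
    show "[2 \<noteq> 0] (mod int p)" using p zdvd_imp_le[of "int p" 2] by (auto simp: cong_0_iff)
  qed (use p in auto)
  have C_eq: "C = (\<lambda>x. x * 2) ` {0<..(int p - 1) div 2}"
    unfolding C_def B_def A_def image_image by (rule image_cong) auto
  have "E = (\<lambda>x. x * 2) ` {(int p - 1) div 4<..(int p - 1) div 2}"
    unfolding E_def C_eq using p by (auto simp: image_iff)
  then have "card E = card {(int p - 1) div 4<..(int p - 1) div 2}"
    by (simp add: card_image inj_on_def)
  then have card: "card E = nat ((int p - 1) div 2 - (int p - 1) div 4)" by simp
  have residues: "p mod 8 = 1 \<or> p mod 8 = 7 \<or> p mod 8 = 3 \<or> p mod 8 = 5" using odd by presburger
  have div4: "(6 + 8 * k) div 4 = 2 * k + 1" "(2 + 8 * k) div 4 = 2 * k" for k :: int by presburger+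
  have "int p = 8 * int (p div 8) + int (p mod 8)" by (metis mult_div_mod_eq of_nat_add of_nat_mult of_nat_numeral)
  then have "even ((int p - 1) div 2 - (int p - 1) div 4) \<longleftrightarrow> p mod 8 = 1 \<or> p mod 8 = 7"
    using residues div4 by (elim disjE) simp_all
  then have "even (card E) \<longleftrightarrow> p mod 8 = 1 \<or> p mod 8 = 7"
    using p unfolding card by (simp add: even_nat_iff)
  then show ?thesis using gauss_lemma residues by (auto simp: char8_def)
qed

text \<open>The numerator-denominator flip of quadratic reciprocity turns \<open>p \<mapsto> (q/p)\<close> into a periodic
  function.\<close>

definition flipped_Legendre :: "nat \<Rightarrow> nat \<Rightarrow> int" where
  "flipped_Legendre q n = (if q = 2 then char8 n
     else Legendre (int n) (int q) * (if q mod 4 = 3 then char4 n else 1))"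

lemma flipped_Legendre_prime:
  assumes q: "prime q" and p: "prime p" "2 < p" "p \<noteq> q"
  shows "flipped_Legendre q p = Legendre (int q) (int p)"
proof (cases "q = 2")
  case True
  then show ?thesis using Legendre_2 p by (simp add: flipped_Legendre_def)
next
  case False
  then have q2: "2 < q" using prime_ge_2_nat[OF q] by simp
  have odd: "odd p" "odd q" using p q q2 prime_odd_nat by auto
  have QR: "Legendre (int p) (int q) * Legendre (int q) (int p) = (-1) ^ ((p - 1) div 2 * ((q - 1) div 2))"
    using Quadratic_Reciprocity[OF p(1,2) q q2 p(3)] .
  have "q mod 4 = 1 \<or> q mod 4 = 3" using odd by presburger
  \<comment> \<open>The reciprocity sign is nontrivial only for q congruent to 3 modulo 4, where it
    is \<open>char4 p\<close>; this is the twist in \<open>flipped_Legendre\<close>.\<close>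
  then have sign: "(-1 :: int) ^ ((p - 1) div 2 * ((q - 1) div 2)) = (if q mod 4 = 3 then char4 p else 1)"
  proof
    assume q1: "q mod 4 = 1"
    then have "even ((q - 1) div 2)" by presburger
    then show ?thesis using q1 by simp
  next
    assume q3: "q mod 4 = 3"
    then have oq: "odd ((q - 1) div 2)" by presburger
    have "p mod 4 = 1 \<or> p mod 4 = 3" using odd by presburger
    then show ?thesis
    proof
      assume p1: "p mod 4 = 1"
      then have "even ((p - 1) div 2)" by presburger
      then show ?thesis using p1 q3 by (simp add: char4_def)
    next
      assume p3: "p mod 4 = 3"
      then have "odd ((p - 1) div 2)" by presburger
      then show ?thesis using oq p3 q3 by (simp add: char4_def)
    qed
  qed
  have "\<not> q dvd p" "\<not> p dvd q" using p q primes_dvd_imp_eq by blast+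
  then have "Legendre (int p) (int q) = 1 \<or> Legendre (int p) (int q) = -1"
    using Legendre_values[of "int p" "int q"] Legendre_eq_0_iff[of "int p" q] by auto
  then have "Legendre (int q) (int p) = Legendre (int p) (int q) * (if q mod 4 = 3 then char4 p else 1)"
    using QR unfolding sign by auto
  then show ?thesis using False by (simp add: flipped_Legendre_def)
qed

lemma flipped_Legendre_mult:
  assumes "prime q"
  shows "flipped_Legendre q (m * n) = flipped_Legendre q m * flipped_Legendre q n"
proof -
  have "2 < q" if "q \<noteq> 2" using that prime_ge_2_nat[OF assms] by simp
  then show ?thesis by (simp add: flipped_Legendre_def char8_mult char4_mult Legendre_mult assms)
qed

lemma flipped_Legendre_values: "flipped_Legendre q n \<in> {-1, 0, 1}"
  using Legendre_values[of "int n" "int q"] by (auto simp: flipped_Legendre_def char8_def char4_def)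

lemma flipped_Legendre_cong:
  assumes "[m = n] (mod 8 * q)"
  shows "flipped_Legendre q m = flipped_Legendre q n"
proof -
  have 8: "m mod 8 = n mod 8" using cong_modulus_mult_nat[OF assms] by (simp add: Cong.cong_def)
  have "m mod 4 = n mod 4"
    using arg_cong[OF 8, of "\<lambda>x. x mod 4"] by (simp add: mod_mod_cancel)
  moreover have "[int m = int n] (mod int q)"
    using cong_modulus_mult_nat[of m n q 8] assms by (simp add: mult.commute cong_int_iff)
  ultimately show ?thesis using 8 Legendre_cong by (simp add: flipped_Legendre_def char8_def char4_def)
qed

text \<open>If every class in 1..p-1 were a square, squaring would be onto and hence injective on
  these classes, but 1 and p - 1 have the same square.\<close>

lemma exists_nonresidue:
  assumes p: "prime p" "2 < p"
  obtains r :: nat where "Legendre (int r) (int p) = -1"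
proof -
  have "\<exists>r\<in>{1..<p}. Legendre (int r) (int p) = -1"
  proof (rule ccontr)
    assume no: "\<not> (\<exists>r\<in>{1..<p}. Legendre (int r) (int p) = -1)"
    let ?f = "\<lambda>x::nat. x\<^sup>2 mod p"
    have "{1..<p} \<subseteq> ?f ` {1..<p}"
    proof
      fix r assume r: "r \<in> {1..<p}"
      then have nd: "\<not> p dvd r" by (auto dest: dvd_imp_le)
      have "Legendre (int r) (int p) \<noteq> -1" using no r by blast
      then have "QuadRes (int p) (int r)" by (auto simp: Legendre_def split: if_splits simp: cong_0_iff nd)
      then obtain y where y: "[y\<^sup>2 = int r] (mod int p)" by (auto simp: QuadRes_def)
      define x where "x = nat (y mod int p)"
      have ix: "int x = y mod int p" using p by (simp add: x_def)
      have "[(int x)\<^sup>2 = int r] (mod int p)" unfolding ix using y by (simp add: Cong.cong_def power_mod)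
      then have "[int (x\<^sup>2) = int r] (mod int p)" by simp
      then have "[x\<^sup>2 = r] (mod p)" by (rule iffD1[OF cong_int_iff])
      then have xr: "x\<^sup>2 mod p = r" using r by (simp add: Cong.cong_def)
      have "x < p" unfolding x_def using p by (simp add: nat_less_iff)
      moreover have "x \<noteq> 0" using xr r by (cases "x = 0") auto
      ultimately show "r \<in> ?f ` {1..<p}" using xr by (intro image_eqI[of _ _ x]) auto
    qed
    then have "card {1..<p} \<le> card (?f ` {1..<p})" by (rule card_mono[rotated]) simp
    then have "card (?f ` {1..<p}) = card {1..<p}" using card_image_le[of "{1..<p}" ?f] by simp
    then have "inj_on ?f {1..<p}" by (rule eq_card_imp_inj_on[rotated]) simp
    moreover have "?f (p - 1) = ?f 1"
    proof -
      have sq: "(p - 1)\<^sup>2 = p * (p - 2) + 1"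
        using p by (cases p; cases "p - 1") (auto simp: power2_eq_square algebra_simps)
      show ?thesis unfolding sq one_power2 by (rule mod_mult_self4)
    qed
    ultimately have "p - 1 = 1" using p by (auto simp: inj_on_def)
    then show False using p by simp
  qed
  then show ?thesis using that by blast
qed

lemma periodic_sum_bounded:
  fixes f :: "nat \<Rightarrow> real"
  assumes k: "k > 0" and per: "\<And>n. f (n + k) = f n" and zero: "(\<Sum>n<k. f n) = 0" and f: "\<And>n. \<bar>f n\<bar> \<le> 1"
  shows "\<bar>\<Sum>n\<le>N. f n\<bar> \<le> real k"
proof -
  have split: "(\<Sum>n<k + m. f n) = (\<Sum>n<k. f n) + (\<Sum>n<m. f (n + k))" for m
    by (induction m) (simp_all add: add.commute add.left_commute)
  have shift: "(\<Sum>n<k * a + b. f n) = (\<Sum>n<b. f n)" for a b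
  proof (induction a)
    case (Suc a)
    have "(\<Sum>n<k * Suc a + b. f n) = (\<Sum>n<k. f n) + (\<Sum>n<k * a + b. f (n + k))"
      using split[of "k * a + b"] by (simp add: add.assoc)
    then show ?case using Suc zero per by simp
  qed simp
  have "(\<Sum>n\<le>N. f n) = (\<Sum>n<Suc N mod k. f n)"
    using shift[of "Suc N div k" "Suc N mod k"] by (simp add: lessThan_Suc_atMost)
  also have "\<bar>\<dots>\<bar> \<le> (\<Sum>n<Suc N mod k. 1)" using f by (intro order_trans[OF sum_abs] sum_mono) auto
  also have "\<dots> \<le> real k" using k by (simp add: less_imp_le)
  finally show ?thesis .
qed

text \<open>The Chinese remainder theorem makes one chosen factor \<open>q0\<close> equal to -1 and
  all others equal to 1. The condition c = 1 modulo 4 neutralizes the \<open>char4\<close> twists.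
  If 2 is in \<open>Q\<close> it is chosen as \<open>q0\<close> with residue 5, since 5 is 1 modulo
  4 and \<open>char8 5 = -1\<close>.\<close>

lemma exists_character_value_minus_1:
  assumes Q: "finite Q" "Q \<noteq> {}" "\<And>q. q \<in> Q \<Longrightarrow> prime q"
  obtains c where "coprime c (8 * \<Prod>Q)" "(\<Prod>q\<in>Q. flipped_Legendre q c) = -1"
proof -
  obtain q0 t where q0: "q0 \<in> Q" and t: "\<And>n. [n = t] (mod (if q0 = 2 then 8 else q0)) \<Longrightarrow> n mod 4 = 1 \<Longrightarrow> flipped_Legendre q0 n = -1"
    and t_cop: "coprime t q0" and t2: "q0 = 2 \<Longrightarrow> t = 5"
  proof (cases "2 \<in> Q")
    case True
    show ?thesis
    proof (rule that[OF True, of 5])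
      show "flipped_Legendre 2 n = -1" if "[n = 5] (mod (if (2::nat) = 2 then 8 else 2))" for n
        using that by (simp add: flipped_Legendre_def char8_def Cong.cong_def)
    qed auto
  next
    case False
    obtain q where q: "q \<in> Q" using Q by auto
    then have qp: "prime q" "2 < q" using Q(3)[of q] False prime_ge_2_nat[of q] by (auto simp: le_less)
    obtain r where r: "Legendre (int r) (int q) = -1" using exists_nonresidue[OF qp] .
    show ?thesis
    proof (rule that[OF q, of r])
      fix n assume n: "[n = r] (mod (if q = 2 then 8 else q))" "n mod 4 = 1"
      then have "Legendre (int n) (int q) = -1"
        using r qp Legendre_cong[of "int n" "int r" "int q"] by (simp add: cong_int_iff)
      then show "flipped_Legendre q n = -1" using qp n by (simp add: flipped_Legendre_def char4_def)
    next
      have "\<not> q dvd r" using r Legendre_eq_0_iff[of "int r" q] by auto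
      then show "coprime r q" using qp by (simp add: prime_imp_coprime coprime_commute)
    qed (use qp in auto)
  qed
  \<comment> \<open>The modulus at 2 is 8, the period of \<open>char8\<close>. The index set
    \<open>insert 2 Q\<close> prescribes c modulo 8 even when 2 is not in \<open>Q\<close>, which
    controls c modulo 4.\<close>
  define m where "m = (\<lambda>q::nat. if q = 2 then 8 else q)"
  define v where "v = (\<lambda>q. if q = q0 then t else 1)"
  have pQ: "prime q" if "q \<in> insert 2 Q" for q using that Q by auto
  have cop: "\<forall>i\<in>insert 2 Q. \<forall>j\<in>insert 2 Q. i \<noteq> j \<longrightarrow> coprime (m i) (m j)"
  proof (intro ballI impI)
    fix i j assume ij: "i \<in> insert 2 Q" "j \<in> insert 2 Q" "i \<noteq> j"
    have e: "m i = i ^ (if i = 2 then 3 else 1)" for i by (simp add: m_def)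
    show "coprime (m i) (m j)" unfolding e using primes_coprime[OF pQ[OF ij(1)] pQ[OF ij(2)] ij(3)] by simp
  qed
  obtain c where c: "\<forall>i\<in>insert 2 Q. [c = v i] (mod m i)"
    using chinese_remainder_nat[OF _ cop, of v] Q by auto
  have c8: "c mod 8 = v 2 mod 8" using c by (auto simp: m_def Cong.cong_def)
  have cop_c: "coprime c q" if "q \<in> insert 2 Q" for q
  proof -
    have "[c = v q] (mod m q)" using c that by blast
    then have "[c = v q] (mod q)"
      by (cases "q = 2") (auto simp: m_def intro: cong_dvd_modulus_nat)
    moreover have "coprime (v q) q" using t_cop by (simp add: v_def)
    ultimately show ?thesis using cong_imp_coprime cong_sym by blast
  qed
  have c4: "c mod 4 = 1"
  proof -
    have "c mod 4 = v 2 mod 4" using arg_cong[OF c8, of "\<lambda>x. x mod 4"] by (simp add: mod_mod_cancel)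
    then show ?thesis using t2 by (auto simp: v_def split: if_splits)
  qed
  have "flipped_Legendre q0 c = -1"
  proof (rule t[OF _ c4])
    have "[c = v q0] (mod m q0)" using c q0 by blast
    then show "[c = t] (mod (if q0 = 2 then 8 else q0))" by (simp add: v_def m_def)
  qed
  moreover have "flipped_Legendre q c = 1" if q: "q \<in> Q - {q0}" for q
  proof -
    have cq: "[c = 1] (mod m q)" using c q by (auto simp: v_def)
    show ?thesis
    proof (cases "q = 2")
      case True
      then show ?thesis using cq by (simp add: flipped_Legendre_def char8_def m_def Cong.cong_def)
    next
      case False
      then have "2 < q" using Q(3)[of q] q prime_ge_2_nat[of q] by auto
      moreover have "[int c = int 1] (mod int q)" using cq False by (simp only: m_def if_False cong_int_iff)
      ultimately have "Legendre (int c) (int q) = 1" using Legendre_cong Legendre_1 by fastforce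
      then show ?thesis using False c4 by (simp add: flipped_Legendre_def char4_def)
    qed
  qed
  ultimately have "(\<Prod>q\<in>Q. flipped_Legendre q c) = -1"
    using Q(1) q0 by (simp add: prod.remove)
  moreover have "coprime c (8 * \<Prod>Q)"
  proof -
    have "coprime c (2 ^ 3)" using cop_c[of 2] by (subst coprime_power_right_iff) simp
    then have "coprime c 8" by (simp only: power3_eq_cube, simp)
    moreover have "coprime c (\<Prod>Q)" by (rule prod_coprime_right) (use cop_c in auto)
    ultimately show ?thesis by simp
  qed
  ultimately show ?thesis using that by blast
qed

theorem exists_quadratic_character:
  assumes Q: "finite Q" "Q \<noteq> {}" "\<And>q. q \<in> Q \<Longrightarrow> prime q"
  obtains h C where "quadratic_character h C"
    "\<And>p. prime p \<Longrightarrow> 2 < p \<Longrightarrow> p \<notin> Q \<Longrightarrow> h p = of_int (\<Prod>q\<in>Q. Legendre (int q) (int p))"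
proof -
  define g where "g = (\<lambda>n. \<Prod>q\<in>Q. flipped_Legendre q n)"
  define h where "h = (\<lambda>n. real_of_int (g n))"
  \<comment> \<open>A common period of all factors: 8 for \<open>char4\<close> and
    \<open>char8\<close>, each odd q for its Legendre symbol.\<close>
  define k where "k = 8 * \<Prod>Q"
  have k: "k > 0" unfolding k_def using Q(3) by (simp add: prod_pos prime_gt_0_nat)
  have g_mult: "g (m * n) = g m * g n" for m n
    using Q(3) by (simp add: g_def flipped_Legendre_mult prod.distrib)
  have g_values: "g n \<in> {-1, 0, 1}" for n
  proof -
    have "(\<Prod>q\<in>X. flipped_Legendre q n) \<in> {-1, 0, 1}" for X
    proof (induction X rule: infinite_finite_induct)
      case (insert q X)
      then show ?case using flipped_Legendre_values[of q n] by auto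
    qed auto
    then show ?thesis by (simp add: g_def)
  qed
  have g_cong: "g m = g n" if "[m = n] (mod k)" for m n
    unfolding g_def
  proof (rule prod.cong)
    fix q assume "q \<in> Q"
    then have "8 * q dvd k" using Q(1) by (auto simp: k_def)
    then show "flipped_Legendre q m = flipped_Legendre q n"
      using that by (intro flipped_Legendre_cong) (rule cong_dvd_modulus_nat)
  qed auto
  have g_0: "g 0 = 0"
  proof -
    obtain q where q: "q \<in> Q" using Q by auto
    have "flipped_Legendre q 0 = 0" by (simp add: flipped_Legendre_def char8_def Legendre_def)
    then show ?thesis using q Q(1) by (auto simp: g_def prod_zero_iff)
  qed
  have g_1: "g 1 = 1"
  proof -
    have "flipped_Legendre q 1 = 1" if "q \<in> Q" for q
      using that Q(3)[of q] prime_ge_2_nat[of q] Legendre_1[of q]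
      by (auto simp: flipped_Legendre_def char8_def char4_def)
    then show ?thesis by (simp add: g_def)
  qed
  obtain c where c: "coprime c k" "g c = -1"
    using exists_character_value_minus_1[OF Q] unfolding k_def g_def by blast
  have sum0: "(\<Sum>n<k. g n) = 0"
  proof -
    \<comment> \<open>Multiplication by c permutes the residues modulo k and, as
      \<open>g c = -1\<close>, changes the sign of every term; so the sum over a period is its own
      negative.\<close>
    have bij: "bij_betw (\<lambda>n. c * n mod k) {..<k} {..<k}"
    proof (rule bij_betw_imageI)
      show inj: "inj_on (\<lambda>n. c * n mod k) {..<k}"
      proof (rule inj_onI)
        fix x y assume xy: "x \<in> {..<k}" "y \<in> {..<k}" "c * x mod k = c * y mod k"
        then have "[x = y] (mod k)" using cong_mult_lcancel_nat[OF c(1)] by (simp add: Cong.cong_def)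
        then show "x = y" using xy by (simp add: Cong.cong_def)
      qed
      show "(\<lambda>n. c * n mod k) ` {..<k} = {..<k}"
        by (rule endo_inj_surj[OF _ _ inj]) (use k in auto)
    qed
    have "(\<Sum>n<k. g n) = (\<Sum>n<k. g (c * n mod k))"
      by (rule sum.reindex_bij_betw[OF bij, symmetric])
    also have "\<dots> = (\<Sum>n<k. - g n)"
    proof (rule sum.cong)
      fix n
      have "g (c * n mod k) = g (c * n)" by (rule g_cong) (simp add: Cong.cong_def)
      then show "g (c * n mod k) = - g n" using c by (simp add: g_mult)
    qed auto
    finally show ?thesis by (simp add: sum_negf)
  qed
  have "quadratic_character h (real k)"
  proof
    show "h n \<in> {-1, 0, 1}" for n using g_values[of n] by (auto simp: h_def)
    show "\<bar>\<Sum>n\<le>N. h n\<bar> \<le> real k" for N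
    proof (rule periodic_sum_bounded[OF k])
      show "h (n + k) = h n" for n unfolding h_def using g_cong[of "n + k" n] by (simp add: Cong.cong_def)
      show "(\<Sum>n<k. h n) = 0" unfolding h_def using sum0 by (simp flip: of_int_sum)
      show "\<bar>h n\<bar> \<le> 1" for n using g_values[of n] by (auto simp: h_def)
    qed
  qed (use g_0 g_1 in \<open>simp_all add: h_def g_mult\<close>)
  moreover have "h p = of_int (\<Prod>q\<in>Q. Legendre (int q) (int p))" if "prime p" "2 < p" "p \<notin> Q" for p
  proof -
    have "g p = (\<Prod>q\<in>Q. Legendre (int q) (int p))"
      unfolding g_def
    proof (rule prod.cong)
      fix q assume "q \<in> Q"
      then show "flipped_Legendre q p = Legendre (int q) (int p)"
        using that Q(3) by (intro flipped_Legendre_prime) auto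
    qed auto
    then show ?thesis by (simp add: h_def)
  qed
  ultimately show ?thesis using that by blast
qed

section \<open>Orthogonality over the binary span\<close>

text \<open>Coordinates with respect to a basis; taking them as extensional functions makes the
  coefficient family of a vector unique.\<close>

lemma (in vectorspace) card_carrier_eq:
  assumes fd: "fin_dim" and finK: "finite (carrier K)"
  shows "finite (carrier V)" "card (carrier V) = card (carrier K) ^ dim"
proof -
  obtain B where B: "finite B" "basis B" using finite_basis_exists[OF fd] by blast
  have BV: "B \<subseteq> carrier V" using B(2) by (simp add: basis_def)
  have uniq: "\<exists>!a. a \<in> B \<rightarrow>\<^sub>E carrier K \<and> lincomb a B = v" if "v \<in> carrier V" for v
    using basis_criterion[OF B(1) BV] B(2) that by blast
  have "bij_betw (\<lambda>a. lincomb a B) (B \<rightarrow>\<^sub>E carrier K) (carrier V)"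
  proof (rule bij_betw_imageI)
    have closed: "lincomb a B \<in> carrier V" if "a \<in> B \<rightarrow>\<^sub>E carrier K" for a
      using that BV by (intro lincomb_closed) (auto simp: PiE_def)
    show "inj_on (\<lambda>a. lincomb a B) (B \<rightarrow>\<^sub>E carrier K)"
    proof (rule inj_onI)
      fix a b assume ab: "a \<in> B \<rightarrow>\<^sub>E carrier K" "b \<in> B \<rightarrow>\<^sub>E carrier K" "lincomb a B = lincomb b B"
      show "a = b" using uniq[OF closed[OF ab(1)]] ab by metis
    qed
    show "(\<lambda>a. lincomb a B) ` (B \<rightarrow>\<^sub>E carrier K) = carrier V"
    proof (intro equalityI subsetI)
      fix v assume "v \<in> carrier V"
      from uniq[OF this] show "v \<in> (\<lambda>a. lincomb a B) ` (B \<rightarrow>\<^sub>E carrier K)" by blast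
    qed (use closed in auto)
  qed
  from bij_betw_same_card[OF this] bij_betw_finite[OF this]
  show "finite (carrier V)" "card (carrier V) = card (carrier K) ^ dim"
    using B finK dim_basis[OF B] by (simp_all add: card_PiE finite_PiE)
qed

abbreviation bit_span :: "nat \<Rightarrow> bit Matrix.vec set \<Rightarrow> bit Matrix.vec set" where
  "bit_span n X \<equiv> module.span class_ring (module_vec TYPE(bit) n) X"

context
  fixes n :: nat and X :: "bit Matrix.vec set"
  assumes X: "finite X" "X \<subseteq> carrier_vec n"
begin

interpretation vec_space "TYPE(bit)" n .

lemma submodule_bit_span: "submodule class_ring (bit_span n X) (module_vec TYPE(bit) n)"
  using X(2) by (intro span_is_submodule) auto

lemma bit_span_closed:
  "X \<subseteq> bit_span n X" "bit_span n X \<subseteq> carrier_vec n" "0\<^sub>v n \<in> bit_span n X"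
  "v \<in> bit_span n X \<Longrightarrow> w \<in> bit_span n X \<Longrightarrow> v + w \<in> bit_span n X"
proof -
  show "X \<subseteq> bit_span n X" using X(2) by (intro in_own_span) simp
  show "bit_span n X \<subseteq> carrier_vec n" using submodule.subset[OF submodule_bit_span] by simp
  show "0\<^sub>v n \<in> bit_span n X" using submodule.zero_closed[OF submodule_bit_span] by simp
  show "v \<in> bit_span n X \<Longrightarrow> w \<in> bit_span n X \<Longrightarrow> v + w \<in> bit_span n X"
    using submodule.m_closed[OF submodule_bit_span, of v w] by simp
qed

lemma card_bit_span: "finite (bit_span n X)" "card (bit_span n X) = 2 ^ span_dim n X"
proof -
  have vs: "vectorspace class_ring (span_vs X)"
    using span_is_subspace[OF X(2)] subspace_is_vs by simp
  have fd: "vectorspace.fin_dim class_ring (span_vs X)" using X by (intro fin_dim_span) auto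
  have K: "finite (carrier (class_ring :: bit ring))" "card (carrier (class_ring :: bit ring)) = 2"
  proof -
    have "carrier (class_ring :: bit ring) = {0, 1}"
    proof (intro equalityI subsetI)
      show "x \<in> {0, 1}" for x :: bit by (cases x) auto
    qed simp
    then show "finite (carrier (class_ring :: bit ring))" "card (carrier (class_ring :: bit ring)) = 2"
      by (simp_all only: finite.intros card_2_iff', auto)
  qed
  show "finite (bit_span n X)" "card (bit_span n X) = 2 ^ span_dim n X"
    using vectorspace.card_carrier_eq[OF vs fd K(1)] K(2) by (simp_all add: span_dim_def)
qed

text \<open>The vectors with value 1 form a submodule: over \<open>bit\<close> the only scalars are
  0 and 1, so closure under scaling comes from the value at the zero vector.\<close>

lemma bit_span_character_eq_1:
  fixes f :: "bit Matrix.vec \<Rightarrow> int"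
  assumes f: "\<And>v w. v \<in> carrier_vec n \<Longrightarrow> w \<in> carrier_vec n \<Longrightarrow> f (v + w) = f v * f w"
      "f (0\<^sub>v n) = 1" "\<And>v. v \<in> X \<Longrightarrow> f v = 1" and w: "w \<in> bit_span n X"
  shows "f w = 1"
proof -
  have "submodule class_ring {v \<in> carrier_vec n. f v = 1} V"
  proof
    fix c :: bit and v assume v: "v \<in> {v \<in> carrier_vec n. f v = 1}"
    show "c \<odot>\<^bsub>V\<^esub> v \<in> {v \<in> carrier_vec n. f v = 1}"
      using v f by (cases c) auto
  qed (use f in auto)
  then have "span X \<subseteq> {v \<in> carrier_vec n. f v = 1}"
    using f(3) X by (intro span_is_subset) auto
  then show ?thesis using w by auto
qed

end

text \<open>Translation by \<open>v\<close> permutes \<open>W\<close> and multiplies the sum by a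
  value different from 1. Cancellation is a hypothesis because the type of vectors mixes all
  dimensions and is not a group.\<close>

lemma sum_character_eq_0:
  fixes f :: "'a :: plus \<Rightarrow> int"
  assumes W: "finite W" "\<And>v w. v \<in> W \<Longrightarrow> w \<in> W \<Longrightarrow> v + w \<in> W"
    and f: "\<And>v w. v \<in> W \<Longrightarrow> w \<in> W \<Longrightarrow> f (v + w) = f v * f w"
    and inj: "\<And>v. v \<in> W \<Longrightarrow> inj_on ((+) v) W" and v: "v \<in> W" "f v \<noteq> 1"
  shows "(\<Sum>w\<in>W. f w) = 0"
proof -
  have "(+) v ` W = W" by (rule endo_inj_surj) (use W inj v in auto)
  then have "bij_betw ((+) v) W W" using inj v by (simp add: bij_betw_def)
  then have "(\<Sum>w\<in>W. f w) = (\<Sum>w\<in>W. f (v + w))" by (rule sum.reindex_bij_betw[symmetric])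
  also have "\<dots> = f v * (\<Sum>w\<in>W. f w)" using f v by (simp add: sum_distrib_left)
  finally have "(f v - 1) * (\<Sum>w\<in>W. f w) = 0" by (simp add: algebra_simps)
  then show ?thesis using v by simp
qed

section \<open>Legendre symbols as characters of the binary vector space\<close>

definition support :: "nat set \<Rightarrow> bit Matrix.vec \<Rightarrow> nat set" where
  "support A w = (\<lambda>i. sorted_list_of_set A ! i) ` {i. i < card A \<and> vec_index w i = 1}"

text \<open>The character of F^n attached to p, determined by its values at the unit vectors. It is
  multiplicative when p divides no element of \<open>A\<close>.\<close>

definition Legendre_vec :: "nat set \<Rightarrow> nat \<Rightarrow> bit Matrix.vec \<Rightarrow> int" where
  "Legendre_vec A p w = (\<Prod>i<card A. if vec_index w i = 1
     then Legendre (int (sorted_list_of_set A ! i)) (int p) else 1)"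

lemma Legendre_vec_eq_prod_support:
  assumes "finite A"
  shows "Legendre_vec A p w = (\<Prod>q\<in>support A w. Legendre (int q) (int p))"
proof -
  have "inj_on (\<lambda>i. sorted_list_of_set A ! i) {..<card A}"
    using assms by (intro inj_on_nth) auto
  then have inj: "inj_on (\<lambda>i. sorted_list_of_set A ! i) {i. i < card A \<and> vec_index w i = 1}"
    by (rule inj_on_subset) auto
  have "Legendre_vec A p w = (\<Prod>i | i \<in> {..<card A} \<and> vec_index w i = 1. Legendre (int (sorted_list_of_set A ! i)) (int p))"
    unfolding Legendre_vec_def by (rule prod.inter_filter[symmetric]) simp
  also have "\<dots> = (\<Prod>q\<in>support A w. Legendre (int q) (int p))"
    unfolding support_def by (subst prod.reindex[OF inj]) simp
  finally show ?thesis .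
qed

lemma support_subset: "finite A \<Longrightarrow> support A w \<subseteq> A"
  unfolding support_def using nth_mem[of _ "sorted_list_of_set A"] by auto

lemma support_incidence_vec:
  assumes "finite A" "X \<subseteq> A"
  shows "support A (incidence_vec A X) = X"
proof -
  have "x \<in> support A (incidence_vec A X)" if x: "x \<in> X" for x
  proof -
    have "x \<in> set (sorted_list_of_set A)" using x assms by auto
    then obtain i where "i < length (sorted_list_of_set A)" "sorted_list_of_set A ! i = x"
      by (metis in_set_conv_nth)
    then show ?thesis using x by (auto simp: support_def incidence_vec_def)
  qed
  then show ?thesis by (auto simp: support_def incidence_vec_def split: if_splits)
qed

text \<open>Nonvanishing symbols square to 1, which matches 1 + 1 = 0 in \<open>bit\<close> at the
  coordinates where both vectors are 1.\<close>

lemma Legendre_vec_add: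
  assumes "\<And>q. q \<in> A \<Longrightarrow> Legendre (int q) (int p) \<noteq> 0" "finite A"
    and "v \<in> carrier_vec (card A)" "w \<in> carrier_vec (card A)"
  shows "Legendre_vec A p (v + w) = Legendre_vec A p v * Legendre_vec A p w"
  unfolding Legendre_vec_def prod.distrib[symmetric]
proof (rule prod.cong)
  fix i assume i: "i \<in> {..<card A}"
  then have "sorted_list_of_set A ! i \<in> A"
    using nth_mem[of i "sorted_list_of_set A"] assms(2) by auto
  then have "Legendre (int (sorted_list_of_set A ! i)) (int p) * Legendre (int (sorted_list_of_set A ! i)) (int p) = 1"
    using assms(1) Legendre_values[of "int (sorted_list_of_set A ! i)" "int p"] by fastforce
  moreover have "vec_index (v + w) i = vec_index v i + vec_index w i" using i assms by simp
  ultimately show "(if vec_index (v + w) i = 1 then Legendre (int (sorted_list_of_set A ! i)) (int p) else 1) =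
      (if vec_index v i = 1 then Legendre (int (sorted_list_of_set A ! i)) (int p) else 1) *
      (if vec_index w i = 1 then Legendre (int (sorted_list_of_set A ! i)) (int p) else 1)"
    by (cases "vec_index v i"; cases "vec_index w i") auto
qed auto

lemma Legendre_vec_0: "Legendre_vec A p (0\<^sub>v (card A)) = 1"
  by (simp add: Legendre_vec_def)

lemma multiplicity_int_int:
  assumes "prime p"
  shows "multiplicity (int p) (int m) = multiplicity p m"
proof (cases "m = 0")
  case False
  have "k \<le> multiplicity (int p) (int m) \<longleftrightarrow> k \<le> multiplicity p m" for k
  proof -
    have "k \<le> multiplicity (int p) (int m) \<longleftrightarrow> int p ^ k dvd int m"
      using False assms prime_gt_1_nat[OF assms] by (intro power_dvd_iff_le_multiplicity[symmetric]) auto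
    also have "\<dots> \<longleftrightarrow> p ^ k dvd m" by (simp flip: of_nat_power)
    also have "\<dots> \<longleftrightarrow> k \<le> multiplicity p m"
      using False assms prime_gt_1_nat[OF assms] by (intro power_dvd_iff_le_multiplicity) auto
    finally show ?thesis .
  qed
  then show ?thesis by (meson le_antisym order_refl)
qed simp

lemma pi_odd_conv_nat:
  "pi_odd (int m) = {p. prime p \<and> p dvd m \<and> odd (multiplicity p m)}"
  by (auto simp: pi_odd_def multiplicity_int_int)

lemma finite_pi_odd: "z > 0 \<Longrightarrow> finite (pi_odd z)"
  by (rule finite_subset[of _ "{..nat z}"]) (auto simp: pi_odd_def dest!: zdvd_imp_le)

lemma Legendre_power:
  assumes "prime p" "2 < p"
  shows "Legendre (a ^ k) (int p) = Legendre a (int p) ^ k"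
  by (induction k) (use assms in \<open>auto simp: Legendre_1 Legendre_mult\<close>)

text \<open>As p does not divide z, every symbol of a prime factor is 1 or -1, so even exponents
  drop out of the factorization.\<close>

lemma Legendre_eq_prod_pi_odd:
  assumes p: "prime p" "2 < p" and z: "z > 0" "\<not> int p dvd z"
  shows "Legendre z (int p) = (\<Prod>q\<in>pi_odd z. Legendre (int q) (int p))"
proof -
  define m where "m = nat z"
  have zm: "z = int m" "m > 0" using z by (auto simp: m_def)
  have m: "m = (\<Prod>q\<in>prime_factors m. q ^ multiplicity q m)"
    using zm by (intro prime_factorization_nat) auto
  have "Legendre z (int p) = Legendre (\<Prod>q\<in>prime_factors m. int q ^ multiplicity q m) (int p)"
    unfolding zm by (subst m) (simp only: of_nat_prod of_nat_power)
  also have "\<dots> = (\<Prod>q\<in>prime_factors m. Legendre (int q) (int p) ^ multiplicity q m)"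
    by (simp add: Legendre_prime_prod[OF p] Legendre_power[OF p])
  also have "\<dots> = (\<Prod>q\<in>prime_factors m. if odd (multiplicity q m) then Legendre (int q) (int p) else 1)"
  proof (rule prod.cong)
    fix q assume q: "q \<in> prime_factors m"
    then have "\<not> p dvd q" using z zm by (auto dest: dvd_trans)
    then have "Legendre (int q) (int p) \<noteq> 0" by (simp add: Legendre_eq_0_iff)
    then have "Legendre (int q) (int p) = 1 \<or> Legendre (int q) (int p) = -1"
      using Legendre_values[of "int q" "int p"] by auto
    then show "Legendre (int q) (int p) ^ multiplicity q m = (if odd (multiplicity q m) then Legendre (int q) (int p) else 1)"
      by auto
  qed auto
  also have "\<dots> = (\<Prod>q | q \<in> prime_factors m \<and> odd (multiplicity q m). Legendre (int q) (int p))"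
    by (rule prod.inter_filter[symmetric]) simp
  also have "{q. q \<in> prime_factors m \<and> odd (multiplicity q m)} = pi_odd z"
    unfolding zm(1) pi_odd_conv_nat using zm(2) by (auto simp: prime_factors_dvd)
  finally show ?thesis .
qed

section \<open>Averages over primes and densities\<close>

lemma prime_counting_at_top: "filterlim (\<lambda>N. real (card (primes_upto N))) at_top sequentially"
proof (rule filterlim_at_top_mono)
  show "filterlim (\<lambda>N::nat. real N / 4 / ln (real N)) at_top sequentially" by real_asymp
  show "\<forall>\<^sub>F N in sequentially. real N / 4 / ln (real N) \<le> real (card (primes_upto N))"
    using chebyshev_lower eventually_ge_at_top[of 2] by eventually_elim (simp add: divide_le_eq)
qed

lemma sum_primes_diff_finite_small:
  fixes g :: "nat \<Rightarrow> real"
  assumes E: "finite E" and g: "\<And>p. \<bar>g p\<bar> \<le> 1"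
    and lim: "(\<lambda>N. (\<Sum>p\<in>primes_upto N. g p) / real (card (primes_upto N))) \<longlonglongrightarrow> l"
  shows "(\<lambda>N. (\<Sum>p | prime p \<and> p \<le> N \<and> p \<notin> E. g p) / real (card (primes_upto N))) \<longlonglongrightarrow> l"
proof -
  let ?c = "\<lambda>N. real (card (primes_upto N))"
  have "(\<lambda>N. (\<Sum>p | prime p \<and> p \<le> N \<and> p \<in> E. g p) / ?c N) \<longlonglongrightarrow> 0"
  proof (rule Lim_null_comparison)
    show "(\<lambda>N. real (card E) / ?c N) \<longlonglongrightarrow> 0"
      by (rule tendsto_divide_0[OF tendsto_const filterlim_at_top_imp_at_infinity[OF prime_counting_at_top]])
    show "\<forall>\<^sub>F N in sequentially. norm ((\<Sum>p | prime p \<and> p \<le> N \<and> p \<in> E. g p) / ?c N) \<le> real (card E) / ?c N"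
    proof (intro always_eventually allI)
      fix N
      have "\<bar>\<Sum>p | prime p \<and> p \<le> N \<and> p \<in> E. g p\<bar> \<le> (\<Sum>p | prime p \<and> p \<le> N \<and> p \<in> E. 1)"
        using g by (intro order_trans[OF sum_abs] sum_mono) auto
      also have "\<dots> \<le> real (card E)" using E by (auto intro!: card_mono)
      finally show "norm ((\<Sum>p | prime p \<and> p \<le> N \<and> p \<in> E. g p) / ?c N) \<le> real (card E) / ?c N"
        by (simp add: abs_divide divide_right_mono)
    qed
  qed
  from tendsto_diff[OF lim this]
  have "(\<lambda>N. ((\<Sum>p\<in>primes_upto N. g p) - (\<Sum>p | prime p \<and> p \<le> N \<and> p \<in> E. g p)) / ?c N) \<longlonglongrightarrow> l"
    by (simp add: diff_divide_distrib)
  also have "(\<lambda>N. (\<Sum>p\<in>primes_upto N. g p) - (\<Sum>p | prime p \<and> p \<le> N \<and> p \<in> E. g p)) =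
      (\<lambda>N. \<Sum>p | prime p \<and> p \<le> N \<and> p \<notin> E. g p)"
  proof
    fix N
    have "(\<Sum>p\<in>primes_upto N. g p) = (\<Sum>p | prime p \<and> p \<le> N \<and> p \<notin> E. g p) + (\<Sum>p | prime p \<and> p \<le> N \<and> p \<in> E. g p)"
      by (subst sum.union_disjoint[symmetric]) (auto intro!: sum.cong finite_subset[OF _ finite_primes_upto[of N]])
    then show "(\<Sum>p\<in>primes_upto N. g p) - (\<Sum>p | prime p \<and> p \<le> N \<and> p \<in> E. g p) = (\<Sum>p | prime p \<and> p \<le> N \<and> p \<notin> E. g p)"
      by simp
  qed
  finally show ?thesis .
qed

text \<open>A nonzero vector has nonempty support, so a nonprincipal character \<open>h\<close>
  agrees with \<open>Legendre_vec\<close> outside \<open>E\<close> and has mean 0 over the primes.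
  For the zero vector every value is 1.\<close>

lemma Legendre_vec_average:
  assumes A: "finite A" "\<And>q. q \<in> A \<Longrightarrow> prime q" and w: "w \<in> carrier_vec (card A)"
    and E: "finite E" "A \<subseteq> E" "2 \<in> E"
  shows "(\<lambda>N. (\<Sum>p | prime p \<and> p \<le> N \<and> p \<notin> E. real_of_int (Legendre_vec A p w)) / real (card (primes_upto N)))
     \<longlonglongrightarrow> (if w = 0\<^sub>v (card A) then 1 else 0)"
proof (cases "w = 0\<^sub>v (card A)")
  case True
  have "(\<lambda>N. (\<Sum>p | prime p \<and> p \<le> N \<and> p \<notin> E. 1) / real (card (primes_upto N))) \<longlonglongrightarrow> 1"
  proof (rule sum_primes_diff_finite_small[OF E(1)])
    have "\<forall>\<^sub>F N in sequentially. real (card (primes_upto N)) > 0"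
      using prime_counting_at_top by (rule filterlim_at_top_dense[THEN iffD1, rule_format])
    then have "\<forall>\<^sub>F N in sequentially. 1 = (\<Sum>p\<in>primes_upto N. 1) / real (card (primes_upto N))"
    proof eventually_elim
      case (elim N)
      have "(\<Sum>p\<in>primes_upto N. 1) = real (card (primes_upto N))" by simp
      then show ?case using elim by (metis divide_self less_irrefl)
    qed
    then show "(\<lambda>N. (\<Sum>p\<in>primes_upto N. 1) / real (card (primes_upto N))) \<longlonglongrightarrow> 1"
      by (rule Lim_transform_eventually[OF tendsto_const])
  qed auto
  then show ?thesis using True by (simp add: Legendre_vec_0)
next
  case False
  have "\<exists>i<card A. vec_index w i \<noteq> 0"
  proof (rule ccontr)
    assume "\<not> (\<exists>i<card A. vec_index w i \<noteq> 0)"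
    then have "w = 0\<^sub>v (card A)" using w by (intro eq_vecI) auto
    then show False using False by simp
  qed
  then obtain i where i: "i < card A" "vec_index w i \<noteq> 0" by blast
  then have "vec_index w i = 1" by (cases "vec_index w i") auto
  then have ne: "support A w \<noteq> {}" using i by (auto simp: support_def)
  have sub: "support A w \<subseteq> A" using A(1) by (rule support_subset)
  obtain h C where h: "quadratic_character h C"
    "\<And>p. prime p \<Longrightarrow> 2 < p \<Longrightarrow> p \<notin> support A w \<Longrightarrow> h p = of_int (\<Prod>q\<in>support A w. Legendre (int q) (int p))"
    using exists_quadratic_character[of "support A w"] ne sub A finite_subset[OF sub] by blast
  interpret quadratic_character h C by (rule h)
  have "(\<lambda>N. (\<Sum>p | prime p \<and> p \<le> N \<and> p \<notin> E. h p) / real (card (primes_upto N))) \<longlonglongrightarrow> 0"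
    by (rule sum_primes_diff_finite_small[OF E(1) abs_h_le_1 sum_h_primes_small])
  also have "(\<lambda>N. \<Sum>p | prime p \<and> p \<le> N \<and> p \<notin> E. h p) = (\<lambda>N. \<Sum>p | prime p \<and> p \<le> N \<and> p \<notin> E. real_of_int (Legendre_vec A p w))"
  proof
    fix N
    show "(\<Sum>p | prime p \<and> p \<le> N \<and> p \<notin> E. h p) = (\<Sum>p | prime p \<and> p \<le> N \<and> p \<notin> E. real_of_int (Legendre_vec A p w))"
    proof (rule sum.cong)
      fix p assume p: "p \<in> {p. prime p \<and> p \<le> N \<and> p \<notin> E}"
      then have "p \<noteq> 2" "p \<notin> support A w" using E sub by auto
      then show "h p = real_of_int (Legendre_vec A p w)"
        using p prime_ge_2_nat[of p] h(2)[of p] by (simp add: Legendre_vec_eq_prod_support[OF A(1)])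
    qed auto
  qed
  finally show ?thesis using False by simp
qed

lemma has_prime_densityI:
  assumes P: "\<And>p. p \<in> P \<Longrightarrow> prime p"
    and lim: "(\<lambda>N. real (card {p \<in> P. p \<le> N}) / real (card (primes_upto N))) \<longlonglongrightarrow> \<delta>"
  shows "has_prime_density P \<delta>"
proof -
  have "filterlim (\<lambda>x::real. nat \<lfloor>x\<rfloor>) sequentially at_top"
    by (rule filterlim_compose[OF filterlim_nat_sequentially filterlim_floor_sequentially])
  from filterlim_compose[OF lim this]
  have "((\<lambda>x::real. real (card {p \<in> P. p \<le> nat \<lfloor>x\<rfloor>}) / real (card {p. prime p \<and> p \<le> nat \<lfloor>x\<rfloor>})) \<longlongrightarrow> \<delta>) at_top" .
  moreover have "\<forall>\<^sub>F x::real in at_top. real (card {p \<in> P. p \<le> nat \<lfloor>x\<rfloor>}) / real (card {p. prime p \<and> p \<le> nat \<lfloor>x\<rfloor>}) =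
      real (card {p \<in> P. real p \<le> x}) / real (card {q::nat. prime q \<and> real q \<le> x})"
    using eventually_ge_at_top[of 0]
  proof eventually_elim
    case (elim x)
    then have "p \<le> nat \<lfloor>x\<rfloor> \<longleftrightarrow> real p \<le> x" for p by (simp add: le_nat_iff le_floor_iff)
    then show ?case by simp
  qed
  ultimately show ?thesis unfolding has_prime_density_def by (rule Lim_transform_eventually)
qed

theorem theorem4p9:
  fixes S :: "int set"
  assumes "finite S" and "S \<noteq> {}" and "\<forall>z\<in>S. z > 0"
  shows "let \<S> = pi_odd ` S;
             A = \<Union>\<S>;
             n = card A;
             d = span_dim n (incidence_vec A ` \<S>)
         in has_prime_density
              {p::nat. prime p \<and> odd p \<and> (\<forall>z\<in>S. Legendre z (int p) = 1)}
              (1 / 2 ^ d)"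
proof -
  define A where "A = \<Union>(pi_odd ` S)"
  define X where "X = incidence_vec A ` pi_odd ` S"
  define P where "P = {p::nat. prime p \<and> odd p \<and> (\<forall>z\<in>S. Legendre z (int p) = 1)}"
  have A: "finite A" "\<And>q. q \<in> A \<Longrightarrow> prime q"
    using assms finite_pi_odd by (auto simp: A_def pi_odd_def)
  have "finite X" "X \<subseteq> carrier_vec (card A)"
    using assms by (auto simp: X_def incidence_vec_def)
  note X = this
  define d where "d = span_dim (card A) X"
  define W where "W = bit_span (card A) X"
  have W: "finite W" "card W = 2 ^ d" "X \<subseteq> W" "W \<subseteq> carrier_vec (card A)"
    "0\<^sub>v (card A) \<in> W" "\<And>v w. v \<in> W \<Longrightarrow> w \<in> W \<Longrightarrow> v + w \<in> W"
    unfolding W_def d_def by (fact card_bit_span[OF X] bit_span_closed[OF X])+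
  define E where "E = insert 2 {p. prime p \<and> (\<exists>z\<in>S. int p dvd z)}"
  have E: "finite E" "A \<subseteq> E" "2 \<in> E"
  proof -
    have "{p. prime p \<and> (\<exists>z\<in>S. int p dvd z)} \<subseteq> (\<Union>z\<in>S. {..nat z})"
    proof
      fix p assume "p \<in> {p. prime p \<and> (\<exists>z\<in>S. int p dvd z)}"
      then obtain z where z: "z \<in> S" "int p dvd z" by blast
      then have "int p \<le> z" using assms(3) zdvd_imp_le by blast
      then have "p \<le> nat z" by linarith
      then show "p \<in> (\<Union>z\<in>S. {..nat z})" using z by auto
    qed
    moreover have "finite (\<Union>z\<in>S. {..nat z})" using assms by simp
    ultimately show "finite E" unfolding E_def by (simp add: finite_subset)
  qed (auto simp: E_def A_def pi_odd_def)
  have P_E: "p \<notin> E" if "p \<in> P" for p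
  proof -
    have "\<not> int p dvd z" if "z \<in> S" for z
      using that \<open>p \<in> P\<close> Legendre_eq_0_iff[of z p] by (auto simp: P_def)
    then show ?thesis using that by (auto simp: E_def P_def)
  qed
  \<comment> \<open>If p is in \<open>P\<close>, the character of p is trivial on the generators and
    hence on \<open>W\<close>. Otherwise some generator \<open>incidence_vec A (pi_odd z)\<close>
    has a value different from 1, and the sum over the group vanishes.\<close>
  have orthogonality: "(\<Sum>w\<in>W. Legendre_vec A p w) = (if p \<in> P then 2 ^ d else 0)"
    if p: "prime p" "p \<notin> E" for p
  proof -
    have p2: "2 < p" using p prime_ge_2_nat[of p] by (auto simp: E_def le_less)
    have odd: "odd p" using p p2 prime_odd_nat by auto
    have nz: "Legendre (int q) (int p) \<noteq> 0" if "q \<in> A" for q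
    proof -
      have "\<not> p dvd q" using that A p E(2) primes_dvd_imp_eq by blast
      then show ?thesis by (simp add: Legendre_eq_0_iff)
    qed
    note add = Legendre_vec_add[OF nz A(1)]
    have val: "Legendre_vec A p (incidence_vec A (pi_odd z)) = Legendre z (int p)" if z: "z \<in> S" for z
    proof -
      have "Legendre_vec A p (incidence_vec A (pi_odd z)) = (\<Prod>q\<in>pi_odd z. Legendre (int q) (int p))"
      proof -
        have "pi_odd z \<subseteq> A" using z by (auto simp: A_def)
        then show ?thesis by (simp only: Legendre_vec_eq_prod_support[OF A(1)] support_incidence_vec[OF A(1)])
      qed
      also have "\<dots> = Legendre z (int p)"
        using z p assms by (intro Legendre_eq_prod_pi_odd[symmetric] p2) (auto simp: E_def)
      finally show ?thesis .
    qed
    show ?thesis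
    proof (cases "p \<in> P")
      case True
      have "Legendre_vec A p w = 1" if "w \<in> W" for w
      proof (rule bit_span_character_eq_1[OF X])
        show "w \<in> bit_span (card A) X" using that by (simp add: W_def)
        show "Legendre_vec A p v = 1" if "v \<in> X" for v
          using that val True by (auto simp: X_def P_def)
      qed (use add Legendre_vec_0 in auto)
      then show ?thesis using True W(2) by simp
    next
      case False
      then obtain z where z: "z \<in> S" "Legendre z (int p) \<noteq> 1" using p odd by (auto simp: P_def)
      have "(\<Sum>w\<in>W. Legendre_vec A p w) = 0"
      proof (rule sum_character_eq_0[OF W(1,6)])
        show "incidence_vec A (pi_odd z) \<in> W" using W(3) z by (auto simp: X_def)
        show "Legendre_vec A p (incidence_vec A (pi_odd z)) \<noteq> 1" using val z by simp
        show "inj_on ((+) v) W" if "v \<in> W" for v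
        proof (rule inj_onI)
          fix x y assume xy: "x \<in> W" "y \<in> W" "v + x = v + y"
          then have carrier: "v \<in> carrier_vec (card A)" "x \<in> carrier_vec (card A)" "y \<in> carrier_vec (card A)"
            using that W(4) by auto
          show "x = y"
          proof (rule eq_vecI)
            fix i assume i: "i < dim_vec y"
            then have "i < dim_vec x" using carrier by simp
            then have "vec_index v i + vec_index x i = vec_index v i + vec_index y i"
              using arg_cong[OF xy(3), of "\<lambda>u. vec_index u i"] i by (simp only: index_add_vec(1))
            then show "vec_index x i = vec_index y i" by (rule add_left_imp_eq)
          qed (use carrier in simp)
        qed
      qed (use add W(4) in auto)
      then show ?thesis using False by simp
    qed
  qed
  \<comment> \<open>The count of \<open>P\<close> is written as an average over \<open>W\<close> by
    orthogonality, and the finite sum over \<open>W\<close> is exchanged with the limit; only the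
    zero vector contributes, namely \<open>1 / 2 ^ d\<close>.\<close>
  let ?c = "\<lambda>N. real (card (primes_upto N))"
  have "(\<lambda>N. 1 / 2 ^ d * (\<Sum>w\<in>W. (\<Sum>p | prime p \<and> p \<le> N \<and> p \<notin> E. real_of_int (Legendre_vec A p w)) / ?c N))
     \<longlonglongrightarrow> 1 / 2 ^ d * (\<Sum>w\<in>W. if w = 0\<^sub>v (card A) then 1 else 0)"
    using W(4) by (intro tendsto_mult tendsto_const tendsto_sum Legendre_vec_average A E) auto
  also have "(\<Sum>w\<in>W. if w = 0\<^sub>v (card A) then 1 else 0) = (1 :: real)" using W(1,5) by simp
  also have "(\<lambda>N. 1 / 2 ^ d * (\<Sum>w\<in>W. (\<Sum>p | prime p \<and> p \<le> N \<and> p \<notin> E. real_of_int (Legendre_vec A p w)) / ?c N))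
     = (\<lambda>N. real (card {p \<in> P. p \<le> N}) / ?c N)"
  proof
    fix N
    have fin: "finite {p. prime p \<and> p \<le> N \<and> p \<notin> E}" by (rule finite_subset[of _ "{..N}"]) auto
    have "(\<Sum>w\<in>W. \<Sum>p | prime p \<and> p \<le> N \<and> p \<notin> E. real_of_int (Legendre_vec A p w)) =
        (\<Sum>p | prime p \<and> p \<le> N \<and> p \<notin> E. \<Sum>w\<in>W. real_of_int (Legendre_vec A p w))"
      by (rule sum.swap)
    also have "\<dots> = (\<Sum>p | prime p \<and> p \<le> N \<and> p \<notin> E. if p \<in> P then 2 ^ d else 0)"
    proof (rule sum.cong)
      fix p assume "p \<in> {p. prime p \<and> p \<le> N \<and> p \<notin> E}"
      then show "(\<Sum>w\<in>W. real_of_int (Legendre_vec A p w)) = (if p \<in> P then 2 ^ d else 0)"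
        using orthogonality[of p] by (simp flip: of_int_sum)
    qed auto
    also have "\<dots> = (\<Sum>p | p \<in> {p. prime p \<and> p \<le> N \<and> p \<notin> E} \<and> p \<in> P. 2 ^ d)"
      by (rule sum.inter_filter[OF fin, symmetric])
    also have "{p. p \<in> {p. prime p \<and> p \<le> N \<and> p \<notin> E} \<and> p \<in> P} = {p \<in> P. p \<le> N}"
      using P_E by (auto simp: P_def)
    finally have "(\<Sum>w\<in>W. \<Sum>p | prime p \<and> p \<le> N \<and> p \<notin> E. real_of_int (Legendre_vec A p w)) =
        real (card {p \<in> P. p \<le> N}) * 2 ^ d" by simp
    then show "1 / 2 ^ d * (\<Sum>w\<in>W. (\<Sum>p | prime p \<and> p \<le> N \<and> p \<notin> E. real_of_int (Legendre_vec A p w)) / ?c N)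
        = real (card {p \<in> P. p \<le> N}) / ?c N"
      by (simp flip: sum_divide_distrib)
  qed
  finally have "has_prime_density P (1 / 2 ^ d)"
    by (intro has_prime_densityI) (auto simp: P_def)
  then show ?thesis by (simp add: Let_def P_def A_def X_def d_def)
qed

end
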